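(* Let $\Omega$ be a bounded open interval of $\mathbb{R}$, $H=L^2(\Omega)$, $V=H^1_0(\Omega)$, and let $A=-\Delta$ (i.e. $Aw=-w''$) with domain $D(A)=\{w\in V:\ \Delta w\in H\}$. Let $c>0$, $\alpha\in(0,1)$ and $$s=\max\left\{\frac1{2\alpha},\frac1{2(1-\alpha)}\right\}.$$ Then for every $r$ with $0<r<s$ there is a solution $u$ of $$u''+Au+cA^{\alpha}u'=0$$ with initial data $u(0)=u_0$, $u'(0)=u_1$, $(u_0,u_1)\in V\times H$, such that $u(t)\notin G^r(\Omega)$ for every $t>0$. In particular, if $\alpha\neq1/2$, solutions are not analytic in general for $t>0$: there is a solution $u$ with initial data in $V\times H$ such that for every $t>0$, $u(t)$ is not analytic in $\Omega$.
   Context: Function spaces are real. $A$ is a positive self-adjoint operator on $H$, with $D(A^{1/2})=V$; $A^{\alpha}$ is defined by the spectral theorem, and $(\cdot,\cdot)$ is the inner product of $H$. Solutions are understood in the energy space: $u\in C([0,\infty);V)\cap C^1([0,\infty);H)$ and, for every $w\in D(A)$, the function $t\mapsto (u'(t),w)$ is $C^1$ on $[0,\infty)$ with $\frac{d}{dt}(u'(t),w)+(u(t),Aw)+c\,(u'(t),A^{\alpha}w)=0$; for each $(u_0,u_1)\in V\times H$ there is exactly one such solution with $u(0)=u_0$, $u'(0)=u_1$. Definition (Gevrey functions, one-dimensional case). For $r>0$, $G^r(\Omega)$ is the set of $f:\Omega\to\mathbb{R}$ with $f\in C^\infty(\Omega)$ such that for every compact $K\subset\Omega$ there is $R=R(K)>0$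 with $\|f^{(p)}\|_{L^\infty(K)}\le R^{p}p^{rp}$ for all integers $p\ge1$. Elements of $L^2(\Omega)$ are identified with their smooth representatives when these exist. *)

theory Defs
  imports "HOL-Analysis.Analysis"
begin

section \<open>The space \<open>L\<^sup>2\<close>\<close>

text \<open>Elements of \<open>L\<^sup>2(M)\<close> are handled through representatives: equality in \<open>L\<^sup>2(M)\<close> is
  equality \<open>M\<close>-almost everywhere.\<close>

definition L2 :: "'a measure \<Rightarrow> ('a \<Rightarrow> real) set" where
  "L2 M = {f. f \<in> borel_measurable M \<and> integrable M (\<lambda>x. (f x)\<^sup>2)}"

definition L2_inner :: "'a measure \<Rightarrow> ('a \<Rightarrow> real) \<Rightarrow> ('a \<Rightarrow> real) \<Rightarrow> real" where
  "L2_inner M f g = (\<integral>x. f x * g x \<partial>M)"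

definition L2_norm :: "'a measure \<Rightarrow> ('a \<Rightarrow> real) \<Rightarrow> real" where
  "L2_norm M f = sqrt (L2_inner M f f)"


section \<open>Smooth, Gevrey and analytic functions on an open set of reals\<close>

text \<open>In the following \<open>\<Omega>\<close> is open, and only the values of functions on \<open>\<Omega>\<close> matter.\<close>

definition smooth_on :: "real set \<Rightarrow> (real \<Rightarrow> real) \<Rightarrow> bool" where
  "smooth_on \<Omega> f \<longleftrightarrow> (\<forall>n. \<forall>x\<in>\<Omega>. (deriv ^^ n) f field_differentiable at x)"

text \<open>The derivatives are continuous, so their norm in \<open>L\<^sup>\<infinity>(K)\<close> is read as a supremum over \<open>K\<close>.
  With the essential supremum the same set results, because every compact subset of \<open>\<Omega>\<close> lies in
  the interior of another one.\<close>

definition gevrey :: "real \<Rightarrow> real set \<Rightarrow> (real \<Rightarrow> real) set" where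
  "gevrey r \<Omega> = {f. smooth_on \<Omega> f \<and>
     (\<forall>K. compact K \<and> K \<subseteq> \<Omega> \<longrightarrow>
        (\<exists>R>0. \<forall>p\<ge>1. \<forall>x\<in>K. \<bar>(deriv ^^ p) f x\<bar> \<le> R ^ p * real p powr (r * real p)))}"

definition real_analytic_on :: "real set \<Rightarrow> (real \<Rightarrow> real) \<Rightarrow> bool" where
  "real_analytic_on \<Omega> f \<longleftrightarrow>
     (\<forall>x\<in>\<Omega>. \<exists>\<rho>>0. \<exists>k :: nat \<Rightarrow> real. \<forall>y\<in>\<Omega>. \<bar>y - x\<bar> < \<rho> \<longrightarrow> (\<lambda>n. k n * (y - x) ^ n) sums f y)"


section \<open>Sobolev spaces and the Dirichlet Laplacian\<close>

definition test_functions :: "real set \<Rightarrow> (real \<Rightarrow> real) set" where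
  "test_functions \<Omega> = {\<phi>. smooth_on UNIV \<phi> \<and> (\<exists>K. compact K \<and> K \<subseteq> \<Omega> \<and> (\<forall>x. x \<notin> K \<longrightarrow> \<phi> x = 0))}"

definition has_weak_deriv :: "real set \<Rightarrow> nat \<Rightarrow> (real \<Rightarrow> real) \<Rightarrow> (real \<Rightarrow> real) \<Rightarrow> bool" where
  "has_weak_deriv \<Omega> n f g \<longleftrightarrow>
     (\<forall>\<phi>\<in>test_functions \<Omega>.
        L2_inner (lebesgue_on \<Omega>) f ((deriv ^^ n) \<phi>) = (-1) ^ n * L2_inner (lebesgue_on \<Omega>) g \<phi>)"

definition H1 :: "real set \<Rightarrow> (real \<Rightarrow> real) set" where
  "H1 \<Omega> = {f \<in> L2 (lebesgue_on \<Omega>). \<exists>g\<in>L2 (lebesgue_on \<Omega>). has_weak_deriv \<Omega> 1 f g}"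

definition weak_deriv :: "real set \<Rightarrow> (real \<Rightarrow> real) \<Rightarrow> real \<Rightarrow> real" where
  "weak_deriv \<Omega> f = (SOME g. g \<in> L2 (lebesgue_on \<Omega>) \<and> has_weak_deriv \<Omega> 1 f g)"

definition H1_norm :: "real set \<Rightarrow> (real \<Rightarrow> real) \<Rightarrow> real" where
  "H1_norm \<Omega> f =
     sqrt ((L2_norm (lebesgue_on \<Omega>) f)\<^sup>2 + (L2_norm (lebesgue_on \<Omega>) (weak_deriv \<Omega> f))\<^sup>2)"

definition H1_0 :: "real set \<Rightarrow> (real \<Rightarrow> real) set" where
  "H1_0 \<Omega> = {f \<in> H1 \<Omega>. \<exists>\<phi> :: nat \<Rightarrow> real \<Rightarrow> real.
     (\<forall>n. \<phi> n \<in> test_functions \<Omega>) \<and> (\<lambda>n. H1_norm \<Omega> (\<lambda>x. f x - \<phi> n x)) \<longlonglongrightarrow> 0}"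

text \<open>Unbounded operators are represented by their graphs. The graph of \<open>-\<Delta>\<close> consists of the pairs
  \<open>(w, z)\<close> with \<open>w \<in> H\<^sup>1\<^sub>0\<close>, \<open>z \<in> L\<^sup>2\<close> and \<open>\<Delta>w = -z\<close> in the sense of distributions.\<close>

definition dirichlet_laplacian :: "real set \<Rightarrow> ((real \<Rightarrow> real) \<times> (real \<Rightarrow> real)) set" where
  "dirichlet_laplacian \<Omega> =
     {(w, z). w \<in> H1_0 \<Omega> \<and> z \<in> L2 (lebesgue_on \<Omega>) \<and> has_weak_deriv \<Omega> 2 w (\<lambda>x. - z x)}"


section \<open>Powers of a positive self-adjoint operator\<close>

text \<open>Linearity of \<open>U\<close>, and its compatibility with equality almost everywhere, follow from the
  preservation of inner products.\<close>

definition L2_unitary ::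
    "'a measure \<Rightarrow> 'b measure \<Rightarrow> (('a \<Rightarrow> real) \<Rightarrow> 'b \<Rightarrow> real) \<Rightarrow> bool" where
  "L2_unitary M N U \<longleftrightarrow>
     (\<forall>f\<in>L2 M. U f \<in> L2 N) \<and>
     (\<forall>f\<in>L2 M. \<forall>g\<in>L2 M. L2_inner N (U f) (U g) = L2_inner M f g) \<and>
     (\<forall>g\<in>L2 N. \<exists>f\<in>L2 M. AE x in N. U f x = g x)"

text \<open>The spectral theorem in multiplication form: a positive self-adjoint operator \<open>A\<close> on \<open>L\<^sup>2(M)\<close>
  is unitarily equivalent to the multiplication by a nonnegative measurable function \<open>h\<close> on some
  \<open>L\<^sup>2(N)\<close>, with its maximal domain. As \<open>U\<close> is onto, the equivalence below says in particular that
  \<open>w\<close> is in the domain of \<open>A\<close> iff \<open>h \<cdot> U w\<close> is in \<open>L\<^sup>2(N)\<close>. For separable \<open>L\<^sup>2(M)\<close>, such as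
  \<open>L\<^sup>2(\<Omega>)\<close>, the measure \<open>N\<close> can be taken on the real line.\<close>

definition diagonalizes ::
    "'a measure \<Rightarrow> (('a \<Rightarrow> real) \<times> ('a \<Rightarrow> real)) set \<Rightarrow>
     real measure \<Rightarrow> (real \<Rightarrow> real) \<Rightarrow> (('a \<Rightarrow> real) \<Rightarrow> real \<Rightarrow> real) \<Rightarrow> bool" where
  "diagonalizes M A N h U \<longleftrightarrow>
     A \<subseteq> L2 M \<times> L2 M \<and> L2_unitary M N U \<and>
     h \<in> borel_measurable N \<and> (\<forall>x\<in>space N. 0 \<le> h x) \<and>
     (\<forall>w\<in>L2 M. \<forall>z\<in>L2 M. (w, z) \<in> A \<longleftrightarrow> (AE x in N. U z x = h x * U w x))"

text \<open>The graph of \<open>A\<^sup>\<alpha>\<close>, for \<open>\<alpha> > 0\<close>: it corresponds to the multiplication by \<open>h\<^sup>\<alpha>\<close>, and does not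
  depend on the diagonalization. Note that \<open>0 powr \<alpha> = 0\<close>.\<close>

definition op_powr ::
    "'a measure \<Rightarrow> (('a \<Rightarrow> real) \<times> ('a \<Rightarrow> real)) set \<Rightarrow> real \<Rightarrow>
     (('a \<Rightarrow> real) \<times> ('a \<Rightarrow> real)) set" where
  "op_powr M A \<alpha> = {(w, z). w \<in> L2 M \<and> z \<in> L2 M \<and>
     (\<exists>N h U. diagonalizes M A N h U \<and> (AE x in N. U z x = h x powr \<alpha> * U w x))}"


section \<open>Solutions in the energy space\<close>

text \<open>\<open>v\<close> is the time derivative of \<open>u\<close> as an \<open>L\<^sup>2(\<Omega>)\<close>-valued function; in the weak equation,
  \<open>z = A w\<close> and \<open>y = A\<^sup>\<alpha> w\<close>, and \<open>g\<close> is the derivative of \<open>t \<mapsto> (u'(t), w)\<close>. All derivatives and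
  limits at time \<open>0\<close> are one-sided.\<close>

definition energy_solution ::
    "real set \<Rightarrow> real \<Rightarrow> real \<Rightarrow> (real \<Rightarrow> real) \<Rightarrow> (real \<Rightarrow> real) \<Rightarrow> (real \<Rightarrow> real \<Rightarrow> real) \<Rightarrow> bool"
  where
  "energy_solution \<Omega> c \<alpha> u\<^sub>0 u\<^sub>1 u \<longleftrightarrow> (\<exists>v :: real \<Rightarrow> real \<Rightarrow> real.
     (\<forall>t\<ge>0. u t \<in> H1_0 \<Omega>) \<and>
     (\<forall>t\<ge>0. ((\<lambda>\<tau>. H1_norm \<Omega> (\<lambda>x. u \<tau> x - u t x)) \<longlongrightarrow> 0) (at t within {0..})) \<and>
     (\<forall>t\<ge>0. v t \<in> L2 (lebesgue_on \<Omega>)) \<and>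
     (\<forall>t\<ge>0. ((\<lambda>\<tau>. L2_norm (lebesgue_on \<Omega>) (\<lambda>x. (u \<tau> x - u t x) / (\<tau> - t) - v t x)) \<longlongrightarrow> 0)
        (at t within {0..})) \<and>
     (\<forall>t\<ge>0. ((\<lambda>\<tau>. L2_norm (lebesgue_on \<Omega>) (\<lambda>x. v \<tau> x - v t x)) \<longlongrightarrow> 0) (at t within {0..})) \<and>
     (\<forall>(w, z)\<in>dirichlet_laplacian \<Omega>.
        \<exists>y g. (w, y) \<in> op_powr (lebesgue_on \<Omega>) (dirichlet_laplacian \<Omega>) \<alpha> \<and>
          continuous_on {0..} g \<and>
          (\<forall>t\<ge>0.
             ((\<lambda>\<tau>. L2_inner (lebesgue_on \<Omega>) (v \<tau>) w) has_real_derivative g t) (at t within {0..}) \<and>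
             g t + L2_inner (lebesgue_on \<Omega>) (u t) z + c * L2_inner (lebesgue_on \<Omega>) (v t) y = 0)) \<and>
     (AE x in lebesgue_on \<Omega>. u 0 x = u\<^sub>0 x) \<and>
     (AE x in lebesgue_on \<Omega>. v 0 x = u\<^sub>1 x))"

end

theory Submission
  imports Defs "HOL-Complex_Analysis.Complex_Analysis" "HOL-Real_Asymp.Real_Asymp"
begin

text \<open>
  In the basis of the Dirichlet eigenfunctions the equation decouples into damped oscillators
  \<open>d'' + c \<lambda>\<^sup>\<alpha> d' + \<lambda> d = 0\<close>. If \<open>\<alpha> > 1/2\<close>, or \<open>\<alpha> = 1/2\<close> and \<open>c \<ge> 2\<close>, the oscillators of high frequency
  are overdamped, and the slow characteristic root has the size \<open>\<lambda>\<^sup>1\<^sup>-\<^sup>\<alpha>\<close>; otherwise they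
  oscillate, and the real part of the roots is \<open>- c \<lambda>\<^sup>\<alpha> / 2\<close>. In terms of the frequency
  \<open>\<mu> = \<lambda>\<^sup>1\<^sup>/\<^sup>2\<close> and of \<open>\<sigma> = 1 / s\<close>, there are in both cases modes that decay at most
  like \<open>exp (- C t \<mu>\<^sup>\<sigma>)\<close> (\<open>overdamped_modes\<close>, \<open>oscillating_modes\<close>). On the other hand, if a sine
  series with suitably chosen frequencies is Gevrey of order \<open>r\<close>, then its coefficients are bounded
  by \<open>C exp (- \<kappa> \<mu>\<^sup>1\<^sup>/\<^sup>r)\<close> (\<open>gevrey_coeff_decay\<close>), which is much smaller if \<open>r < s\<close>. The
  statement on analyticity is the case \<open>r = 1\<close>, as analytic functions are Gevrey of order \<open>1\<close>
  (\<open>real_analytic_imp_gevrey_1\<close>) and \<open>s > 1\<close> for \<open>\<alpha> \<noteq> 1/2\<close>.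

  Three choices make this work.

  \<^item> Gevrey regularity is an interior condition, whereas the decay of the sine coefficients also
    reflects the behaviour at the end points; a sine series may well be analytic inside the
    interval and not at its ends. So only every fourth mode is used. The solution then
    has half of the interval as a period, and interior bounds on one period are global bounds.

  \<^item> An oscillating mode vanishes at certain times, and the solution has to be irregular at every
    time. Every third of the modes used starts as a sine instead of a cosine. The
    frequencies of the damped oscillators have second differences that tend to \<open>0\<close>; therefore, at
    each time, all but finitely many blocks of three modes contain one that is not small.

  \<^item> The initial amplitudes are \<open>exp (- \<mu>\<^sup>\<sigma>)\<close>. The lower bound keeps its form, while all
    series involved, with all their derivatives, converge uniformly for \<open>t \<ge> 0\<close>.

  The weak form of the equation involves \<open>A w\<close> and \<open>A\<^sup>\<alpha> w\<close> for all \<open>w\<close> in the domain of \<open>A\<close>. These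
  are accessible because the sine transform diagonalizes the Dirichlet Laplacian
  (\<open>diagonalizes_dirichlet_laplacian\<close>). The ingredients are the totality of the sines
  (\<open>sine_total\<close>), the completeness of \<open>L\<^sup>2\<close> (\<open>L2_complete\<close>), and the approximation of smooth functions
  that vanish at the end points by test functions (\<open>vanishing_smooth_approx\<close>).
\<close>

section \<open>The inner product of \<open>L\<^sup>2\<close>\<close>

lemma L2_measurable: "f \<in> L2 M \<Longrightarrow> f \<in> borel_measurable M"
  by (simp add: L2_def)

lemma abs_mult_le_sum_squares: "\<bar>s * t\<bar> \<le> s\<^sup>2 + (t::real)\<^sup>2"
proof -
  have "0 \<le> (\<bar>s\<bar> - \<bar>t\<bar>)\<^sup>2" by simp
  then have "2 * (\<bar>s\<bar> * \<bar>t\<bar>) \<le> s\<^sup>2 + t\<^sup>2" by (simp add: power2_diff)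
  then show ?thesis
    using mult_nonneg_nonneg[OF abs_ge_zero[of s] abs_ge_zero[of t]]
    unfolding abs_mult by linarith
qed

lemma L2_integrable_mult:
  assumes "f \<in> L2 M" "g \<in> L2 M"
  shows "integrable M (\<lambda>x. f x * g x)"
proof (rule Bochner_Integration.integrable_bound)
  show "integrable M (\<lambda>x. (f x)\<^sup>2 + (g x)\<^sup>2)"
    using assms by (auto simp: L2_def)
  show "(\<lambda>x. f x * g x) \<in> borel_measurable M"
    using assms by (auto simp: L2_def)
  show "AE x in M. norm (f x * g x) \<le> norm ((f x)\<^sup>2 + (g x)\<^sup>2)"
    using abs_mult_le_sum_squares by auto
qed

lemma L2_scale: "f \<in> L2 M \<Longrightarrow> (\<lambda>x. k * f x) \<in> L2 M"
  by (auto simp: L2_def power_mult_distrib)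

lemma L2_add:
  assumes "f \<in> L2 M" "g \<in> L2 M"
  shows "(\<lambda>x. f x + g x) \<in> L2 M"
proof -
  have "(\<lambda>x. (f x + g x)\<^sup>2) = (\<lambda>x. (f x)\<^sup>2 + (g x)\<^sup>2 + 2 * (f x * g x))"
    by (simp add: power2_sum fun_eq_iff)
  moreover have "integrable M \<dots>"
    using assms L2_integrable_mult[OF assms] by (auto simp: L2_def)
  ultimately show ?thesis
    using assms by (auto simp: L2_def)
qed

lemma L2_diff: "f \<in> L2 M \<Longrightarrow> g \<in> L2 M \<Longrightarrow> (\<lambda>x. f x - g x) \<in> L2 M"
  using L2_add[of f M "\<lambda>x. -1 * g x"] L2_scale[of g M "-1"] by simp

lemma L2_minus: "f \<in> L2 M \<Longrightarrow> (\<lambda>x. - f x) \<in> L2 M"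
  using L2_scale[of f M "-1"] by simp

lemma L2_zero: "(\<lambda>x. 0) \<in> L2 M"
  by (simp add: L2_def)

lemma L2_sum: "(\<And>i. i \<in> I \<Longrightarrow> f i \<in> L2 M) \<Longrightarrow> (\<lambda>x. \<Sum>i\<in>I. f i x) \<in> L2 M"
  by (induction I rule: infinite_finite_induct) (auto intro: L2_zero L2_add)

lemma L2_inner_commute: "L2_inner M f g = L2_inner M g f"
  by (simp add: L2_inner_def mult.commute)

lemma L2_inner_add_left:
  "f \<in> L2 M \<Longrightarrow> g \<in> L2 M \<Longrightarrow> k \<in> L2 M \<Longrightarrow>
    L2_inner M (\<lambda>x. f x + g x) k = L2_inner M f k + L2_inner M g k"
  by (simp add: L2_inner_def distrib_right L2_integrable_mult)

lemma L2_inner_diff_left: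
  "f \<in> L2 M \<Longrightarrow> g \<in> L2 M \<Longrightarrow> k \<in> L2 M \<Longrightarrow>
    L2_inner M (\<lambda>x. f x - g x) k = L2_inner M f k - L2_inner M g k"
  by (simp add: L2_inner_def left_diff_distrib L2_integrable_mult)

lemma L2_inner_scale_left: "L2_inner M (\<lambda>x. c * f x) k = c * L2_inner M f k"
  by (simp add: L2_inner_def mult.assoc)

lemma L2_inner_scale_right: "L2_inner M k (\<lambda>x. c * f x) = c * L2_inner M k f"
  by (simp add: L2_inner_commute[of M k] L2_inner_scale_left)

lemma L2_inner_minus_left: "L2_inner M (\<lambda>x. - f x) k = - L2_inner M f k"
  using L2_inner_scale_left[of M "-1" f k] by simp

lemma L2_inner_sum_left:
  "(\<And>i. i \<in> I \<Longrightarrow> f i \<in> L2 M) \<Longrightarrow> k \<in> L2 M \<Longrightarrow>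
    L2_inner M (\<lambda>x. \<Sum>i\<in>I. f i x) k = (\<Sum>i\<in>I. L2_inner M (f i) k)"
  by (simp add: L2_inner_def sum_distrib_right L2_integrable_mult)

lemma L2_inner_add_right:
  "f \<in> L2 M \<Longrightarrow> g \<in> L2 M \<Longrightarrow> k \<in> L2 M \<Longrightarrow>
    L2_inner M k (\<lambda>x. f x + g x) = L2_inner M k f + L2_inner M k g"
  by (simp add: L2_inner_commute[of M k] L2_inner_add_left)

lemma L2_inner_diff_right:
  "f \<in> L2 M \<Longrightarrow> g \<in> L2 M \<Longrightarrow> k \<in> L2 M \<Longrightarrow>
    L2_inner M k (\<lambda>x. f x - g x) = L2_inner M k f - L2_inner M k g"
  by (simp add: L2_inner_commute[of M k] L2_inner_diff_left)

lemma L2_inner_self_nonneg: "0 \<le> L2_inner M f f"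
  by (simp add: L2_inner_def)

lemma L2_norm_nonneg: "0 \<le> L2_norm M f"
  by (simp add: L2_norm_def L2_inner_self_nonneg)

lemma L2_norm_power2: "(L2_norm M f)\<^sup>2 = L2_inner M f f"
  by (simp add: L2_norm_def L2_inner_self_nonneg)

lemma L2_norm_minus_commute: "L2_norm M (\<lambda>x. f x - g x) = L2_norm M (\<lambda>x. g x - f x)"
  by (simp add: L2_norm_def L2_inner_def power2_commute flip: power2_eq_square)

lemma L2_norm_cong_AE:
  assumes "AE x in M. f x = f' x" "f \<in> borel_measurable M" "f' \<in> borel_measurable M"
  shows "L2_norm M f = L2_norm M f'"
proof -
  have "L2_inner M f f = L2_inner M f' f'"
    unfolding L2_inner_def by (rule integral_cong_AE) (use assms in auto)
  then show ?thesis by (simp add: L2_norm_def)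
qed

lemma L2_Cauchy_Schwarz:
  assumes f: "f \<in> L2 M" and g: "g \<in> L2 M"
  shows "\<bar>L2_inner M f g\<bar> \<le> L2_norm M f * L2_norm M g"
proof -
  let ?A = "L2_inner M f f" and ?B = "L2_inner M f g" and ?C = "L2_inner M g g"
  have quad: "0 \<le> ?A * p\<^sup>2 + 2 * ?B * (p * q) + ?C * q\<^sup>2" for p q
  proof -
    have "0 \<le> L2_inner M (\<lambda>x. p * f x + q * g x) (\<lambda>x. p * f x + q * g x)"
      by (rule L2_inner_self_nonneg)
    also have "\<dots> = ?A * p\<^sup>2 + 2 * ?B * (p * q) + ?C * q\<^sup>2"
      by (simp add: L2_inner_add_left L2_inner_add_right L2_scale L2_add f g L2_inner_scale_left
          L2_inner_scale_right L2_inner_commute[of M g f] power2_eq_square algebra_simps)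
    finally show ?thesis .
  qed
  have "?B\<^sup>2 \<le> ?A * ?C"
  proof (cases "?C = 0")
    case True
    have "?B = 0"
    proof (rule ccontr)
      assume "?B \<noteq> 0"
      moreover have "0 \<le> ?A + 2 * ?B * (- (?A + 1) / (2 * ?B))"
        using quad[of 1 "- (?A + 1) / (2 * ?B)"] True by simp
      ultimately show False by (simp add: field_simps)
    qed
    then show ?thesis using True by simp
  next
    case False
    then have C: "?C > 0" using L2_inner_self_nonneg[of M g] by simp
    have "0 \<le> ?C * (?A * ?C - ?B\<^sup>2)"
      using quad[of ?C "- ?B"] by (simp add: power2_eq_square algebra_simps)
    then show ?thesis using C by (simp add: zero_le_mult_iff)
  qed
  then have "\<bar>?B\<bar> \<le> sqrt (?A * ?C)" by (intro real_le_rsqrt) simp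
  then show ?thesis by (simp add: L2_norm_def real_sqrt_mult)
qed

lemma L2_norm_triangle:
  assumes f: "f \<in> L2 M" and g: "g \<in> L2 M"
  shows "L2_norm M (\<lambda>x. f x + g x) \<le> L2_norm M f + L2_norm M g"
proof (rule power2_le_imp_le)
  have "(L2_norm M (\<lambda>x. f x + g x))\<^sup>2 = L2_inner M f f + 2 * L2_inner M f g + L2_inner M g g"
    by (simp add: L2_norm_power2 L2_inner_add_left L2_inner_add_right L2_add f g
        L2_inner_commute[of M g f])
  also have "\<dots> \<le> (L2_norm M f)\<^sup>2 + 2 * (L2_norm M f * L2_norm M g) + (L2_norm M g)\<^sup>2"
    using L2_Cauchy_Schwarz[OF f g] by (simp add: L2_norm_power2)
  finally show "(L2_norm M (\<lambda>x. f x + g x))\<^sup>2 \<le> (L2_norm M f + L2_norm M g)\<^sup>2"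
    by (simp add: power2_sum)
qed (simp add: L2_norm_nonneg)

lemma L2_norm_triangle_diff:
  assumes "f \<in> L2 M" "g \<in> L2 M" "h \<in> L2 M"
  shows "L2_norm M (\<lambda>x. f x - h x) \<le> L2_norm M (\<lambda>x. f x - g x) + L2_norm M (\<lambda>x. g x - h x)"
  using L2_norm_triangle[of "\<lambda>x. f x - g x" M "\<lambda>x. g x - h x"] assms by (simp add: L2_diff)

lemma L2_inner_tendsto_eventually:
  assumes F: "\<forall>\<^sub>F n in K. F n \<in> L2 M" and f: "f \<in> L2 M" and g: "g \<in> L2 M"
    and lim: "((\<lambda>n. L2_norm M (\<lambda>x. F n x - f x)) \<longlongrightarrow> 0) K"
  shows "((\<lambda>n. L2_inner M (F n) g) \<longlongrightarrow> L2_inner M f g) K"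
proof -
  have "((\<lambda>n. L2_inner M (F n) g - L2_inner M f g) \<longlongrightarrow> 0) K"
  proof (rule Lim_null_comparison)
    show "\<forall>\<^sub>F n in K. norm (L2_inner M (F n) g - L2_inner M f g)
        \<le> L2_norm M (\<lambda>x. F n x - f x) * L2_norm M g"
      using F
    proof eventually_elim
      case (elim n)
      show ?case
        using L2_Cauchy_Schwarz[OF L2_diff[OF elim f] g] by (simp add: L2_inner_diff_left elim f g)
    qed
    show "((\<lambda>n. L2_norm M (\<lambda>x. F n x - f x) * L2_norm M g) \<longlongrightarrow> 0) K"
      using lim by (auto intro: tendsto_mult_left_zero)
  qed
  then show ?thesis by (simp add: LIM_zero_iff)
qed

lemma L2_inner_tendsto:
  assumes F: "\<And>n. F n \<in> L2 M" and f: "f \<in> L2 M" and g: "g \<in> L2 M"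
    and lim: "((\<lambda>n. L2_norm M (\<lambda>x. F n x - f x)) \<longlongrightarrow> 0) K"
  shows "((\<lambda>n. L2_inner M (F n) g) \<longlongrightarrow> L2_inner M f g) K"
  by (rule L2_inner_tendsto_eventually[OF always_eventually f g lim]) (simp add: F)

lemma nn_integral_L2_norm:
  "f \<in> L2 M \<Longrightarrow> (\<integral>\<^sup>+x. ennreal ((f x)\<^sup>2) \<partial>M) = ennreal ((L2_norm M f)\<^sup>2)"
  by (simp add: L2_norm_power2 L2_inner_def L2_def nn_integral_eq_integral flip: power2_eq_square)

text \<open>On a finite measure space convergence in \<open>L\<^sup>2\<close> dominates convergence in \<open>L\<^sup>1\<close>. Along a
  subsequence with norm increments \<open>2\<^sup>-\<^sup>k\<close> the increments are therefore absolutely summable almost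
  everywhere, which gives a pointwise limit, and Fatou's lemma turns the Cauchy condition into
  convergence to it.\<close>

lemma L2_complete:
  assumes fin: "finite_measure M" and F: "\<And>n. F n \<in> L2 M"
    and Cauchy: "\<And>e. e > 0 \<Longrightarrow> \<exists>N. \<forall>m\<ge>N. \<forall>n\<ge>N. L2_norm M (\<lambda>x. F m x - F n x) < e"
  shows "\<exists>f\<in>L2 M. (\<lambda>n. L2_norm M (\<lambda>x. F n x - f x)) \<longlonglongrightarrow> 0"
proof -
  interpret finite_measure M by fact
  have [measurable]: "F n \<in> borel_measurable M" for n using F by (rule L2_measurable)
  have one: "(\<lambda>x. 1) \<in> L2 M" by (simp add: L2_def)
  obtain N where N: "\<And>k m n. m \<ge> N k \<Longrightarrow> n \<ge> N k \<Longrightarrow> L2_norm M (\<lambda>x. F m x - F n x) < (1/2)^k"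
    using Cauchy[of "(1/2)^_"] by (metis half_gt_zero zero_less_one zero_less_power)
  \<comment> \<open>The running maximum makes the sequence of indices monotone, so that both \<open>r k\<close> and
    \<open>r (Suc k)\<close> are beyond \<open>N k\<close>.\<close>
  define r where "r k = Max (N ` {..k})" for k
  have r: "r k \<ge> N j" if "j \<le> k" for j k
    unfolding r_def using that by (intro Max_ge) auto
  define G where "G k x = F (r (Suc k)) x - F (r k) x" for k x
  have GL2: "G k \<in> L2 M" for k unfolding G_def by (intro L2_diff F)
  then have [measurable]: "G k \<in> borel_measurable M" for k by (rule L2_measurable)
  have absG: "(\<lambda>x. \<bar>G k x\<bar>) \<in> L2 M" for k using GL2[of k] by (auto simp: L2_def)
  have "(\<integral>\<^sup>+x. ennreal \<bar>G k x\<bar> \<partial>M) \<le> ennreal ((1/2)^k * L2_norm M (\<lambda>x. 1))" for k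
  proof -
    have "(\<integral>\<^sup>+x. ennreal \<bar>G k x\<bar> \<partial>M) = ennreal (L2_inner M (\<lambda>x. \<bar>G k x\<bar>) (\<lambda>x. 1))"
      using L2_integrable_mult[OF absG one] by (simp add: L2_inner_def nn_integral_eq_integral)
    moreover have "L2_inner M (\<lambda>x. \<bar>G k x\<bar>) (\<lambda>x. 1) \<le> L2_norm M (\<lambda>x. \<bar>G k x\<bar>) * L2_norm M (\<lambda>x. 1)"
      using L2_Cauchy_Schwarz[OF absG one, of k] by simp
    moreover have "L2_norm M (\<lambda>x. \<bar>G k x\<bar>) = L2_norm M (G k)"
      by (simp add: L2_norm_def L2_inner_def)
    moreover have "L2_norm M (G k) \<le> (1/2)^k"
      unfolding G_def using N[of k "r (Suc k)" "r k"] r by (simp add: less_imp_le)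
    ultimately show ?thesis
      by (smt (verit, best) ennreal_leI mult_right_mono L2_norm_nonneg)
  qed
  then have "(\<Sum>k. \<integral>\<^sup>+x. ennreal \<bar>G k x\<bar> \<partial>M) \<le> (\<Sum>k. ennreal ((1/2)^k * L2_norm M (\<lambda>x. 1)))"
    by (intro suminf_le) auto
  also have "\<dots> = ennreal (\<Sum>k. (1/2)^k * L2_norm M (\<lambda>x. 1))"
    by (intro suminf_ennreal2 summable_mult2 summable_geometric) (auto simp: L2_norm_nonneg)
  finally have "(\<integral>\<^sup>+x. (\<Sum>k. ennreal \<bar>G k x\<bar>) \<partial>M) \<noteq> \<infinity>"
    by (subst nn_integral_suminf) (auto simp: top_unique)
  then have "AE x in M. (\<Sum>k. ennreal \<bar>G k x\<bar>) \<noteq> \<infinity>"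
    by (intro nn_integral_PInf_AE) auto
  then have conv: "AE x in M. convergent (\<lambda>k. F (r k) x)"
  proof eventually_elim
    case (elim x)
    then have "summable (\<lambda>k. \<bar>G k x\<bar>)" by (intro summable_suminf_not_top) auto
    then have "summable (\<lambda>k. G k x)" by (rule summable_rabs_cancel)
    then have "convergent (\<lambda>n. F (r 0) x + (\<Sum>k<n. G k x))"
      by (intro convergent_add convergent_const) (simp add: summable_iff_convergent)
    moreover have "F (r 0) x + (\<Sum>k<n. G k x) = F (r n) x" for n
      by (simp add: G_def sum_lessThan_telescope[of "\<lambda>k. F (r k) x"])
    ultimately show ?case by simp
  qed
  define f where "f x = lim (\<lambda>k. F (r k) x)" for x
  have [measurable]: "f \<in> borel_measurable M" unfolding f_def by measurable
  have lim: "AE x in M. (\<lambda>k. F (r k) x) \<longlonglongrightarrow> f x"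
    using conv by eventually_elim (simp add: f_def convergent_LIMSEQ_iff)
  have bound: "(\<integral>\<^sup>+x. ennreal ((F m x - f x)\<^sup>2) \<partial>M) \<le> ennreal (((1/2)^j)\<^sup>2)" if m: "m \<ge> N j" for m j
  proof -
    have "(\<integral>\<^sup>+x. ennreal ((F m x - f x)\<^sup>2) \<partial>M)
        = (\<integral>\<^sup>+x. liminf (\<lambda>k. ennreal ((F m x - F (r k) x)\<^sup>2)) \<partial>M)"
    proof (rule nn_integral_cong_AE)
      show "AE x in M. ennreal ((F m x - f x)\<^sup>2) = liminf (\<lambda>k. ennreal ((F m x - F (r k) x)\<^sup>2))"
        using lim
      proof eventually_elim
        case (elim x)
        then have "(\<lambda>k. ennreal ((F m x - F (r k) x)\<^sup>2)) \<longlonglongrightarrow> ennreal ((F m x - f x)\<^sup>2)"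
          by (intro tendsto_intros) auto
        then show ?case by (rule lim_imp_Liminf[OF trivial_limit_sequentially, symmetric])
      qed
    qed
    also have "\<dots> \<le> liminf (\<lambda>k. \<integral>\<^sup>+x. ennreal ((F m x - F (r k) x)\<^sup>2) \<partial>M)"
      by (intro nn_integral_liminf) auto
    also have "\<dots> \<le> ennreal (((1/2)^j)\<^sup>2)"
    proof (rule Liminf_le)
      show "\<forall>\<^sub>F k in sequentially. (\<integral>\<^sup>+x. ennreal ((F m x - F (r k) x)\<^sup>2) \<partial>M) \<le> ennreal (((1/2)^j)\<^sup>2)"
        using eventually_ge_at_top[of j]
      proof eventually_elim
        case (elim k)
        have "(\<integral>\<^sup>+x. ennreal ((F m x - F (r k) x)\<^sup>2) \<partial>M)
            = ennreal ((L2_norm M (\<lambda>x. F m x - F (r k) x))\<^sup>2)"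
          by (rule nn_integral_L2_norm[OF L2_diff[OF F F]])
        also have "\<dots> \<le> ennreal (((1/2)^j)\<^sup>2)"
          using N[of j m "r k"] m r[OF elim] by (intro ennreal_leI power_mono L2_norm_nonneg) auto
        finally show ?case .
      qed
    qed simp
    finally show ?thesis .
  qed
  have dL2: "(\<lambda>x. F m x - f x) \<in> L2 M" if "m \<ge> N j" for m j
    using bound[OF that] by (auto simp: L2_def integrable_iff_bounded le_less_trans[OF _ ennreal_less_top])
  have "f \<in> L2 M"
    using L2_diff[OF F[of "N 0"] dL2[of 0 "N 0"]] by simp
  moreover have "(\<lambda>n. L2_norm M (\<lambda>x. F n x - f x)) \<longlonglongrightarrow> 0"
  proof (rule LIMSEQ_I)
    fix e :: real assume "e > 0"
    then obtain j where j: "(1/2)^j < e" using real_arch_pow_inv[of e "1/2"] by auto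
    have "L2_norm M (\<lambda>x. F m x - f x) < e" if m: "m \<ge> N j" for m
    proof -
      have "ennreal ((L2_norm M (\<lambda>x. F m x - f x))\<^sup>2) \<le> ennreal (((1/2)^j)\<^sup>2)"
        using bound[OF m] by (simp only: nn_integral_L2_norm[OF dL2[OF m]])
      then have "L2_norm M (\<lambda>x. F m x - f x) \<le> (1/2)^j"
        by (subst (asm) ennreal_le_iff) (auto intro: power2_le_imp_le)
      with j show ?thesis by simp
    qed
    then show "\<exists>no. \<forall>n\<ge>no. norm (L2_norm M (\<lambda>x. F n x - f x) - 0) < e"
      by (auto intro!: exI[of _ "N j"] simp: L2_norm_nonneg)
  qed
  ultimately show ?thesis by blast
qed

abbreviation leb :: "real \<Rightarrow> real \<Rightarrow> real measure" where
  "leb a b \<equiv> lebesgue_on {a<..<b}"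

section \<open>Smooth functions and cutoffs\<close>

text \<open>A class of functions that is closed under differentiation consists of smooth functions. The
  smoothness of products, affine substitutions and the special functions below is proved in this way.\<close>

lemma smooth_coinduct:
  assumes "P f"
    and step: "\<And>g. P g \<Longrightarrow> \<exists>g'. (\<forall>x. (g has_real_derivative g' x) (at x)) \<and> P g'"
  shows "smooth_on UNIV f"
proof -
  have deriv: "P (deriv g)" if Pg: "P g" for g
  proof -
    obtain g' where g': "\<And>x. (g has_real_derivative g' x) (at x)" "P g'"
      using step[OF Pg] by blast
    have "deriv g = g'" using g'(1) by (intro ext DERIV_imp_deriv)
    with g'(2) show ?thesis by simp
  qed
  have "P ((deriv ^^ n) f)" for n
    by (induction n) (simp_all add: assms(1) deriv)
  then show ?thesis
    unfolding smooth_on_def field_differentiable_def using step by blast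
qed

lemma smooth_deriv: "smooth_on UNIV f \<Longrightarrow> smooth_on UNIV (deriv f)"
  unfolding smooth_on_def
proof (intro allI ballI)
  fix n x assume "\<forall>n. \<forall>x\<in>UNIV. (deriv ^^ n) f field_differentiable at x"
  then have "(deriv ^^ Suc n) f field_differentiable at x" by blast
  then show "(deriv ^^ n) (deriv f) field_differentiable at x"
    by (simp only: funpow_Suc_right comp_apply)
qed

lemma smooth_DERIV: "smooth_on UNIV f \<Longrightarrow> (f has_real_derivative deriv f x) (at x)"
  by (auto simp: smooth_on_def DERIV_deriv_iff_field_differentiable dest: spec[of _ 0])

lemma smooth_continuous_on: "smooth_on UNIV f \<Longrightarrow> continuous_on S f"
  by (rule DERIV_continuous_on, rule has_field_derivative_at_within, rule smooth_DERIV)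

lemma smooth_affine:
  assumes "smooth_on UNIV f"
  shows "smooth_on UNIV (\<lambda>x. f (p * x + q))"
proof (rule smooth_coinduct[where P = "\<lambda>h. \<exists>k f. smooth_on UNIV f \<and> h = (\<lambda>x. k * f (p * x + q))"])
  show "\<exists>k g. smooth_on UNIV g \<and> (\<lambda>x. f (p * x + q)) = (\<lambda>x. k * g (p * x + q))"
    using assms by (intro exI[of _ 1] exI[of _ f]) simp
  fix h :: "real \<Rightarrow> real" assume "\<exists>k f. smooth_on UNIV f \<and> h = (\<lambda>x. k * f (p * x + q))"
  then obtain k f where kf: "smooth_on UNIV f" "h = (\<lambda>x. k * f (p * x + q))" by blast
  have "((\<lambda>x. k * f (p * x + q)) has_real_derivative (k * p) * deriv f (p * x + q)) (at x)" for x
    by (rule derivative_eq_intros DERIV_chain2[OF smooth_DERIV[OF kf(1)]] refl | simp)+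
  then show "\<exists>g. (\<forall>x. (h has_real_derivative g x) (at x)) \<and>
      (\<exists>k f. smooth_on UNIV f \<and> g = (\<lambda>x. k * f (p * x + q)))"
    unfolding kf(2)
    by (intro exI[of _ "\<lambda>x. (k * p) * deriv f (p * x + q)"] conjI allI
        exI[of _ "k * p"] exI[of _ "deriv f"] smooth_deriv kf(1)) auto
qed

text \<open>The derivative of a product is a sum of two products, so the sums of products of smooth
  functions form a class that is closed under differentiation.\<close>

inductive sum_of_smooth_products :: "(real \<Rightarrow> real) \<Rightarrow> bool" where
  product: "smooth_on UNIV f \<Longrightarrow> smooth_on UNIV g \<Longrightarrow> sum_of_smooth_products (\<lambda>x. f x * g x)"
| sum: "sum_of_smooth_products u \<Longrightarrow> sum_of_smooth_products v \<Longrightarrow>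
    sum_of_smooth_products (\<lambda>x. u x + v x)"

lemma smooth_mult:
  assumes "smooth_on UNIV f" "smooth_on UNIV g"
  shows "smooth_on UNIV (\<lambda>x. f x * g x)"
proof (rule smooth_coinduct)
  show "sum_of_smooth_products (\<lambda>x. f x * g x)"
    using assms by (rule sum_of_smooth_products.product)
  fix h assume "sum_of_smooth_products h"
  then show "\<exists>h'. (\<forall>x. (h has_real_derivative h' x) (at x)) \<and> sum_of_smooth_products h'"
  proof induction
    case (product f g)
    have "((\<lambda>x. f x * g x) has_real_derivative deriv f x * g x + deriv g x * f x) (at x)" for x
      by (rule DERIV_mult[OF smooth_DERIV[OF product(1)] smooth_DERIV[OF product(2)]])
    moreover have "sum_of_smooth_products (\<lambda>x. deriv f x * g x + deriv g x * f x)"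
      by (intro sum_of_smooth_products.intros smooth_deriv product)
    ultimately show ?case by (intro exI conjI allI)
  next
    case (sum u v)
    then obtain u' v' where uv: "\<And>x. (u has_real_derivative u' x) (at x)" "sum_of_smooth_products u'"
      "\<And>x. (v has_real_derivative v' x) (at x)" "sum_of_smooth_products v'" by blast
    have "((\<lambda>x. u x + v x) has_real_derivative u' x + v' x) (at x)" for x
      by (rule DERIV_add[OF uv(1) uv(3)])
    moreover have "sum_of_smooth_products (\<lambda>x. u' x + v' x)"
      by (intro sum_of_smooth_products.sum uv)
    ultimately show ?case by (intro exI conjI allI)
  qed
qed

lemma smooth_sin: "smooth_on UNIV (\<lambda>x. k * sin (p * x + q))"
proof (rule smooth_coinduct[where P = "\<lambda>h. \<exists>k q. h = (\<lambda>x. k * sin (p * x + q))"])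
  fix h :: "real \<Rightarrow> real" assume "\<exists>k q. h = (\<lambda>x. k * sin (p * x + q))"
  then obtain k q where h: "h = (\<lambda>x. k * sin (p * x + q))" by blast
  have "(h has_real_derivative (k * p) * sin (p * x + (q + pi / 2))) (at x)" for x
    unfolding h by (auto intro!: derivative_eq_intros simp: sin_add cos_add algebra_simps)
  then show "\<exists>h'. (\<forall>x. (h has_real_derivative h' x) (at x)) \<and> (\<exists>k q. h' = (\<lambda>x. k * sin (p * x + q)))"
    by (intro exI conjI allI) (assumption, rule refl)
qed blast

text \<open>The functions \<open>p (1/x) exp (-1/x)\<close>, extended by \<open>0\<close> to \<open>x \<le> 0\<close>, with a polynomial \<open>p\<close> are
  closed under differentiation; \<open>p = 1\<close> gives the building block of all cutoffs.\<close>

definition flat_exp :: "real poly \<Rightarrow> real \<Rightarrow> real" where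
  "flat_exp p x = (if x > 0 then poly p (1 / x) * exp (- (1 / x)) else 0)"

lemma poly_times_exp_minus_tendsto_0: "((\<lambda>y::real. poly p y * exp (- y)) \<longlongrightarrow> 0) at_top"
proof -
  have "((\<lambda>y::real. \<Sum>i\<le>degree p. coeff p i * (y ^ i / exp y)) \<longlongrightarrow> (\<Sum>i\<le>degree p. coeff p i * 0)) at_top"
    by (intro tendsto_intros tendsto_power_div_exp_0)
  then show ?thesis
    by (simp add: poly_altdef sum_distrib_right exp_minus divide_inverse mult.assoc)
qed

lemma flat_exp_DERIV:
  "(flat_exp p has_real_derivative flat_exp ([:0, 0, 1:] * (p - pderiv p)) x) (at x)"
proof -
  consider "x > 0" | "x < 0" | "x = 0" by linarith
  then show ?thesis
  proof cases
    case 1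
    have "((\<lambda>x. poly p (1 / x) * exp (- (1 / x))) has_real_derivative
        flat_exp ([:0, 0, 1:] * (p - pderiv p)) x) (at x)"
      using 1 by (auto intro!: derivative_eq_intros DERIV_chain2[OF poly_DERIV]
          simp: flat_exp_def field_simps power2_eq_square)
    then show ?thesis
      by (rule has_field_derivative_transform_within_open[where S = "{0<..}"])
        (use 1 in \<open>auto simp: flat_exp_def\<close>)
  next
    case 2
    have "((\<lambda>x. 0) has_real_derivative flat_exp ([:0, 0, 1:] * (p - pderiv p)) x) (at x)"
      using 2 by (auto simp: flat_exp_def)
    then show ?thesis
      by (rule has_field_derivative_transform_within_open[where S = "{..<0}"])
        (use 2 in \<open>auto simp: flat_exp_def\<close>)
  next
    case 3
    have right: "((\<lambda>h. flat_exp p h / h) \<longlongrightarrow> 0) (at_right 0)"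
    proof (rule Lim_transform_eventually)
      show "((\<lambda>h. poly (pCons 0 p) (inverse h) * exp (- inverse h)) \<longlongrightarrow> 0) (at_right (0::real))"
        by (rule filterlim_compose[OF poly_times_exp_minus_tendsto_0 filterlim_inverse_at_top_right])
      show "\<forall>\<^sub>F h in at_right 0. poly (pCons 0 p) (inverse h) * exp (- inverse h) = flat_exp p h / h"
        using eventually_at_right_less[of "0::real"]
        by eventually_elim (simp add: flat_exp_def divide_inverse)
    qed
    have left: "((\<lambda>h. flat_exp p h / h) \<longlongrightarrow> 0) (at_left 0)"
    proof (rule Lim_transform_eventually)
      show "\<forall>\<^sub>F h in at_left 0. 0 = flat_exp p h / h"
        unfolding eventually_at_filter by (rule always_eventually) (auto simp: flat_exp_def)
    qed simp
    show ?thesis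
      using filterlim_split_at[OF left right] 3
      by (simp add: has_field_derivative_iff flat_exp_def)
  qed
qed

lemma smooth_flat_exp: "smooth_on UNIV (flat_exp p)"
proof (rule smooth_coinduct[where P = "\<lambda>h. \<exists>p. h = flat_exp p"])
  fix h assume "\<exists>p. h = flat_exp p"
  then show "\<exists>h'. (\<forall>x. (h has_real_derivative h' x) (at x)) \<and> (\<exists>p. h' = flat_exp p)"
    using flat_exp_DERIV by metis
qed blast

text \<open>The support of this function stays away from the end points, and as \<open>m \<rightarrow> \<infinity>\<close> it
  tends to the indicator of the interval. Its derivative grows like \<open>m\<close>, but only at distance about
  \<open>1/m\<close> from an end point.\<close>

definition cutoff :: "real \<Rightarrow> real \<Rightarrow> real \<Rightarrow> real \<Rightarrow> real" where
  "cutoff a b m x = flat_exp 1 (m * (x - a) - 1) * flat_exp 1 (m * (b - x) - 1)"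

lemma flat_exp_1_bounds: "0 \<le> flat_exp 1 x" "flat_exp 1 x \<le> 1"
  by (auto simp: flat_exp_def)

lemma cutoff_bounds: "0 \<le> cutoff a b m x" "cutoff a b m x \<le> 1"
  unfolding cutoff_def using flat_exp_1_bounds by (auto intro: mult_le_one)

lemma smooth_cutoff: "smooth_on UNIV (cutoff a b m)"
proof -
  have "smooth_on UNIV (\<lambda>x. flat_exp 1 (m * x + (- m * a - 1)) * flat_exp 1 ((- m) * x + (m * b - 1)))"
    by (intro smooth_mult smooth_affine smooth_flat_exp)
  moreover have "cutoff a b m =
      (\<lambda>x. flat_exp 1 (m * x + (- m * a - 1)) * flat_exp 1 ((- m) * x + (m * b - 1)))"
    by (simp add: fun_eq_iff cutoff_def algebra_simps)
  ultimately show ?thesis by simp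
qed

lemma test_function_mult:
  assumes "\<phi> \<in> test_functions \<Omega>" "smooth_on UNIV g"
  shows "(\<lambda>x. \<phi> x * g x) \<in> test_functions \<Omega>"
proof -
  obtain K where "compact K" "K \<subseteq> \<Omega>" "\<forall>x. x \<notin> K \<longrightarrow> \<phi> x = 0" and "smooth_on UNIV \<phi>"
    using assms(1) by (auto simp: test_functions_def)
  with smooth_mult[OF _ assms(2), of \<phi>] show ?thesis
    unfolding test_functions_def by (intro CollectI conjI exI[of _ K]) simp_all
qed

lemma test_function_smooth: "\<phi> \<in> test_functions \<Omega> \<Longrightarrow> smooth_on UNIV \<phi>"
  by (simp add: test_functions_def)

lemma test_function_zero: "\<phi> \<in> test_functions \<Omega> \<Longrightarrow> x \<notin> \<Omega> \<Longrightarrow> \<phi> x = 0"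
  by (auto simp: test_functions_def)

lemma test_function_deriv:
  assumes "\<phi> \<in> test_functions \<Omega>"
  shows "deriv \<phi> \<in> test_functions \<Omega>"
proof -
  obtain K where K: "compact K" "K \<subseteq> \<Omega>" "\<And>x. x \<notin> K \<Longrightarrow> \<phi> x = 0"
    using assms by (auto simp: test_functions_def)
  have "deriv \<phi> x = 0" if "x \<notin> K" for x
  proof -
    have "open (- K)" using K(1) by (simp add: compact_imp_closed open_Compl)
    then have "\<forall>\<^sub>F y in nhds x. y \<in> - K" using that by (intro eventually_nhds_in_open) auto
    then have "\<forall>\<^sub>F y in nhds x. \<phi> y = 0" by eventually_elim (use K in auto)
    then have "deriv \<phi> x = deriv (\<lambda>x. 0) x" by (intro deriv_cong_ev) auto
    then show ?thesis by simp
  qed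
  then show ?thesis
    unfolding test_functions_def
    using K smooth_deriv[OF test_function_smooth[OF assms]]
    by (intro CollectI conjI exI[of _ K]) simp_all
qed

lemma cutoff_test_function:
  assumes "m > 0" "a \<le> c" "d \<le> b"
  shows "cutoff c d m \<in> test_functions {a<..<b}"
proof -
  have "cutoff c d m x = 0" if "x \<notin> {c + 1 / m .. d - 1 / m}" for x
    using that assms by (auto simp: cutoff_def flat_exp_def field_simps not_le)
  moreover have "0 < 1 / m" using assms by simp
  then have "{c + 1 / m .. d - 1 / m} \<subseteq> {a<..<b}"
    using assms(2,3) by (intro subsetI) (auto simp del: zero_less_divide_1_iff)
  ultimately show ?thesis
    unfolding test_functions_def using smooth_cutoff by blast
qed

lemma flat_exp_1_tendsto: "x > 0 \<Longrightarrow> (\<lambda>n. flat_exp 1 (real (Suc n) * x - 1)) \<longlonglongrightarrow> 1"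
proof -
  assume "x > 0"
  have "(flat_exp 1 \<longlongrightarrow> 1) at_top"
  proof (rule Lim_transform_eventually)
    show "((\<lambda>x. exp (- (1 / x))) \<longlongrightarrow> (1::real)) at_top" by real_asymp
    show "\<forall>\<^sub>F x in at_top. exp (- (1 / x)) = flat_exp 1 x"
      using eventually_gt_at_top[of "0::real"] by eventually_elim (simp add: flat_exp_def)
  qed
  moreover have "filterlim (\<lambda>n. real (Suc n) * x - 1) at_top sequentially"
    using \<open>x > 0\<close> by real_asymp
  ultimately show ?thesis by (rule filterlim_compose)
qed

lemma cutoff_tendsto_indicator: "(\<lambda>n. cutoff c d (real (Suc n)) x) \<longlonglongrightarrow> indicator {c<..<d} x"
proof (cases "x \<in> {c<..<d}")
  case True
  then have "(\<lambda>n. cutoff c d (real (Suc n)) x) \<longlonglongrightarrow> 1 * 1"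
    unfolding cutoff_def by (intro tendsto_mult flat_exp_1_tendsto) auto
  with True show ?thesis by simp
next
  case False
  then have "m * (x - c) \<le> 0 \<or> m * (d - x) \<le> 0" if "m > 0" for m
    using that by (auto simp: mult_le_0_iff)
  then have "cutoff c d (real (Suc n)) x = 0" for n
    by (smt (verit) cutoff_def flat_exp_def mult_eq_0_iff of_nat_0_less_iff zero_less_Suc)
  with False show ?thesis by simp
qed

lemma deriv_flat_exp_1: "deriv (flat_exp 1) y = flat_exp [:0, 0, 1:] y"
  using DERIV_imp_deriv[OF flat_exp_DERIV[of 1 y]] by simp

text \<open>With \<open>y = m (x - a) - 1\<close> and \<open>\<psi> = flat_exp 1\<close> this is the product of the distance
  \<open>x - a\<close> and the derivative \<open>m \<psi>'(m (x - a) - 1)\<close> of a cutoff: the distance compensates the factor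
  \<open>m\<close>.\<close>

lemma weighted_deriv_flat_exp_le: "\<bar>(y + 1) * deriv (flat_exp 1) y\<bar> \<le> 2"
proof (cases "y > 0")
  case True
  define t where "t = 1 / y"
  have t: "t > 0" using True by (simp add: t_def)
  have "1 + t + t\<^sup>2 / 2 \<le> exp t"
    using exp_lower_Taylor_quadratic[of t] t by simp
  then have "(t + t\<^sup>2) * exp (- t) \<le> 2"
    using t by (simp add: exp_minus field_simps)
  moreover have "(y + 1) * deriv (flat_exp 1) y = (t + t\<^sup>2) * exp (- t)"
    using True by (simp add: deriv_flat_exp_1 flat_exp_def t_def field_simps power2_eq_square)
  moreover have "0 \<le> (t + t\<^sup>2) * exp (- t)" using t by simp
  ultimately show ?thesis by simp
qed (simp add: deriv_flat_exp_1 flat_exp_def)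

lemma weighted_deriv_flat_exp_tendsto_0:
  assumes "x > 0"
  shows "(\<lambda>n. real (Suc n) * x * deriv (flat_exp 1) (real (Suc n) * x - 1)) \<longlonglongrightarrow> 0"
proof -
  have "((\<lambda>y. (y + 1) * deriv (flat_exp 1) y) \<longlongrightarrow> 0) at_top"
  proof (rule Lim_transform_eventually)
    show "((\<lambda>y. (y + 1) * ((1 / y)\<^sup>2 * exp (- (1 / y)))) \<longlongrightarrow> (0::real)) at_top" by real_asymp
    show "\<forall>\<^sub>F y in at_top. (y + 1) * ((1 / y)\<^sup>2 * exp (- (1 / y))) = (y + 1) * deriv (flat_exp 1) y"
      using eventually_gt_at_top[of "0::real"]
      by eventually_elim (simp add: deriv_flat_exp_1 flat_exp_def power2_eq_square)
  qed
  moreover have "filterlim (\<lambda>n. real (Suc n) * x - 1) at_top sequentially"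
    using \<open>x > 0\<close> by real_asymp
  ultimately show ?thesis
    by (auto dest: filterlim_compose)
qed

text \<open>By Lebesgue differentiation, \<open>h\<close> is almost everywhere the limit of its means over shrinking
  intervals.\<close>

lemma AE_eq_zero_if_interval_integrals_zero:
  fixes h :: "real \<Rightarrow> real"
  assumes h: "integrable (leb a b) h"
    and zero: "\<And>c d. a < c \<Longrightarrow> c < d \<Longrightarrow> d < b \<Longrightarrow>
      (\<integral>x. h x * indicator {c<..<d} x \<partial>leb a b) = 0"
  shows "AE x in leb a b. h x = 0"
proof -
  define k where "k x = (if x \<in> {a<..<b} then h x else 0)" for x
  have "integrable lebesgue k"
    unfolding k_def using h by (subst Lebesgue_Measure.integrable_restrict_UNIV) auto
  then have "k integrable_on UNIV"
    using integrable_on_lebesgue_on[of UNIV k] by (simp add: lebesgue_on_UNIV_eq)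
  then have k: "k integrable_on cbox c d" for c d
    using integrable_on_subcbox by blast
  have int0: "integral {c..d} k = 0" if "a < c" "c < d" "d < b" for c d
  proof -
    have "integrable (leb a b) (\<lambda>x. indicator {c<..<d} x *\<^sub>R h x)"
      using h that by (intro integrable_mult_indicator) (auto simp: sets_restrict_space_iff)
    then have "(\<integral>x. h x * indicator {c<..<d} x \<partial>leb a b)
        = integral {a<..<b} (\<lambda>x. h x * indicator {c<..<d} x)"
      by (intro lebesgue_integral_eq_integral) (auto simp: mult.commute)
    also have "\<dots> = integral UNIV (\<lambda>x. if x \<in> {a<..<b} then h x * indicator {c<..<d} x else 0)"
      by (rule Henstock_Kurzweil_Integration.integral_restrict_UNIV[symmetric])
    also have "\<dots> = integral UNIV (\<lambda>x. if x \<in> {c<..<d} then k x else 0)"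
      using that by (intro arg_cong[where f = "integral UNIV"]) (auto simp: k_def fun_eq_iff)
    also have "\<dots> = integral {c<..<d} k"
      by (rule Henstock_Kurzweil_Integration.integral_restrict_UNIV)
    also have "\<dots> = integral {c..d} k" by (rule integral_open_interval_real[symmetric])
    finally show ?thesis using zero[OF that] by simp
  qed
  obtain N where N: "negligible N"
    and lim: "\<And>x e. x \<notin> N \<Longrightarrow> 0 < e \<Longrightarrow> \<exists>d>0. \<forall>h. 0 < h \<and> h < d \<longrightarrow>
      norm (integral (cbox x (x + h *\<^sub>R One)) k /\<^sub>R h ^ DIM(real) - k x) < e"
    using integrable_ccontinuous_explicit[of k] k by blast
  have "h x = 0" if x: "x \<in> {a<..<b}" "x \<notin> N" for x
  proof (rule ccontr)
    assume "h x \<noteq> 0"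
    then obtain d where d: "d > 0" "\<And>h. 0 < h \<Longrightarrow> h < d \<Longrightarrow>
        \<bar>integral {x..x + h} k / h - k x\<bar> < \<bar>k x\<bar>"
      using lim[OF x(2), of "\<bar>k x\<bar>"] x(1) by (auto simp: k_def divide_inverse mult.commute)
    define t where "t = min d (b - x) / 2"
    have t: "0 < t" "t < d" "x + t < b" using d(1) x(1) by (auto simp: t_def min_def field_simps)
    then have "integral {x..x + t} k = 0" using x(1) by (intro int0) auto
    then show False using d(2)[OF t(1,2)] by simp
  qed
  moreover have "AE x in lebesgue. x \<notin> N"
    using N AE_not_in negligible_iff_null_sets by blast
  ultimately show ?thesis
    by (subst AE_restrict_space_iff) (auto elim: eventually_mono)
qed

text \<open>The fundamental lemma of the calculus of variations: test with cutoffs, which converge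
  boundedly to the indicators of intervals.\<close>

lemma AE_eq_zero_if_orthogonal_to_test_functions:
  fixes h :: "real \<Rightarrow> real"
  assumes h: "integrable (leb a b) h"
    and zero: "\<And>\<phi>. \<phi> \<in> test_functions {a<..<b} \<Longrightarrow> (\<integral>x. h x * \<phi> x \<partial>leb a b) = 0"
  shows "AE x in leb a b. h x = 0"
proof (rule AE_eq_zero_if_interval_integrals_zero[OF h])
  fix c d assume cd: "a < c" "c < d" "d < b"
  let ?M = "leb a b"
  have [measurable]: "h \<in> borel_measurable ?M" using h by simp
  have cut[measurable]: "cutoff c d m \<in> borel_measurable ?M" for m
    by (intro continuous_imp_measurable_on_sets_lebesgue smooth_continuous_on smooth_cutoff) auto
  have ind[measurable]: "{c<..<d} \<in> sets ?M"
    using cd by (auto simp: sets_restrict_space_iff)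
  have "(\<lambda>n. \<integral>x. h x * cutoff c d (real (Suc n)) x \<partial>?M) \<longlonglongrightarrow> (\<integral>x. h x * indicator {c<..<d} x \<partial>?M)"
  proof (rule integral_dominated_convergence[where w = "\<lambda>x. \<bar>h x\<bar>"])
    show "AE x in ?M. (\<lambda>n. h x * cutoff c d (real (Suc n)) x) \<longlonglongrightarrow> h x * indicator {c<..<d} x"
      by (intro AE_I2 tendsto_intros cutoff_tendsto_indicator)
    show "AE x in ?M. norm (h x * cutoff c d (real (Suc n)) x) \<le> \<bar>h x\<bar>" for n
      using cutoff_bounds by (auto simp: abs_mult intro!: mult_left_le)
  qed (use h in auto)
  moreover have "(\<integral>x. h x * cutoff c d (real (Suc n)) x \<partial>?M) = 0" for n
    using cd by (intro zero cutoff_test_function) auto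
  ultimately show "(\<integral>x. h x * indicator {c<..<d} x \<partial>?M) = 0"
    by (simp add: LIMSEQ_const_iff)
qed

section \<open>Weak derivatives and \<open>H\<^sup>1\<^sub>0\<close> on an interval\<close>

lemma finite_measure_interval: "finite_measure (leb a b)"
  by (rule finite_measure_lebesgue_on) simp

lemma measure_interval: "a < b \<Longrightarrow> measure (leb a b) {a<..<b} = b - a"
  by (subst measure_restrict_space) auto

lemma measurable_interval:
  "continuous_on {a..b} f \<Longrightarrow> f \<in> borel_measurable (leb a b)"
  by (intro continuous_imp_measurable_on_sets_lebesgue)
     (auto elim: continuous_on_subset)

lemma continuous_bounded:
  fixes f :: "real \<Rightarrow> real"
  assumes "continuous_on {a..b} f"
  shows "\<exists>B\<ge>0. \<forall>x\<in>{a..b}. \<bar>f x\<bar> \<le> B"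
proof -
  have "bounded (f ` {a..b})"
    using assms by (intro compact_imp_bounded compact_continuous_image) auto
  then obtain B where "\<forall>y\<in>f ` {a..b}. norm y \<le> B"
    unfolding bounded_iff by blast
  then have "\<forall>x\<in>{a..b}. \<bar>f x\<bar> \<le> max B 0" by (auto intro: max.coboundedI1)
  then show ?thesis by (intro exI[of _ "max B 0"]) simp
qed

lemma bounded_integrable_interval:
  fixes f :: "real \<Rightarrow> real"
  assumes "f \<in> borel_measurable (leb a b)" "\<And>x. x \<in> {a<..<b} \<Longrightarrow> \<bar>f x\<bar> \<le> B"
  shows "integrable (leb a b) f"
  using assms
  by (intro finite_measure.integrable_const_bound[OF finite_measure_interval, where B = B]) auto

lemma continuous_integrable_interval:
  fixes f :: "real \<Rightarrow> real"
  assumes "continuous_on {a..b} f"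
  shows "integrable (leb a b) f"
proof -
  obtain B where B: "B \<ge> 0" "\<And>x. x \<in> {a..b} \<Longrightarrow> \<bar>f x\<bar> \<le> B"
    using continuous_bounded[OF assms] by blast
  show ?thesis
    by (rule bounded_integrable_interval[OF measurable_interval[OF assms], of B]) (use B(2) in auto)
qed

lemma continuous_L2:
  fixes f :: "real \<Rightarrow> real"
  assumes "continuous_on {a..b} f"
  shows "f \<in> L2 (leb a b)"
proof -
  have "continuous_on {a..b} (\<lambda>x. (f x)\<^sup>2)" using assms by (intro continuous_intros)
  then show ?thesis
    using measurable_interval[OF assms] continuous_integrable_interval[of a b "\<lambda>x. (f x)\<^sup>2"]
    by (simp add: L2_def)
qed

lemma smooth_L2: "smooth_on UNIV f \<Longrightarrow> f \<in> L2 (leb a b)"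
  by (intro continuous_L2 smooth_continuous_on)

lemma test_function_L2: "\<phi> \<in> test_functions {a<..<b} \<Longrightarrow> \<phi> \<in> L2 (leb a b)"
  by (intro smooth_L2 test_function_smooth)

lemma L2_norm_le_sup:
  assumes "a < b" and f: "f \<in> L2 (leb a b)" and "B \<ge> 0"
    and B: "\<And>x. x \<in> {a<..<b} \<Longrightarrow> \<bar>f x\<bar> \<le> B"
  shows "L2_norm (leb a b) f \<le> B * sqrt (b - a)"
proof -
  let ?M = "leb a b"
  interpret finite_measure ?M by (rule finite_measure_interval)
  have "L2_inner ?M f f \<le> (\<integral>x. B\<^sup>2 \<partial>?M)"
    unfolding L2_inner_def
  proof (rule integral_mono)
    show "integrable ?M (\<lambda>x. f x * f x)" by (rule L2_integrable_mult[OF f f])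
    fix x assume "x \<in> space ?M"
    then have "\<bar>f x\<bar>\<^sup>2 \<le> B\<^sup>2" using B[of x] by (intro power_mono) auto
    then show "f x * f x \<le> B\<^sup>2" by (simp add: power2_eq_square)
  qed simp
  also have "\<dots> = B\<^sup>2 * (b - a)" using \<open>a < b\<close> by (simp add: measure_interval)
  finally have "sqrt (L2_inner ?M f f) \<le> sqrt (B\<^sup>2 * (b - a))" by simp
  then show ?thesis using \<open>B \<ge> 0\<close> by (simp add: L2_norm_def real_sqrt_mult)
qed

lemma L2_norm_tendsto_0_bounded:
  fixes F :: "nat \<Rightarrow> real \<Rightarrow> real"
  assumes meas: "\<And>n. F n \<in> borel_measurable (leb a b)"
    and lim: "\<And>x. x \<in> {a<..<b} \<Longrightarrow> (\<lambda>n. F n x) \<longlonglongrightarrow> 0"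
    and B: "\<And>n x. x \<in> {a<..<b} \<Longrightarrow> \<bar>F n x\<bar> \<le> B"
  shows "(\<lambda>n. L2_norm (leb a b) (F n)) \<longlonglongrightarrow> 0"
proof -
  let ?M = "leb a b"
  interpret finite_measure ?M by (rule finite_measure_interval)
  have "(\<lambda>n. \<integral>x. F n x * F n x \<partial>?M) \<longlonglongrightarrow> (\<integral>x. 0 \<partial>?M)"
  proof (rule integral_dominated_convergence[where w = "\<lambda>x. B\<^sup>2"])
    show "AE x in ?M. (\<lambda>n. F n x * F n x) \<longlonglongrightarrow> 0"
      using tendsto_mult[OF lim lim] by (intro AE_I2) auto
    show "AE x in ?M. norm (F n x * F n x) \<le> B\<^sup>2" for n
    proof (rule AE_I2)
      fix x assume "x \<in> space ?M"
      then have "\<bar>F n x\<bar>\<^sup>2 \<le> B\<^sup>2" using B[of x n] by (intro power_mono) auto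
      then show "norm (F n x * F n x) \<le> B\<^sup>2" by (simp add: power2_eq_square)
    qed
  qed (use meas in auto)
  then have "(\<lambda>n. sqrt (L2_inner ?M (F n) (F n))) \<longlonglongrightarrow> sqrt 0"
    by (intro tendsto_real_sqrt) (simp add: L2_inner_def)
  then show ?thesis by (simp add: L2_norm_def)
qed

lemma L2_inner_by_parts:
  assumes "a < b"
    and F: "\<And>x. (F has_real_derivative F' x) (at x)" "continuous_on UNIV F'"
    and G: "\<And>x. (G has_real_derivative G' x) (at x)" "continuous_on UNIV G'"
  shows "L2_inner (leb a b) F G'
    = F b * G b - F a * G a - L2_inner (leb a b) F' G"
proof -
  let ?M = "leb a b"
  have cont: "continuous_on {a..b} F" "continuous_on {a..b} G"
    "continuous_on {a..b} F'" "continuous_on {a..b} G'"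
    using F G by (auto intro: continuous_on_subset DERIV_continuous_on has_field_derivative_at_within)
  have "((\<lambda>x. F' x * G x + G' x * F x) has_integral F b * G b - F a * G a) {a..b}"
    using \<open>a < b\<close> DERIV_mult[OF F(1) G(1)]
    by (intro fundamental_theorem_of_calculus)
       (auto intro: has_field_derivative_at_within simp flip: has_real_derivative_iff_has_vector_derivative)
  then have "F b * G b - F a * G a = integral {a<..<b} (\<lambda>x. F' x * G x + G' x * F x)"
    by (simp add: integral_unique flip: integral_open_interval_real)
  also have "\<dots> = (\<integral>x. F' x * G x + G' x * F x \<partial>?M)"
    using cont by (intro lebesgue_integral_eq_integral[symmetric] continuous_integrable_interval
        continuous_intros) auto
  also have "\<dots> = L2_inner ?M F' G + L2_inner ?M G' F"
    using cont by (simp add: L2_inner_def L2_integrable_mult continuous_L2)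
  finally show ?thesis by (simp add: L2_inner_commute[of ?M F G'])
qed

lemma has_weak_deriv_1:
  "has_weak_deriv \<Omega> 1 f g \<longleftrightarrow> (\<forall>\<phi>\<in>test_functions \<Omega>.
    L2_inner (lebesgue_on \<Omega>) f (deriv \<phi>) = - L2_inner (lebesgue_on \<Omega>) g \<phi>)"
  by (simp add: has_weak_deriv_def)

lemma has_weak_deriv_2:
  "has_weak_deriv \<Omega> 2 f g \<longleftrightarrow> (\<forall>\<phi>\<in>test_functions \<Omega>.
    L2_inner (lebesgue_on \<Omega>) f (deriv (deriv \<phi>)) = L2_inner (lebesgue_on \<Omega>) g \<phi>)"
  by (simp add: has_weak_deriv_def numeral_2_eq_2)

lemma L2_inner_deriv_test_function:
  assumes "a < b" "smooth_on UNIV F" "\<phi> \<in> test_functions {a<..<b}"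
  shows "L2_inner (leb a b) F (deriv \<phi>)
    = - L2_inner (leb a b) (deriv F) \<phi>"
proof -
  have "\<phi> a = 0" "\<phi> b = 0" using test_function_zero[OF assms(3)] by auto
  then show ?thesis
    using L2_inner_by_parts[of a b F "deriv F" \<phi> "deriv \<phi>"] assms
    by (simp add: smooth_DERIV smooth_continuous_on smooth_deriv test_function_smooth)
qed

lemma weak_deriv_unique:
  assumes "a < b" "g \<in> L2 (leb a b)" "k \<in> L2 (leb a b)"
    and "has_weak_deriv {a<..<b} 1 f g" "has_weak_deriv {a<..<b} 1 f k"
  shows "AE x in leb a b. g x = k x"
proof -
  let ?M = "leb a b"
  have one: "(\<lambda>x. 1) \<in> L2 ?M" by (intro continuous_L2 continuous_intros)
  have "AE x in ?M. g x - k x = 0"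
  proof (rule AE_eq_zero_if_orthogonal_to_test_functions)
    show "integrable ?M (\<lambda>x. g x - k x)"
      using L2_integrable_mult[OF L2_diff[OF assms(2,3)] one] by simp
    fix \<phi> assume \<phi>: "\<phi> \<in> test_functions {a<..<b}"
    have "L2_inner ?M (\<lambda>x. g x - k x) \<phi> = 0"
      using assms \<phi> by (simp del: One_nat_def add: has_weak_deriv_1 L2_inner_diff_left test_function_L2)
    then show "(\<integral>x. (g x - k x) * \<phi> x \<partial>?M) = 0" by (simp add: L2_inner_def)
  qed
  then show ?thesis by eventually_elim simp
qed

text \<open>By uniqueness, the derivative that enters the norm of \<open>H\<^sup>1\<close> may be replaced by any other
  weak derivative.\<close>

lemma H1_norm_eq:
  assumes "a < b" "g \<in> L2 (leb a b)" "has_weak_deriv {a<..<b} 1 f g"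
  shows "H1_norm {a<..<b} f
    = sqrt ((L2_norm (leb a b) f)\<^sup>2 + (L2_norm (leb a b) g)\<^sup>2)"
proof -
  let ?M = "leb a b"
  have "weak_deriv {a<..<b} f \<in> L2 ?M \<and> has_weak_deriv {a<..<b} 1 f (weak_deriv {a<..<b} f)"
    unfolding weak_deriv_def by (rule someI[of _ g]) (use assms in auto)
  then have "L2_norm ?M (weak_deriv {a<..<b} f) = L2_norm ?M g"
    using weak_deriv_unique[OF assms(1) _ assms(2) _ assms(3)] assms(2)
    by (intro L2_norm_cong_AE L2_measurable) auto
  then show ?thesis by (simp add: H1_norm_def)
qed

lemma H1_norm_tendsto_0_iff:
  assumes "a < b" "\<And>n. g n \<in> L2 (leb a b)" "\<And>n. has_weak_deriv {a<..<b} 1 (f n) (g n)"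
  shows "((\<lambda>n. H1_norm {a<..<b} (f n)) \<longlongrightarrow> 0) K \<longleftrightarrow>
    ((\<lambda>n. L2_norm (leb a b) (f n)) \<longlongrightarrow> 0) K \<and>
    ((\<lambda>n. L2_norm (leb a b) (g n)) \<longlongrightarrow> 0) K"
    (is "?H \<longleftrightarrow> (?f \<longlongrightarrow> 0) K \<and> (?g \<longlongrightarrow> 0) K")
proof -
  have eq: "H1_norm {a<..<b} (f n) = sqrt ((?f n)\<^sup>2 + (?g n)\<^sup>2)" for n
    using H1_norm_eq assms by blast
  show ?thesis
  proof
    assume H: ?H
    show "(?f \<longlongrightarrow> 0) K \<and> (?g \<longlongrightarrow> 0) K"
    proof
      show "(?f \<longlongrightarrow> 0) K"
        by (rule tendsto_sandwich[OF _ _ tendsto_const H])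
           (auto simp: eq L2_norm_nonneg)
      show "(?g \<longlongrightarrow> 0) K"
        by (rule tendsto_sandwich[OF _ _ tendsto_const H])
           (auto simp: eq L2_norm_nonneg)
    qed
  next
    assume "(?f \<longlongrightarrow> 0) K \<and> (?g \<longlongrightarrow> 0) K"
    then have "((\<lambda>n. sqrt ((?f n)\<^sup>2 + (?g n)\<^sup>2)) \<longlongrightarrow> sqrt (0\<^sup>2 + 0\<^sup>2)) K"
      by (intro tendsto_intros) auto
    then show ?H by (simp add: eq)
  qed
qed

text \<open>The weak derivative is a closed operator: both sides of its defining identity pass to the
  limit in \<open>L\<^sup>2\<close>.\<close>

lemma has_weak_deriv_limit:
  assumes "a < b"
    and f: "f \<in> L2 (leb a b)" "g \<in> L2 (leb a b)"
    and S: "\<And>n. smooth_on UNIV (S n)"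
    and lim: "(\<lambda>n. L2_norm (leb a b) (\<lambda>x. S n x - f x)) \<longlonglongrightarrow> 0"
      "(\<lambda>n. L2_norm (leb a b) (\<lambda>x. deriv (S n) x - g x)) \<longlonglongrightarrow> 0"
  shows "has_weak_deriv {a<..<b} 1 f g"
  unfolding has_weak_deriv_1
proof
  fix \<phi> assume \<phi>: "\<phi> \<in> test_functions {a<..<b}"
  let ?M = "leb a b"
  have "(\<lambda>n. L2_inner ?M (S n) (deriv \<phi>)) \<longlonglongrightarrow> L2_inner ?M f (deriv \<phi>)"
    by (rule L2_inner_tendsto[OF smooth_L2[OF S] f(1) test_function_L2[OF test_function_deriv[OF \<phi>]] lim(1)])
  moreover have "(\<lambda>n. - L2_inner ?M (deriv (S n)) \<phi>) \<longlonglongrightarrow> - L2_inner ?M g \<phi>"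
    by (intro tendsto_minus L2_inner_tendsto[OF smooth_L2[OF smooth_deriv[OF S]] f(2) test_function_L2[OF \<phi>] lim(2)])
  ultimately show "L2_inner ?M f (deriv \<phi>) = - L2_inner ?M g \<phi>"
    using LIMSEQ_unique L2_inner_deriv_test_function[OF \<open>a < b\<close> S \<phi>] by simp
qed

lemma has_weak_deriv_deriv:
  assumes "a < b" "smooth_on UNIV f"
  shows "has_weak_deriv {a<..<b} 1 f (deriv f)"
  using assms by (simp del: One_nat_def add: has_weak_deriv_1 L2_inner_deriv_test_function)

lemma has_weak_deriv_1_diff:
  assumes "f \<in> L2 (leb a b)" "g \<in> L2 (leb a b)"
    "f' \<in> L2 (leb a b)" "g' \<in> L2 (leb a b)"
    and "has_weak_deriv {a<..<b} 1 f f'" "has_weak_deriv {a<..<b} 1 g g'"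
  shows "has_weak_deriv {a<..<b} 1 (\<lambda>x. f x - g x) (\<lambda>x. f' x - g' x)"
  using assms by (simp del: One_nat_def add: has_weak_deriv_1 L2_inner_diff_left test_function_L2 test_function_deriv)

text \<open>A smooth function with boundary values \<open>0\<close> is bounded by a multiple of the distance to the
  boundary. This compensates the growth of the derivative of the cutoffs.\<close>

lemma vanishing_smooth_approx:
  assumes "a < b" and g: "smooth_on UNIV g" "g a = 0" "g b = 0"
  obtains \<phi> where "\<And>n. \<phi> n \<in> test_functions {a<..<b}"
    "(\<lambda>n. L2_norm (leb a b) (\<lambda>x. \<phi> n x - g x)) \<longlonglongrightarrow> 0"
    "(\<lambda>n. L2_norm (leb a b) (\<lambda>x. deriv (\<phi> n) x - deriv g x)) \<longlonglongrightarrow> 0"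
proof -
  let ?\<psi> = "flat_exp 1" and ?\<eta> = "\<lambda>n. cutoff a b (real (Suc n))"
  define \<phi> where "\<phi> n x = ?\<eta> n x * g x" for n x
  have test: "\<phi> n \<in> test_functions {a<..<b}" for n
    unfolding \<phi>_def by (intro test_function_mult cutoff_test_function g) auto
  obtain B where B: "B \<ge> 0" "\<And>x. x \<in> {a..b} \<Longrightarrow> \<bar>g x\<bar> \<le> B"
    using continuous_bounded[OF smooth_continuous_on[OF g(1)]] by blast
  obtain C where C: "C \<ge> 0" "\<And>x. x \<in> {a..b} \<Longrightarrow> \<bar>deriv g x\<bar> \<le> C"
    using continuous_bounded[OF smooth_continuous_on[OF smooth_deriv[OF g(1)]]] by blast
  have lip: "\<bar>g x - g y\<bar> \<le> C * \<bar>x - y\<bar>" if "x \<in> {a..b}" "y \<in> {a..b}" for x y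
    using field_differentiable_bound[of "{a..b}" g "deriv g" C x y] that C(2)
    by (auto intro: has_field_derivative_at_within smooth_DERIV[OF g(1)])
  have \<eta>01: "\<bar>?\<eta> n x - 1\<bar> \<le> 1" for n x
    using cutoff_bounds[of a b "real (Suc n)" x] by auto
  have \<eta>1: "(\<lambda>n. ?\<eta> n x) \<longlonglongrightarrow> 1" if "x \<in> {a<..<b}" for x
    using cutoff_tendsto_indicator[of a b x] that by simp
  have meas: "(\<lambda>x. \<phi> n x - g x) \<in> borel_measurable (leb a b)"
    "(\<lambda>x. deriv (\<phi> n) x - deriv g x) \<in> borel_measurable (leb a b)" for n
    using test g by (intro L2_measurable L2_diff test_function_L2 smooth_L2 smooth_deriv
        test_function_deriv; simp)+
  have 1: "(\<lambda>n. L2_norm (leb a b) (\<lambda>x. \<phi> n x - g x)) \<longlonglongrightarrow> 0"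
  proof (rule L2_norm_tendsto_0_bounded[where B = B])
    fix x assume x: "x \<in> {a<..<b}"
    have "(\<lambda>n. ?\<eta> n x * g x - g x) \<longlonglongrightarrow> 1 * g x - g x"
      using \<eta>1[OF x] by (intro tendsto_intros)
    then show "(\<lambda>n. \<phi> n x - g x) \<longlonglongrightarrow> 0" by (simp add: \<phi>_def)
    fix n
    have "\<phi> n x - g x = (?\<eta> n x - 1) * g x" by (simp add: \<phi>_def algebra_simps)
    also have "\<bar>\<dots>\<bar> \<le> 1 * B"
      unfolding abs_mult using \<eta>01[of n x] B x by (intro mult_mono) auto
    finally show "\<bar>\<phi> n x - g x\<bar> \<le> B" by simp
  qed (rule meas)
  define l where "l n x = real (Suc n) * (x - a) * deriv ?\<psi> (real (Suc n) * (x - a) - 1)" for n x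
  define r where "r n x = real (Suc n) * (b - x) * deriv ?\<psi> (real (Suc n) * (b - x) - 1)" for n x
  define l' where "l' n x = ?\<psi> (real (Suc n) * (x - a) - 1)" for n x
  define r' where "r' n x = ?\<psi> (real (Suc n) * (b - x) - 1)" for n x
  have deriv_eq: "deriv (\<phi> n) x - deriv g x
      = (?\<eta> n x - 1) * deriv g x + (l n x * r' n x) * (g x / (x - a)) - (r n x * l' n x) * (g x / (b - x))"
    if x: "x \<in> {a<..<b}" for n x
  proof -
    let ?m = "real (Suc n)"
    have "((\<lambda>x. ?m * (x - a) - 1) has_real_derivative ?m) (at x)"
      "((\<lambda>x. ?m * (b - x) - 1) has_real_derivative - ?m) (at x)"
      by (auto intro!: derivative_eq_intros)
    note DERIV_chain2[OF smooth_DERIV[OF smooth_flat_exp[of 1]] this(1)]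
      DERIV_chain2[OF smooth_DERIV[OF smooth_flat_exp[of 1]] this(2)]
    then have "(\<phi> n has_real_derivative
        (deriv ?\<psi> (?m * (x - a) - 1) * ?m * r' n x + deriv ?\<psi> (?m * (b - x) - 1) * - ?m * l' n x) * g x
        + deriv g x * ?\<eta> n x) (at x)"
      unfolding \<phi>_def[abs_def] cutoff_def l'_def r'_def
      by (intro DERIV_mult smooth_DERIV g)
    then have "deriv (\<phi> n) x = (deriv ?\<psi> (?m * (x - a) - 1) * ?m * r' n x
        + deriv ?\<psi> (?m * (b - x) - 1) * - ?m * l' n x) * g x + deriv g x * ?\<eta> n x"
      by (rule DERIV_imp_deriv)
    moreover have "(l n x * r' n x) * (g x / (x - a)) = deriv ?\<psi> (?m * (x - a) - 1) * ?m * r' n x * g x"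
      "(r n x * l' n x) * (g x / (b - x)) = deriv ?\<psi> (?m * (b - x) - 1) * ?m * l' n x * g x"
      using x by (simp_all add: l_def r_def del: of_nat_Suc)
    ultimately show ?thesis by (simp add: left_diff_distrib distrib_right mult.commute[of "deriv g x"] del: of_nat_Suc)
  qed
  have quot: "\<bar>g x / (x - a)\<bar> \<le> C" "\<bar>g x / (b - x)\<bar> \<le> C" if "x \<in> {a<..<b}" for x
    using lip[of x a] lip[of x b] that g(2,3) by (auto simp: divide_le_eq)
  have bnd: "\<bar>l n x\<bar> \<le> 2" "\<bar>r n x\<bar> \<le> 2" "\<bar>l' n x\<bar> \<le> 1" "\<bar>r' n x\<bar> \<le> 1" for n x
    using weighted_deriv_flat_exp_le[of "real (Suc n) * (x - a) - 1"]
      weighted_deriv_flat_exp_le[of "real (Suc n) * (b - x) - 1"] flat_exp_1_bounds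
    by (simp_all add: l_def r_def l'_def r'_def)
  have 2: "(\<lambda>n. L2_norm (leb a b) (\<lambda>x. deriv (\<phi> n) x - deriv g x)) \<longlonglongrightarrow> 0"
  proof (rule L2_norm_tendsto_0_bounded[where B = "1 * C + (2 * 1) * C + (2 * 1) * C"])
    fix x assume x: "x \<in> {a<..<b}"
    have "(\<lambda>n. l n x) \<longlonglongrightarrow> 0" "(\<lambda>n. r n x) \<longlonglongrightarrow> 0" "(\<lambda>n. l' n x) \<longlonglongrightarrow> 1" "(\<lambda>n. r' n x) \<longlonglongrightarrow> 1"
      unfolding l_def r_def l'_def r'_def using x
      by (auto intro!: weighted_deriv_flat_exp_tendsto_0 flat_exp_1_tendsto simp del: of_nat_Suc)
    then have "(\<lambda>n. (?\<eta> n x - 1) * deriv g x + (l n x * r' n x) * (g x / (x - a)) - (r n x * l' n x) * (g x / (b - x)))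
        \<longlonglongrightarrow> (1 - 1) * deriv g x + (0 * 1) * (g x / (x - a)) - (0 * 1) * (g x / (b - x))"
      using \<eta>1[OF x] by (intro tendsto_add tendsto_diff tendsto_mult tendsto_const) auto
    then show "(\<lambda>n. deriv (\<phi> n) x - deriv g x) \<longlonglongrightarrow> 0"
      by (simp add: deriv_eq[OF x])
    fix n
    have "\<bar>(?\<eta> n x - 1) * deriv g x\<bar> \<le> 1 * C"
      unfolding abs_mult using \<eta>01[of n x] C x by (intro mult_mono) auto
    moreover have "\<bar>(l n x * r' n x) * (g x / (x - a))\<bar> \<le> (2 * 1) * C"
      unfolding abs_mult[of "_ * _"] abs_mult[of "l n x"] using bnd quot(1)[OF x] by (intro mult_mono) auto
    moreover have "\<bar>(r n x * l' n x) * (g x / (b - x))\<bar> \<le> (2 * 1) * C"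
      unfolding abs_mult[of "_ * _"] abs_mult[of "r n x"] using bnd quot(2)[OF x] by (intro mult_mono) auto
    ultimately show "\<bar>deriv (\<phi> n) x - deriv g x\<bar> \<le> 1 * C + (2 * 1) * C + (2 * 1) * C"
      unfolding deriv_eq[OF x] by linarith
  qed (rule meas)
  show ?thesis using that test 1 2 by blast
qed

text \<open>Since \<open>H\<^sup>1\<^sub>0\<close> is defined as a closure of the test functions, limits of smooth functions with
  boundary values \<open>0\<close> are reached by a diagonal choice of approximants.\<close>

lemma H1_0I:
  assumes "a < b"
    and f: "f \<in> L2 (leb a b)" "g \<in> L2 (leb a b)"
    and S: "\<And>n. smooth_on UNIV (S n)" "\<And>n. S n a = 0" "\<And>n. S n b = 0"
    and lim: "(\<lambda>n. L2_norm (leb a b) (\<lambda>x. S n x - f x)) \<longlonglongrightarrow> 0"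
      "(\<lambda>n. L2_norm (leb a b) (\<lambda>x. deriv (S n) x - g x)) \<longlonglongrightarrow> 0"
  shows "f \<in> H1_0 {a<..<b}"
proof -
  let ?M = "leb a b"
  have "\<exists>\<phi>. \<phi> \<in> test_functions {a<..<b} \<and> L2_norm ?M (\<lambda>x. \<phi> x - S n x) < 1 / real (Suc n) \<and>
      L2_norm ?M (\<lambda>x. deriv \<phi> x - deriv (S n) x) < 1 / real (Suc n)" for n
  proof -
    obtain \<phi> where \<phi>: "\<And>k. \<phi> k \<in> test_functions {a<..<b}"
      "(\<lambda>k. L2_norm ?M (\<lambda>x. \<phi> k x - S n x)) \<longlonglongrightarrow> 0"
      "(\<lambda>k. L2_norm ?M (\<lambda>x. deriv (\<phi> k) x - deriv (S n) x)) \<longlonglongrightarrow> 0"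
      using vanishing_smooth_approx[OF \<open>a < b\<close> S] by blast
    have "\<forall>\<^sub>F k in sequentially. L2_norm ?M (\<lambda>x. \<phi> k x - S n x) < 1 / real (Suc n) \<and>
        L2_norm ?M (\<lambda>x. deriv (\<phi> k) x - deriv (S n) x) < 1 / real (Suc n)"
      using \<phi>(2,3) by (intro eventually_conj order_tendstoD) auto
    then obtain k where "L2_norm ?M (\<lambda>x. \<phi> k x - S n x) < 1 / real (Suc n) \<and>
        L2_norm ?M (\<lambda>x. deriv (\<phi> k) x - deriv (S n) x) < 1 / real (Suc n)"
      by (auto simp: eventually_sequentially)
    then show ?thesis using \<phi>(1) by blast
  qed
  then have "\<forall>n. \<exists>\<phi>. \<phi> \<in> test_functions {a<..<b} \<and> L2_norm ?M (\<lambda>x. \<phi> x - S n x) < 1 / real (Suc n) \<and>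
      L2_norm ?M (\<lambda>x. deriv \<phi> x - deriv (S n) x) < 1 / real (Suc n)" ..
  from choice[OF this] obtain \<phi> where \<phi>: "\<And>n. \<phi> n \<in> test_functions {a<..<b}"
    "\<And>n. L2_norm ?M (\<lambda>x. \<phi> n x - S n x) < 1 / real (Suc n)"
    "\<And>n. L2_norm ?M (\<lambda>x. deriv (\<phi> n) x - deriv (S n) x) < 1 / real (Suc n)"
    by blast
  have inv: "(\<lambda>n. 1 / real (Suc n)) \<longlonglongrightarrow> 0" by real_asymp
  have lim\<phi>: "(\<lambda>n. L2_norm ?M (\<lambda>x. u x - p n x)) \<longlonglongrightarrow> 0"
    if "\<And>n. p n \<in> L2 ?M" "\<And>n. q n \<in> L2 ?M" "u \<in> L2 ?M"
      "\<And>n. L2_norm ?M (\<lambda>x. p n x - q n x) < 1 / real (Suc n)"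
      "(\<lambda>n. L2_norm ?M (\<lambda>x. q n x - u x)) \<longlonglongrightarrow> 0" for p q u
  proof (rule tendsto_sandwich[OF _ _ tendsto_const])
    show "(\<lambda>n. 1 / real (Suc n) + L2_norm ?M (\<lambda>x. q n x - u x)) \<longlonglongrightarrow> 0"
      using tendsto_add[OF inv that(5)] by simp
    have "L2_norm ?M (\<lambda>x. u x - p n x) \<le> 1 / real (Suc n) + L2_norm ?M (\<lambda>x. q n x - u x)" for n
      using L2_norm_triangle_diff[OF that(1,2,3), of n n] that(4)[of n]
      by (simp add: L2_norm_minus_commute[of _ u])
    then show "\<forall>\<^sub>F n in sequentially. L2_norm ?M (\<lambda>x. u x - p n x) \<le> 1 / real (Suc n) + L2_norm ?M (\<lambda>x. q n x - u x)"
      by (intro always_eventually allI)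
  qed (simp add: L2_norm_nonneg)
  have wd: "has_weak_deriv {a<..<b} 1 f g"
    using has_weak_deriv_limit[OF \<open>a < b\<close> f S(1) lim] .
  have \<phi>L2: "\<phi> n \<in> L2 ?M" "deriv (\<phi> n) \<in> L2 ?M" for n
    using \<phi>(1) test_function_L2 test_function_deriv by blast+
  have "(\<lambda>n. H1_norm {a<..<b} (\<lambda>x. f x - \<phi> n x)) \<longlonglongrightarrow> 0"
  proof (subst H1_norm_tendsto_0_iff[where g = "\<lambda>n x. g x - deriv (\<phi> n) x"])
    show "has_weak_deriv {a<..<b} 1 (\<lambda>x. f x - \<phi> n x) (\<lambda>x. g x - deriv (\<phi> n) x)" for n
      using f \<phi>L2 wd \<phi>(1) \<open>a < b\<close>
      by (intro has_weak_deriv_1_diff has_weak_deriv_deriv) (auto intro: test_function_smooth)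
    show "(\<lambda>n. L2_norm ?M (\<lambda>x. f x - \<phi> n x)) \<longlonglongrightarrow> 0 \<and> (\<lambda>n. L2_norm ?M (\<lambda>x. g x - deriv (\<phi> n) x)) \<longlonglongrightarrow> 0"
      using lim\<phi>[OF \<phi>L2(1) smooth_L2[OF S(1)] f(1) \<phi>(2) lim(1)]
        lim\<phi>[OF \<phi>L2(2) smooth_L2[OF smooth_deriv[OF S(1)]] f(2) \<phi>(3) lim(2)] by blast
  qed (use f \<phi>L2 \<open>a < b\<close> in \<open>auto intro: L2_diff\<close>)
  then show ?thesis
    unfolding H1_0_def H1_def
    by (intro CollectI conjI f(1) bexI[of _ g] exI[of _ \<phi>] allI \<phi>(1) wd f(2))
qed

lemma vanishing_smooth_H1_0:
  assumes "a < b" "smooth_on UNIV g" "g a = 0" "g b = 0"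
  shows "g \<in> H1_0 {a<..<b}"
  using assms
  by (intro H1_0I[of a b g "deriv g" "\<lambda>_. g"] smooth_L2 smooth_deriv)
     (auto simp: L2_norm_def L2_inner_def)

lemma H1_0_approx:
  assumes "a < b" "w \<in> H1_0 {a<..<b}"
  obtains g \<phi> where "g \<in> L2 (leb a b)" "has_weak_deriv {a<..<b} 1 w g"
    "\<And>n. \<phi> n \<in> test_functions {a<..<b}"
    "(\<lambda>n. L2_norm (leb a b) (\<lambda>x. \<phi> n x - w x)) \<longlonglongrightarrow> 0"
    "(\<lambda>n. L2_norm (leb a b) (\<lambda>x. deriv (\<phi> n) x - g x)) \<longlonglongrightarrow> 0"
proof -
  let ?M = "leb a b"
  obtain g \<phi> where w: "w \<in> L2 ?M" and g: "g \<in> L2 ?M" "has_weak_deriv {a<..<b} 1 w g"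
    and \<phi>: "\<And>n. \<phi> n \<in> test_functions {a<..<b}" "(\<lambda>n. H1_norm {a<..<b} (\<lambda>x. w x - \<phi> n x)) \<longlonglongrightarrow> 0"
    using assms unfolding H1_0_def H1_def by blast
  have \<phi>L2: "\<phi> n \<in> L2 ?M" "deriv (\<phi> n) \<in> L2 ?M" for n
    using \<phi>(1) test_function_L2 test_function_deriv by blast+
  have "has_weak_deriv {a<..<b} 1 (\<lambda>x. w x - \<phi> n x) (\<lambda>x. g x - deriv (\<phi> n) x)" for n
    using w g \<phi>L2 \<phi>(1) \<open>a < b\<close>
    by (intro has_weak_deriv_1_diff has_weak_deriv_deriv) (auto intro: test_function_smooth)
  then have "(\<lambda>n. L2_norm ?M (\<lambda>x. w x - \<phi> n x)) \<longlonglongrightarrow> 0 \<and> (\<lambda>n. L2_norm ?M (\<lambda>x. g x - deriv (\<phi> n) x)) \<longlonglongrightarrow> 0"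
    using \<phi>(2) g \<phi>L2 \<open>a < b\<close>
    by (subst (asm) H1_norm_tendsto_0_iff[where g = "\<lambda>n x. g x - deriv (\<phi> n) x"]) (auto intro: L2_diff)
  then show ?thesis
    by (intro that[of g \<phi>, OF g \<phi>(1)])
       (simp_all add: L2_norm_minus_commute[of _ w] L2_norm_minus_commute[of _ g])
qed

text \<open>Green's formula: both factors are approximated by test functions, \<open>w\<close> by the definition of
  \<open>H\<^sup>1\<^sub>0\<close> and \<open>e\<close> because of its boundary values.\<close>

lemma dirichlet_laplacian_symmetric:
  assumes "a < b" and wz: "(w, z) \<in> dirichlet_laplacian {a<..<b}"
    and e: "smooth_on UNIV e" "e a = 0" "e b = 0"
  shows "L2_inner (leb a b) z e = - L2_inner (leb a b) w (deriv (deriv e))"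
proof -
  let ?M = "leb a b"
  have w: "w \<in> H1_0 {a<..<b}" and z: "z \<in> L2 ?M" and wd2: "has_weak_deriv {a<..<b} 2 w (\<lambda>x. - z x)"
    using wz by (auto simp: dirichlet_laplacian_def)
  have wL2: "w \<in> L2 ?M" using w by (simp add: H1_0_def H1_def)
  obtain g \<phi> where g: "g \<in> L2 ?M" "has_weak_deriv {a<..<b} 1 w g"
    and \<phi>: "\<And>n. \<phi> n \<in> test_functions {a<..<b}" "(\<lambda>n. L2_norm ?M (\<lambda>x. \<phi> n x - w x)) \<longlonglongrightarrow> 0"
      "(\<lambda>n. L2_norm ?M (\<lambda>x. deriv (\<phi> n) x - g x)) \<longlonglongrightarrow> 0"
    using H1_0_approx[OF \<open>a < b\<close> w] by blast
  obtain \<xi> where \<xi>: "\<And>n. \<xi> n \<in> test_functions {a<..<b}" "(\<lambda>n. L2_norm ?M (\<lambda>x. \<xi> n x - e x)) \<longlonglongrightarrow> 0"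
      "(\<lambda>n. L2_norm ?M (\<lambda>x. deriv (\<xi> n) x - deriv e x)) \<longlonglongrightarrow> 0"
    using vanishing_smooth_approx[OF \<open>a < b\<close> e] by blast
  have \<phi>L2: "\<phi> n \<in> L2 ?M" "deriv (\<phi> n) \<in> L2 ?M" and \<xi>L2: "\<xi> n \<in> L2 ?M" "deriv (\<xi> n) \<in> L2 ?M" for n
    using \<phi>(1) \<xi>(1) test_function_L2 test_function_deriv by blast+
  have "L2_inner ?M (deriv (\<xi> n)) g = L2_inner ?M (\<xi> n) z" for n
    using bspec[OF g(2)[unfolded has_weak_deriv_1] test_function_deriv[OF \<xi>(1)], of n]
      bspec[OF wd2[unfolded has_weak_deriv_2] \<xi>(1), of n]
    by (simp add: L2_inner_minus_left L2_inner_commute[of ?M "deriv _" g] L2_inner_commute[of ?M "\<xi> n" z])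
  moreover have "(\<lambda>n. L2_inner ?M (deriv (\<xi> n)) g) \<longlonglongrightarrow> L2_inner ?M (deriv e) g"
    by (rule L2_inner_tendsto[OF \<xi>L2(2) smooth_L2[OF smooth_deriv[OF e(1)]] g(1) \<xi>(3)])
  moreover have "(\<lambda>n. L2_inner ?M (\<xi> n) z) \<longlonglongrightarrow> L2_inner ?M e z"
    by (rule L2_inner_tendsto[OF \<xi>L2(1) smooth_L2[OF e(1)] z \<xi>(2)])
  ultimately have 1: "L2_inner ?M (deriv e) g = L2_inner ?M e z"
    using LIMSEQ_unique by simp
  have "L2_inner ?M (deriv (\<phi> n)) (deriv e) = - L2_inner ?M (\<phi> n) (deriv (deriv e))" for n
    using L2_inner_deriv_test_function[OF \<open>a < b\<close> smooth_deriv[OF e(1)] \<phi>(1), of n]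
    by (simp add: L2_inner_commute)
  moreover have "(\<lambda>n. L2_inner ?M (deriv (\<phi> n)) (deriv e)) \<longlonglongrightarrow> L2_inner ?M g (deriv e)"
    by (rule L2_inner_tendsto[OF \<phi>L2(2) g(1) smooth_L2[OF smooth_deriv[OF e(1)]] \<phi>(3)])
  moreover have "(\<lambda>n. - L2_inner ?M (\<phi> n) (deriv (deriv e))) \<longlonglongrightarrow> - L2_inner ?M w (deriv (deriv e))"
    by (intro tendsto_minus
        L2_inner_tendsto[OF \<phi>L2(1) wL2 smooth_L2[OF smooth_deriv[OF smooth_deriv[OF e(1)]]] \<phi>(2)])
  ultimately have "L2_inner ?M g (deriv e) = - L2_inner ?M w (deriv (deriv e))"
    using LIMSEQ_unique by simp
  with 1 show ?thesis by (simp add: L2_inner_commute)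
qed

text \<open>The Laplacian is closed, so it suffices that smooth functions with boundary values \<open>0\<close>
  converge in the graph norm. The first derivatives are required to converge as well, which gives
  membership in \<open>H\<^sup>1\<^sub>0\<close>.\<close>

lemma dirichlet_laplacianI:
  assumes "a < b"
    and f: "w \<in> L2 (leb a b)" "g \<in> L2 (leb a b)" "z \<in> L2 (leb a b)"
    and S: "\<And>n. smooth_on UNIV (S n)" "\<And>n. S n a = 0" "\<And>n. S n b = 0"
    and lim: "(\<lambda>n. L2_norm (leb a b) (\<lambda>x. S n x - w x)) \<longlonglongrightarrow> 0"
      "(\<lambda>n. L2_norm (leb a b) (\<lambda>x. deriv (S n) x - g x)) \<longlonglongrightarrow> 0"
      "(\<lambda>n. L2_norm (leb a b) (\<lambda>x. - deriv (deriv (S n)) x - z x)) \<longlonglongrightarrow> 0"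
  shows "(w, z) \<in> dirichlet_laplacian {a<..<b}"
proof -
  let ?M = "leb a b"
  have "L2_inner ?M w (deriv (deriv \<phi>)) = L2_inner ?M (\<lambda>x. - z x) \<phi>"
    if \<phi>: "\<phi> \<in> test_functions {a<..<b}" for \<phi>
  proof -
    have "(\<lambda>n. L2_inner ?M (S n) (deriv (deriv \<phi>))) \<longlonglongrightarrow> L2_inner ?M w (deriv (deriv \<phi>))"
      by (rule L2_inner_tendsto[OF smooth_L2[OF S(1)] f(1)
            test_function_L2[OF test_function_deriv[OF test_function_deriv[OF \<phi>]]] lim(1)])
    moreover have "L2_inner ?M (S n) (deriv (deriv \<phi>)) = - L2_inner ?M (\<lambda>x. - deriv (deriv (S n)) x) \<phi>" for n
      using L2_inner_deriv_test_function[OF \<open>a < b\<close> S(1) test_function_deriv[OF \<phi>], of n]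
        L2_inner_deriv_test_function[OF \<open>a < b\<close> smooth_deriv[OF S(1)] \<phi>, of n]
      by (simp add: L2_inner_minus_left)
    moreover have "(\<lambda>n. - L2_inner ?M (\<lambda>x. - deriv (deriv (S n)) x) \<phi>) \<longlonglongrightarrow> - L2_inner ?M z \<phi>"
      by (intro tendsto_minus L2_inner_tendsto[OF L2_minus[OF smooth_L2[OF smooth_deriv[OF smooth_deriv[OF S(1)]]]]
            f(3) test_function_L2[OF \<phi>] lim(3)])
    ultimately show ?thesis
      using LIMSEQ_unique by (simp add: L2_inner_minus_left)
  qed
  then show ?thesis
    using H1_0I[OF \<open>a < b\<close> f(1,2) S lim(1,2)] f(3)
    by (simp add: dirichlet_laplacian_def has_weak_deriv_2)
qed

section \<open>The sine basis\<close>

text \<open>The square roots of the Dirichlet eigenvalues; the lowest one has the index \<open>0\<close>.\<close>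

definition freq :: "real \<Rightarrow> real \<Rightarrow> nat \<Rightarrow> real" where
  "freq a b n = real (Suc n) * pi / (b - a)"

text \<open>Up to the power of the frequency, this is the \<open>q\<close>-th derivative of the \<open>n\<close>-th normalized
  Dirichlet eigenfunction.\<close>

definition mode :: "real \<Rightarrow> real \<Rightarrow> nat \<Rightarrow> nat \<Rightarrow> real \<Rightarrow> real" where
  "mode a b q n x = sqrt (2 / (b - a)) * sin (freq a b n * (x - a) + real q * (pi / 2))"

definition series :: "real \<Rightarrow> real \<Rightarrow> nat \<Rightarrow> (nat \<Rightarrow> real) \<Rightarrow> real \<Rightarrow> real" where
  "series a b q c x = (\<Sum>n. c n * mode a b q n x)"

definition rapid :: "real \<Rightarrow> real \<Rightarrow> (nat \<Rightarrow> real) \<Rightarrow> bool" where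
  "rapid a b c \<longleftrightarrow> (\<forall>k. summable (\<lambda>n. \<bar>c n\<bar> * freq a b n ^ k))"

lemma freq_pos: "a < b \<Longrightarrow> freq a b n > 0"
  by (simp add: freq_def)

lemma freq_inj: "a < b \<Longrightarrow> freq a b m = freq a b n \<longleftrightarrow> m = n"
  by (simp add: freq_def field_simps)

lemma sin_quarter_shift: "sin (t + real (Suc q) * (pi / 2)) = cos (t + real q * (pi / 2))"
  and cos_quarter_shift: "cos (t + real (Suc q) * (pi / 2)) = - sin (t + real q * (pi / 2))"
proof -
  have "t + real (Suc q) * (pi / 2) = (t + real q * (pi / 2)) + pi / 2"
    by (simp add: field_simps)
  then show "sin (t + real (Suc q) * (pi / 2)) = cos (t + real q * (pi / 2))"
    "cos (t + real (Suc q) * (pi / 2)) = - sin (t + real q * (pi / 2))"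
    by (simp_all only: sin_add cos_add sin_pi_half cos_pi_half) simp_all
qed

lemma mode_DERIV: "(mode a b q n has_real_derivative freq a b n * mode a b (Suc q) n x) (at x)"
  unfolding mode_def[abs_def] sin_quarter_shift
  by (auto intro!: derivative_eq_intros)

lemma mode_bound: "a < b \<Longrightarrow> \<bar>mode a b q n x\<bar> \<le> sqrt (2 / (b - a))"
  by (simp add: mode_def abs_mult mult_left_le)

lemma mode_add_2: "mode a b (Suc (Suc q)) n x = - mode a b q n x"
  unfolding mode_def sin_quarter_shift cos_quarter_shift by simp

lemma mode_add_even: "mode a b (2 * q) n x = (-1) ^ q * mode a b 0 n x"
  by (induction q) (simp_all add: mode_add_2)

lemma mode_boundary: "a < b \<Longrightarrow> mode a b 0 n a = 0" "a < b \<Longrightarrow> mode a b 0 n b = 0"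
  by (simp_all add: mode_def freq_def sin_times_pi_eq_0 del: of_nat_Suc)

lemma smooth_mode: "smooth_on UNIV (mode a b q n)"
proof -
  have "mode a b q n = (\<lambda>x. sqrt (2 / (b - a)) * sin (freq a b n * x + (real q * (pi / 2) - freq a b n * a)))"
    by (simp add: mode_def fun_eq_iff algebra_simps)
  then show ?thesis using smooth_sin by simp
qed

lemma mode_L2: "mode a b q n \<in> L2 (leb a b)"
  by (rule smooth_L2[OF smooth_mode])

lemma deriv_mode: "deriv (mode a b q n) = (\<lambda>x. freq a b n * mode a b (Suc q) n x)"
  by (intro ext DERIV_imp_deriv mode_DERIV)

lemma deriv2_mode: "deriv (deriv (mode a b 0 n)) = (\<lambda>x. - (freq a b n)\<^sup>2 * mode a b 0 n x)"
proof
  fix x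
  have "(deriv (mode a b 0 n) has_real_derivative freq a b n * (freq a b n * mode a b (Suc (Suc 0)) n x)) (at x)"
    unfolding deriv_mode by (intro DERIV_cmult mode_DERIV)
  from DERIV_imp_deriv[OF this] show "deriv (deriv (mode a b 0 n)) x = - (freq a b n)\<^sup>2 * mode a b 0 n x"
    by (simp add: mode_add_2 power2_eq_square)
qed

lemma rapid_summable: "rapid a b c \<Longrightarrow> summable (\<lambda>n. \<bar>c n\<bar> * freq a b n ^ k)"
  by (simp add: rapid_def)

lemma rapid_summable_abs: "rapid a b c \<Longrightarrow> summable (\<lambda>n. \<bar>c n\<bar>)"
  using rapid_summable[of a b c 0] by simp

lemma rapid_freq_mult:
  assumes "a < b" "rapid a b c"
  shows "rapid a b (\<lambda>n. freq a b n ^ p * c n)"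
  unfolding rapid_def
proof
  fix k
  have "\<bar>freq a b n ^ p * c n\<bar> * freq a b n ^ k = \<bar>c n\<bar> * freq a b n ^ (p + k)" for n
    using freq_pos[OF assms(1), of n] by (simp add: abs_mult power_add)
  then show "summable (\<lambda>n. \<bar>freq a b n ^ p * c n\<bar> * freq a b n ^ k)"
    using rapid_summable[OF assms(2)] by simp
qed

lemma rapid_finite: "(\<And>n. n \<ge> N \<Longrightarrow> c n = 0) \<Longrightarrow> rapid a b c"
  unfolding rapid_def by (intro allI summable_finite[of "{..<N}"]) (auto simp: not_less)

lemma series_term_bound:
  "a < b \<Longrightarrow> norm (c n * mode a b q n x) \<le> sqrt (2 / (b - a)) * \<bar>c n\<bar>"
  using mult_left_mono[OF mode_bound[of a b q n x], of "\<bar>c n\<bar>"] by (simp add: abs_mult mult.commute)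

lemma series_summable:
  assumes "a < b" "rapid a b c"
  shows "summable (\<lambda>n. c n * mode a b q n x)"
  by (rule summable_comparison_test[OF exI[of _ 0] summable_mult[OF rapid_summable_abs[OF assms(2)]]])
     (use series_term_bound[OF assms(1)] in blast)

lemma series_bound:
  assumes "a < b" "rapid a b c"
  shows "\<bar>series a b q c x\<bar> \<le> sqrt (2 / (b - a)) * (\<Sum>n. \<bar>c n\<bar>)"
proof -
  have "norm (series a b q c x) \<le> (\<Sum>n. sqrt (2 / (b - a)) * \<bar>c n\<bar>)"
    unfolding series_def
    by (rule norm_suminf_le[of "\<lambda>n. c n * mode a b q n x" "\<lambda>n. sqrt (2 / (b - a)) * \<bar>c n\<bar>",
          OF series_term_bound[where c = c, OF assms(1)] summable_mult[OF rapid_summable_abs[OF assms(2)]]])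
  then show ?thesis by (simp add: suminf_mult rapid_summable_abs[OF assms(2)])
qed

lemma series_DERIV:
  assumes "a < b" "rapid a b c"
  shows "(series a b q c has_real_derivative series a b (Suc q) (\<lambda>n. freq a b n * c n) x) (at x)"
proof -
  have "uniform_limit UNIV (\<lambda>N x. \<Sum>n<N. c n * (freq a b n * mode a b (Suc q) n x))
      (\<lambda>x. \<Sum>n. c n * (freq a b n * mode a b (Suc q) n x)) sequentially"
  proof (rule Weierstrass_m_test)
    show "norm (c n * (freq a b n * mode a b (Suc q) n x)) \<le> sqrt (2 / (b - a)) * \<bar>freq a b n ^ 1 * c n\<bar>" for n x
      using series_term_bound[OF assms(1), of "\<lambda>n. freq a b n * c n" n "Suc q" x] by (simp add: ac_simps)
    show "summable (\<lambda>n. sqrt (2 / (b - a)) * \<bar>freq a b n ^ 1 * c n\<bar>)"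
      by (intro summable_mult rapid_summable_abs[OF rapid_freq_mult[OF assms]])
  qed
  then have "((\<lambda>x. \<Sum>n. c n * mode a b q n x) has_real_derivative
      (\<Sum>n. c n * (freq a b n * mode a b (Suc q) n x))) (at x)"
    using series_summable[OF assms]
    by (intro has_field_derivative_series'(2)[of UNIV _ _ x])
       (auto intro!: DERIV_cmult mode_DERIV uniformly_convergentI)
  then show ?thesis by (simp add: series_def[abs_def] ac_simps)
qed

lemma deriv_series:
  assumes "a < b" "rapid a b c"
  shows "deriv (series a b q c) = series a b (Suc q) (\<lambda>n. freq a b n * c n)"
  by (intro ext DERIV_imp_deriv series_DERIV assms)

lemma higher_deriv_series:
  assumes "a < b" "rapid a b c"
  shows "(deriv ^^ p) (series a b q c) = series a b (q + p) (\<lambda>n. freq a b n ^ p * c n)"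
proof (induction p)
  case (Suc p)
  then show ?case
    using deriv_series[OF assms(1) rapid_freq_mult[OF assms, of p], of "q + p"]
    by (simp add: ac_simps)
qed simp

lemma smooth_series:
  assumes "a < b" "rapid a b c"
  shows "smooth_on UNIV (series a b q c)"
proof (rule smooth_coinduct[where P = "\<lambda>f. \<exists>q c. rapid a b c \<and> f = series a b q c"])
  show "\<exists>q' c'. rapid a b c' \<and> series a b q c = series a b q' c'" using assms by blast
  fix f assume "\<exists>q c. rapid a b c \<and> f = series a b q c"
  then obtain q c where c: "rapid a b c" "f = series a b q c" by blast
  show "\<exists>g. (\<forall>x. (f has_real_derivative g x) (at x)) \<and> (\<exists>q c. rapid a b c \<and> g = series a b q c)"
    unfolding c(2)
  proof (intro exI conjI allI)
    show "(series a b q c has_real_derivative series a b (Suc q) (\<lambda>n. freq a b n * c n) x) (at x)" for x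
      by (rule series_DERIV[OF assms(1) c(1)])
    show "rapid a b (\<lambda>n. freq a b n * c n)"
      using rapid_freq_mult[OF assms(1) c(1), of 1] by simp
  qed (rule refl)
qed

lemma series_boundary: "a < b \<Longrightarrow> series a b 0 c a = 0" "a < b \<Longrightarrow> series a b 0 c b = 0"
  by (simp_all add: series_def mode_boundary)

lemma series_finite:
  "(\<And>n. n \<ge> N \<Longrightarrow> c n = 0) \<Longrightarrow> series a b q c x = (\<Sum>n<N. c n * mode a b q n x)"
  unfolding series_def by (rule suminf_finite) (auto simp: not_less)

text \<open>Integration by parts moves one derivative of \<open>- e\<^sub>n'' = \<mu>\<^sub>n\<^sup>2 e\<^sub>n\<close> to the other factor;
  the boundary terms vanish. The right-hand side is symmetric in \<open>m\<close> and \<open>n\<close>.\<close>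

lemma deriv_mode_orthogonal:
  assumes "a < b"
  shows "L2_inner (leb a b) (mode a b 0 m) (mode a b 0 n) * (freq a b n)\<^sup>2
    = L2_inner (leb a b) (deriv (mode a b 0 m)) (deriv (mode a b 0 n))"
proof -
  have "L2_inner (leb a b) (mode a b 0 m) (deriv (deriv (mode a b 0 n)))
      = - L2_inner (leb a b) (deriv (mode a b 0 m)) (deriv (mode a b 0 n))"
    using L2_inner_by_parts[OF assms, of "mode a b 0 m" "deriv (mode a b 0 m)"
        "deriv (mode a b 0 n)" "deriv (deriv (mode a b 0 n))"] mode_boundary[OF assms]
    by (simp add: smooth_DERIV smooth_continuous_on smooth_deriv smooth_mode)
  then have "- (freq a b n)\<^sup>2 * L2_inner (leb a b) (mode a b 0 m) (mode a b 0 n)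
      = - L2_inner (leb a b) (deriv (mode a b 0 m)) (deriv (mode a b 0 n))"
    by (simp only: deriv2_mode L2_inner_scale_right)
  then show ?thesis by (simp add: mult.commute)
qed

text \<open>Eigenfunctions for different eigenvalues are orthogonal by symmetry; the norm follows from
  \<open>sin\<^sup>2 + cos\<^sup>2 = 1\<close> and the fact that \<open>sin\<close> and \<open>cos\<close> contribute equally.\<close>

lemma mode_orthonormal:
  assumes "a < b"
  shows "L2_inner (leb a b) (mode a b 0 m) (mode a b 0 n) = (if m = n then 1 else 0)"
proof (cases "m = n")
  case False
  let ?I = "L2_inner (leb a b) (mode a b 0 m) (mode a b 0 n)"
  have "?I * (freq a b n)\<^sup>2 = ?I * (freq a b m)\<^sup>2"
    using deriv_mode_orthogonal[OF assms, of m n] deriv_mode_orthogonal[OF assms, of n m]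
    by (simp add: L2_inner_commute)
  moreover have "(freq a b n)\<^sup>2 \<noteq> (freq a b m)\<^sup>2"
    using False freq_inj[OF assms] freq_pos[OF assms] by (simp add: power2_eq_iff_nonneg less_imp_le)
  ultimately show ?thesis using False by auto
next
  case True
  let ?M = "leb a b"
  interpret finite_measure ?M by (rule finite_measure_interval)
  have pos: "freq a b n \<noteq> 0" using freq_pos[OF assms, of n] by simp
  have *: "L2_inner ?M (mode a b 0 n) (mode a b 0 n) = L2_inner ?M (mode a b 1 n) (mode a b 1 n)"
    using deriv_mode_orthogonal[OF assms, of n n] pos
    by (simp add: deriv_mode L2_inner_scale_left L2_inner_scale_right power2_eq_square)
  have const: "(b * 2 - a * 2) / (b - a) = 2" using assms by (simp add: field_simps)
  have square: "(s * t) * (s * t) + (s * r) * (s * r) = s\<^sup>2 * (t\<^sup>2 + r\<^sup>2)" for s t r :: real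
    by (simp add: power2_eq_square algebra_simps)
  have "mode a b 0 n x * mode a b 0 n x + mode a b 1 n x * mode a b 1 n x = 2 / (b - a)" for x
  proof -
    have "mode a b 0 n x = sqrt (2 / (b - a)) * sin (freq a b n * (x - a))"
      "mode a b 1 n x = sqrt (2 / (b - a)) * cos (freq a b n * (x - a))"
      using sin_quarter_shift[of "freq a b n * (x - a)" 0] by (simp_all add: mode_def)
    note modes = this
    have "mode a b 0 n x * mode a b 0 n x + mode a b 1 n x * mode a b 1 n x
        = (sqrt (2 / (b - a)))\<^sup>2 * ((sin (freq a b n * (x - a)))\<^sup>2 + (cos (freq a b n * (x - a)))\<^sup>2)"
      unfolding modes by (rule square)
    also have "\<dots> = 2 / (b - a)" using assms by simp
    finally show ?thesis .
  qed
  moreover have "L2_inner ?M (mode a b 0 n) (mode a b 0 n) + L2_inner ?M (mode a b 1 n) (mode a b 1 n)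
      = (\<integral>x. mode a b 0 n x * mode a b 0 n x + mode a b 1 n x * mode a b 1 n x \<partial>?M)"
    by (simp add: L2_inner_def L2_integrable_mult mode_L2)
  ultimately have "L2_inner ?M (mode a b 0 n) (mode a b 0 n) + L2_inner ?M (mode a b 1 n) (mode a b 1 n) = 2"
    using assms const by (simp add: measure_interval)
  with * True show ?thesis by simp
qed

text \<open>The products \<open>sin y cos\<^sup>k y\<close> are combinations of the sines, and on \<open>[0, \<pi>]\<close> every continuous
  function is a uniform limit of polynomials in \<open>cos y\<close>. So \<open>f sin y\<close> is orthogonal to all test
  functions.\<close>

lemma sine_total:
  assumes "a < b" and f: "f \<in> L2 (leb a b)"
    and zero: "\<And>n. L2_inner (leb a b) f (mode a b 0 n) = 0"
  shows "AE x in leb a b. f x = 0"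
proof -
  let ?M = "leb a b"
  define y where "y x = pi * (x - a) / (b - a)" for x
  have conty: "continuous_on S y" for S
    unfolding y_def using assms(1) by (intro continuous_intros) auto
  have y: "0 < y x" "y x < pi" if "x \<in> {a<..<b}" for x
    using that by (auto simp: y_def field_simps)
  have cont: "continuous_on S (\<lambda>x. sin (real m * y x) * cos (y x) ^ k)" for m k S
    by (intro continuous_intros conty)
  have sin_zero: "L2_inner ?M f (\<lambda>x. sin (real m * y x) * cos (y x) ^ k) = 0" for m k
  proof (induction k arbitrary: m)
    case 0
    show ?case
    proof (cases m)
      case 0
      then show ?thesis by (simp add: L2_inner_def)
    next
      case (Suc n)
      have "(\<lambda>x. sin (real m * y x) * cos (y x) ^ 0) = (\<lambda>x. (1 / sqrt (2 / (b - a))) * mode a b 0 n x)"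
        using Suc assms(1) by (simp add: mode_def freq_def y_def fun_eq_iff mult.assoc)
      then show ?thesis using zero[of n] by (simp only: L2_inner_scale_right mult_zero_right)
    qed
  next
    case (Suc k)
    show ?case
    proof (cases m)
      case 0
      then show ?thesis by (simp add: L2_inner_def)
    next
      case (Suc n)
      have "sin (real m * t) * cos t = 1 / 2 * sin (real (Suc m) * t) + 1 / 2 * sin (real n * t)" for t
        using Suc sin_add[of "real m * t" t] sin_diff[of "real m * t" t] by (simp add: algebra_simps)
      then have "(\<lambda>x. sin (real m * y x) * cos (y x) ^ Suc k) =
          (\<lambda>x. 1 / 2 * (sin (real (Suc m) * y x) * cos (y x) ^ k) + 1 / 2 * (sin (real n * y x) * cos (y x) ^ k))"
        by (simp only: power_Suc mult.assoc[symmetric]) (simp add: fun_eq_iff algebra_simps)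
      moreover have "L2_inner ?M f (\<lambda>x. 1 / 2 * (sin (real (Suc m) * y x) * cos (y x) ^ k) + 1 / 2 * (sin (real n * y x) * cos (y x) ^ k))
          = 1 / 2 * L2_inner ?M f (\<lambda>x. sin (real (Suc m) * y x) * cos (y x) ^ k)
          + 1 / 2 * L2_inner ?M f (\<lambda>x. sin (real n * y x) * cos (y x) ^ k)"
        by (simp only: L2_inner_add_right[OF L2_scale[OF continuous_L2[OF cont]] L2_scale[OF continuous_L2[OF cont]] f]
            L2_inner_scale_right)
      ultimately show ?thesis by (simp only: Suc.IH mult_zero_right add_0)
    qed
  qed
  have poly_zero: "L2_inner ?M f (\<lambda>x. sin (y x) * p (cos (y x))) = 0" if p: "real_polynomial_function p" for p
  proof -
    obtain c N where p: "p = (\<lambda>t. \<Sum>i\<le>N. c i * t ^ i)"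
      using p real_polynomial_function_iff_sum by blast
    have "L2_inner ?M (\<lambda>x. sin (y x) * p (cos (y x))) f
        = L2_inner ?M (\<lambda>x. \<Sum>i\<le>N. c i * (sin (real 1 * y x) * cos (y x) ^ i)) f"
      by (simp add: p sum_distrib_left ac_simps)
    also have "\<dots> = (\<Sum>i\<le>N. L2_inner ?M (\<lambda>x. c i * (sin (real 1 * y x) * cos (y x) ^ i)) f)"
      by (intro L2_inner_sum_left L2_scale continuous_L2 cont f)
    also have "\<dots> = 0"
      unfolding L2_inner_scale_left L2_inner_commute[of ?M _ f] sin_zero by simp
    finally show ?thesis by (simp only: L2_inner_commute[of ?M f])
  qed
  have siny: "(\<lambda>x. sin (y x)) \<in> L2 ?M" by (intro continuous_L2 continuous_intros conty)
  have "AE x in ?M. f x * sin (y x) = 0"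
  proof (rule AE_eq_zero_if_orthogonal_to_test_functions)
    show "integrable ?M (\<lambda>x. f x * sin (y x))" by (rule L2_integrable_mult[OF f siny])
    fix \<phi> assume \<phi>: "\<phi> \<in> test_functions {a<..<b}"
    have \<phi>cont: "continuous_on S \<phi>" for S by (rule smooth_continuous_on[OF test_function_smooth[OF \<phi>]])
    define G where "G t = \<phi> (a + (b - a) / pi * arccos t)" for t
    have G: "G (cos (y x)) = \<phi> x" if "x \<in> {a<..<b}" for x
      using y[OF that] assms(1) by (simp add: G_def arccos_cos) (simp add: y_def)
    have contG: "continuous_on {-1..1} G"
      unfolding G_def
      by (intro continuous_on_compose2[OF \<phi>cont[of UNIV]] continuous_on_add continuous_on_mult continuous_on_const continuous_on_arccos' subset_UNIV)
    \<comment> \<open>Uniform approximation of \<open>G\<close> by a polynomial within \<open>e\<close> changes the inner product by at most a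
      multiple of \<open>e\<close>, and the inner product with the polynomial is \<open>0\<close>.\<close>
    let ?I = "L2_inner ?M f (\<lambda>x. sin (y x) * \<phi> x)"
    have bound: "\<bar>?I\<bar> \<le> L2_norm ?M f * (e * sqrt (b - a))" if "e > 0" for e
    proof -
      obtain p where p: "real_polynomial_function p" "\<And>t. t \<in> {-1..1} \<Longrightarrow> \<bar>G t - p t\<bar> < e"
        by (rule Stone_Weierstrass_real_polynomial_function[OF compact_Icc contG \<open>e > 0\<close>]) (rule that, assumption, blast)
      have contp: "continuous_on S (\<lambda>x. p (cos (y x)))" for S
        using continuous_real_polymonial_function[OF p(1)]
        by (intro continuous_on_compose2[OF _ continuous_on_cos[OF conty] subset_UNIV]
            continuous_at_imp_continuous_on ballI)
      have L: "(\<lambda>x. sin (y x) * p (cos (y x))) \<in> L2 ?M" "(\<lambda>x. sin (y x) * \<phi> x) \<in> L2 ?M"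
        by (intro continuous_L2 continuous_intros conty contp \<phi>cont)+
      have I: "?I = L2_inner ?M f (\<lambda>x. sin (y x) * \<phi> x - sin (y x) * p (cos (y x)))"
        by (simp add: L2_inner_diff_right[OF L(2,1) f] poly_zero[OF p(1)])
      have "\<bar>?I\<bar> \<le> L2_norm ?M f * L2_norm ?M (\<lambda>x. sin (y x) * \<phi> x - sin (y x) * p (cos (y x)))"
        unfolding I by (rule L2_Cauchy_Schwarz[OF f L2_diff[OF L(2,1)]])
      also have "\<dots> \<le> L2_norm ?M f * (e * sqrt (b - a))"
      proof (intro mult_left_mono L2_norm_le_sup L2_norm_nonneg L2_diff L)
        fix x assume x: "x \<in> {a<..<b}"
        have "\<bar>sin (y x)\<bar> * \<bar>\<phi> x - p (cos (y x))\<bar> \<le> 1 * e"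
          using p(2)[of "cos (y x)"] G[OF x] by (intro mult_mono) auto
        then show "\<bar>sin (y x) * \<phi> x - sin (y x) * p (cos (y x))\<bar> \<le> e"
          by (simp only: abs_mult[symmetric] right_diff_distrib mult_1)
      qed (use assms(1) \<open>e > 0\<close> in auto)
      finally show ?thesis .
    qed
    have "?I = 0"
    proof (rule ccontr)
      define C where "C = L2_norm ?M f * sqrt (b - a)"
      define X where "X = \<bar>?I\<bar> / (2 * (C + 1))"
      assume "?I \<noteq> 0"
      moreover have "C \<ge> 0" using assms(1) L2_norm_nonneg[of ?M f] by (simp add: C_def)
      ultimately have X: "X > 0" "0 \<le> C * X" "X * (2 * (C + 1)) = \<bar>?I\<bar>"
        by (simp_all add: X_def)
      have eq: "X * (2 * (C + 1)) = 2 * (C * X) + 2 * X" by (simp add: algebra_simps)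
      have "\<bar>?I\<bar> \<le> C * X"
        using bound[OF X(1)] by (simp only: C_def mult.assoc mult.commute[of X])
      with X eq show False by linarith
    qed
    then show "(\<integral>x. f x * sin (y x) * \<phi> x \<partial>?M) = 0" by (simp add: L2_inner_def mult.assoc)
  qed
  moreover have "AE x in ?M. x \<in> {a<..<b}" by (rule AE_I2) simp
  ultimately show ?thesis
  proof eventually_elim
    case (elim x)
    then show ?case using sin_gt_zero[OF y[OF elim(2)]] by simp
  qed
qed

section \<open>Diagonalization of the Dirichlet Laplacian\<close>

definition sine_coeff :: "real \<Rightarrow> real \<Rightarrow> (real \<Rightarrow> real) \<Rightarrow> nat \<Rightarrow> real" where
  "sine_coeff a b f n = L2_inner (leb a b) f (mode a b 0 n)"

text \<open>Stated for an orthogonal system with arbitrary norms, because the derivatives of the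
  eigenfunctions form one as well.\<close>

lemma orthogonal_series_converges:
  assumes fin: "finite_measure M" and u: "\<And>n. u n \<in> L2 M"
    and orth: "\<And>m n. L2_inner M (u m) (u n) = (if m = n then \<kappa> n else 0)"
    and sum: "summable (\<lambda>n. (c n)\<^sup>2 * \<kappa> n)"
  shows "\<exists>f\<in>L2 M. (\<lambda>N. L2_norm M (\<lambda>x. (\<Sum>n<N. c n * u n x) - f x)) \<longlonglongrightarrow> 0"
proof (rule L2_complete[OF fin])
  show SL2: "(\<lambda>x. \<Sum>n<N. c n * u n x) \<in> L2 M" for N
    by (intro L2_sum L2_scale u)
  have block: "(L2_norm M (\<lambda>x. \<Sum>n\<in>A. c n * u n x))\<^sup>2 = (\<Sum>n\<in>A. (c n)\<^sup>2 * \<kappa> n)" if "finite A" for A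
  proof -
    have inner: "L2_inner M (u n) (\<lambda>x. \<Sum>n\<in>A. c n * u n x) = (if n \<in> A then c n * \<kappa> n else 0)" for n
    proof -
      have "L2_inner M (u n) (\<lambda>x. \<Sum>n\<in>A. c n * u n x) = (\<Sum>m\<in>A. c m * L2_inner M (u m) (u n))"
        unfolding L2_inner_commute[of M "u n"]
        by (subst L2_inner_sum_left) (simp_all add: L2_scale u L2_inner_scale_left)
      also have "\<dots> = (\<Sum>m\<in>A. if m = n then c m * \<kappa> n else 0)"
        by (intro sum.cong refl) (simp add: orth)
      finally show ?thesis using that by simp
    qed
    have "(L2_norm M (\<lambda>x. \<Sum>n\<in>A. c n * u n x))\<^sup>2
        = (\<Sum>n\<in>A. c n * L2_inner M (u n) (\<lambda>x. \<Sum>n\<in>A. c n * u n x))"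
      unfolding L2_norm_power2
      by (subst L2_inner_sum_left) (simp_all add: L2_scale L2_sum u L2_inner_scale_left)
    also have "\<dots> = (\<Sum>n\<in>A. (c n)\<^sup>2 * \<kappa> n)"
      by (intro sum.cong refl) (simp add: inner power2_eq_square)
    finally show ?thesis .
  qed
  fix e :: real assume "e > 0"
  then have "e\<^sup>2 > 0" by simp
  from sum[unfolded summable_Cauchy, rule_format, OF this]
  obtain N where N: "\<And>m n. m \<ge> N \<Longrightarrow> norm (\<Sum>i\<in>{m..<n}. (c i)\<^sup>2 * \<kappa> i) < e\<^sup>2"
    by blast
  have close: "L2_norm M (\<lambda>x. (\<Sum>n<m. c n * u n x) - (\<Sum>n<k. c n * u n x)) < e" if "N \<le> k" "k \<le> m" for m k
  proof -
    have diff: "(\<Sum>n<m. c n * u n x) - (\<Sum>n<k. c n * u n x) = (\<Sum>n\<in>{k..<m}. c n * u n x)" for x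
      using sum.atLeastLessThan_concat[of 0 k m "\<lambda>n. c n * u n x"] that(2)
      by (simp add: atLeast0LessThan)
    have "(L2_norm M (\<lambda>x. \<Sum>n\<in>{k..<m}. c n * u n x))\<^sup>2 < e\<^sup>2"
      using N[OF that(1), of m] by (simp add: block)
    then show ?thesis
      unfolding diff using \<open>e > 0\<close> by (intro power_less_imp_less_base[of _ 2 e]) simp_all
  qed
  have "L2_norm M (\<lambda>x. (\<Sum>n<m. c n * u n x) - (\<Sum>n<k. c n * u n x)) < e" if "N \<le> m" "N \<le> k" for m k
  proof (cases "k \<le> m")
    case True
    then show ?thesis using close[OF that(2)] by simp
  next
    case False
    then show ?thesis
      using close[OF that(1), of k] by (subst L2_norm_minus_commute) simp
  qed
  then show "\<exists>N. \<forall>m\<ge>N. \<forall>n\<ge>N. L2_norm M (\<lambda>x. (\<Sum>i<m. c i * u i x) - (\<Sum>i<n. c i * u i x)) < e"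
    by (intro exI[of _ N] allI impI)
qed

lemma sine_coeff_sum:
  assumes "a < b"
  shows "sine_coeff a b (\<lambda>x. \<Sum>n<N. c n * mode a b 0 n x) m = (if m < N then c m else 0)"
proof -
  have "sine_coeff a b (\<lambda>x. \<Sum>n<N. c n * mode a b 0 n x) m
      = (\<Sum>n<N. c n * L2_inner (leb a b) (mode a b 0 n) (mode a b 0 m))"
    unfolding sine_coeff_def by (subst L2_inner_sum_left) (simp_all add: L2_scale mode_L2 L2_inner_scale_left)
  also have "\<dots> = (\<Sum>n<N. if n = m then c n else 0)"
    by (intro sum.cong refl) (simp add: mode_orthonormal[OF assms])
  finally show ?thesis by simp
qed

lemma sine_coeff_diff:
  assumes "f \<in> L2 (leb a b)" "g \<in> L2 (leb a b)"
  shows "sine_coeff a b (\<lambda>x. f x - g x) n = sine_coeff a b f n - sine_coeff a b g n"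
  by (simp add: sine_coeff_def L2_inner_diff_left assms mode_L2)

lemma sine_coeff_limit:
  assumes "a < b" "f \<in> L2 (leb a b)"
    and lim: "(\<lambda>N. L2_norm (leb a b) (\<lambda>x. (\<Sum>n<N. c n * mode a b 0 n x) - f x)) \<longlonglongrightarrow> 0"
  shows "sine_coeff a b f m = c m"
proof -
  have "(\<lambda>N. sine_coeff a b (\<lambda>x. \<Sum>n<N. c n * mode a b 0 n x) m) \<longlonglongrightarrow> sine_coeff a b f m"
    unfolding sine_coeff_def
    by (rule L2_inner_tendsto[OF _ assms(2) mode_L2 lim]) (intro L2_sum L2_scale mode_L2)
  moreover have "(\<lambda>N. sine_coeff a b (\<lambda>x. \<Sum>n<N. c n * mode a b 0 n x) m) \<longlonglongrightarrow> c m"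
    by (rule Lim_transform_eventually[OF tendsto_const])
       (use eventually_gt_at_top[of m] in eventually_elim, simp add: sine_coeff_sum[OF assms(1)])
  ultimately show ?thesis by (rule LIMSEQ_unique)
qed

lemma sine_series_exists:
  assumes "a < b" "summable (\<lambda>n. (c n)\<^sup>2)"
  shows "\<exists>f\<in>L2 (leb a b).
    (\<lambda>N. L2_norm (leb a b) (\<lambda>x. (\<Sum>n<N. c n * mode a b 0 n x) - f x)) \<longlonglongrightarrow> 0 \<and>
    (\<forall>n. sine_coeff a b f n = c n)"
proof -
  have "\<exists>f\<in>L2 (leb a b).
      (\<lambda>N. L2_norm (leb a b) (\<lambda>x. (\<Sum>n<N. c n * mode a b 0 n x) - f x)) \<longlonglongrightarrow> 0"
    by (rule orthogonal_series_converges[where \<kappa> = "\<lambda>_. 1"])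
       (simp_all add: finite_measure_interval mode_L2 mode_orthonormal[OF assms(1)] assms(2))
  then obtain f where f: "f \<in> L2 (leb a b)"
    "(\<lambda>N. L2_norm (leb a b) (\<lambda>x. (\<Sum>n<N. c n * mode a b 0 n x) - f x)) \<longlonglongrightarrow> 0" ..
  then show ?thesis
    by (intro bexI[of _ f] conjI allI sine_coeff_limit[OF assms(1)])
qed

lemma Bessel:
  assumes "a < b" "f \<in> L2 (leb a b)"
  shows "summable (\<lambda>n. (sine_coeff a b f n)\<^sup>2)"
proof (rule summableI_nonneg_bounded)
  fix N
  let ?M = "leb a b" and ?c = "sine_coeff a b f"
  let ?S = "\<lambda>x. \<Sum>n<N. ?c n * mode a b 0 n x"
  have S: "?S \<in> L2 ?M" by (intro L2_sum L2_scale mode_L2)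
  have fS: "L2_inner ?M ?S g = (\<Sum>n<N. ?c n * sine_coeff a b g n)" if "g \<in> L2 ?M" for g
    by (subst L2_inner_sum_left)
       (simp_all add: L2_scale mode_L2 that L2_inner_scale_left sine_coeff_def L2_inner_commute[of _ _ g])
  have "0 \<le> L2_inner ?M (\<lambda>x. f x - ?S x) (\<lambda>x. f x - ?S x)"
    by (rule L2_inner_self_nonneg)
  also have "\<dots> = L2_inner ?M f f - 2 * L2_inner ?M ?S f + L2_inner ?M ?S ?S"
    by (simp add: L2_inner_diff_left L2_inner_diff_right L2_diff assms(2) S L2_inner_commute[of _ f ?S])
  also have "\<dots> = L2_inner ?M f f - (\<Sum>n<N. (?c n)\<^sup>2)"
    unfolding fS[OF assms(2)] fS[OF S] by (simp add: sine_coeff_sum[OF assms(1)] power2_eq_square)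
  finally show "(\<Sum>n<N. (?c n)\<^sup>2) \<le> L2_inner ?M f f" by simp
qed simp

text \<open>By Bessel's inequality and completeness of \<open>L\<^sup>2\<close> the sine series of \<open>f\<close> converges to some
  function with the same coefficients, which is \<open>f\<close> because the sines are total.\<close>

lemma sine_expansion:
  assumes "a < b" "f \<in> L2 (leb a b)"
  shows "(\<lambda>N. L2_norm (leb a b) (\<lambda>x. (\<Sum>n<N. sine_coeff a b f n * mode a b 0 n x) - f x)) \<longlonglongrightarrow> 0"
proof -
  let ?M = "leb a b"
  from sine_series_exists[OF assms(1) Bessel[OF assms]]
  obtain g where g: "g \<in> L2 ?M" "\<forall>n. sine_coeff a b g n = sine_coeff a b f n"
    "(\<lambda>N. L2_norm ?M (\<lambda>x. (\<Sum>n<N. sine_coeff a b f n * mode a b 0 n x) - g x)) \<longlonglongrightarrow> 0"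
    by (elim bexE conjE)
  have "AE x in ?M. g x - f x = 0"
  proof (rule sine_total[OF assms(1) L2_diff[OF g(1) assms(2)]])
    show "L2_inner ?M (\<lambda>x. g x - f x) (mode a b 0 n) = 0" for n
      using sine_coeff_diff[OF g(1) assms(2), of n] g(2) by (simp add: sine_coeff_def)
  qed
  then have eq: "AE x in ?M. (\<Sum>n<N. sine_coeff a b f n * mode a b 0 n x) - g x
      = (\<Sum>n<N. sine_coeff a b f n * mode a b 0 n x) - f x" for N
    by eventually_elim simp
  have "L2_norm ?M (\<lambda>x. (\<Sum>n<N. sine_coeff a b f n * mode a b 0 n x) - g x)
      = L2_norm ?M (\<lambda>x. (\<Sum>n<N. sine_coeff a b f n * mode a b 0 n x) - f x)" for N
    by (rule L2_norm_cong_AE[OF eq])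
       (intro L2_measurable L2_diff L2_sum L2_scale mode_L2 g(1) assms(2))+
  with g(3) show ?thesis by simp
qed

lemma Parseval:
  assumes "a < b" "f \<in> L2 (leb a b)" "g \<in> L2 (leb a b)"
  shows "(\<lambda>n. sine_coeff a b f n * sine_coeff a b g n) sums L2_inner (leb a b) f g"
proof -
  let ?M = "leb a b"
  have "(\<lambda>N. L2_inner ?M (\<lambda>x. \<Sum>n<N. sine_coeff a b f n * mode a b 0 n x) g) \<longlonglongrightarrow> L2_inner ?M f g"
    by (rule L2_inner_tendsto[OF _ assms(2,3) sine_expansion[OF assms(1,2)]]) (intro L2_sum L2_scale mode_L2)
  moreover have "L2_inner ?M (\<lambda>x. \<Sum>n<N. sine_coeff a b f n * mode a b 0 n x) g
      = (\<Sum>n<N. sine_coeff a b f n * sine_coeff a b g n)" for N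
    by (subst L2_inner_sum_left)
       (simp_all add: L2_scale mode_L2 assms(3) L2_inner_scale_left sine_coeff_def L2_inner_commute[of _ _ g])
  ultimately show ?thesis by (simp add: sums_def)
qed

lemma summable_mult_squares:
  fixes c d :: "nat \<Rightarrow> real"
  assumes "summable (\<lambda>n. (c n)\<^sup>2)" "summable (\<lambda>n. (d n)\<^sup>2)"
  shows "summable (\<lambda>n. \<bar>c n * d n\<bar>)"
proof (rule summable_comparison_test)
  show "summable (\<lambda>n. (c n)\<^sup>2 + (d n)\<^sup>2)" using assms by (rule summable_add)
  show "\<exists>N. \<forall>n\<ge>N. norm \<bar>c n * d n\<bar> \<le> (c n)\<^sup>2 + (d n)\<^sup>2"
    by (simp add: abs_mult_le_sum_squares)
qed

text \<open>The spectral representation lives on the counting measure on the naturals, embedded into the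
  reals.\<close>

abbreviation spectral_measure :: "real measure" where
  "spectral_measure \<equiv> count_space (range real)"

definition sine_transform :: "real \<Rightarrow> real \<Rightarrow> (real \<Rightarrow> real) \<Rightarrow> real \<Rightarrow> real" where
  "sine_transform a b f x = sine_coeff a b f (nat \<lfloor>x\<rfloor>)"

definition eigenvalue :: "real \<Rightarrow> real \<Rightarrow> real \<Rightarrow> real" where
  "eigenvalue a b x = (freq a b (nat \<lfloor>x\<rfloor>))\<^sup>2"

lemma sine_transform_real [simp]: "sine_transform a b f (real n) = sine_coeff a b f n"
  by (simp add: sine_transform_def)

lemma eigenvalue_real [simp]: "eigenvalue a b (real n) = (freq a b n)\<^sup>2"
  by (simp add: eigenvalue_def)

lemma bij_betw_real: "bij_betw real UNIV (range real)"
  by (simp add: bij_betw_def inj_on_def)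

lemma integrable_spectral:
  "integrable spectral_measure g \<longleftrightarrow> summable (\<lambda>n. \<bar>g (real n)\<bar> :: real)"
  using integrable_bij_count_space[OF bij_betw_real, of g]
  by (simp add: integrable_count_space_nat_iff)

lemma integral_spectral:
  fixes g :: "real \<Rightarrow> real"
  assumes "integrable spectral_measure g"
  shows "(\<integral>x. g x \<partial>spectral_measure) = (\<Sum>n. g (real n))"
  using integral_bij_count_space[OF bij_betw_real, of g] integrable_bij_count_space[OF bij_betw_real, of g]
    assms integral_count_space_nat[of "\<lambda>n. g (real n)"] by simp

lemma L2_spectral: "g \<in> L2 spectral_measure \<longleftrightarrow> summable (\<lambda>n. (g (real n))\<^sup>2)"
  by (simp add: L2_def integrable_spectral)

lemma AE_spectral: "(AE x in spectral_measure. P x) \<longleftrightarrow> (\<forall>n. P (real n))"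
  by (simp add: AE_count_space)

lemma sine_transform_unitary:
  assumes "a < b"
  shows "L2_unitary (leb a b) spectral_measure (sine_transform a b)"
  unfolding L2_unitary_def
proof (intro conjI ballI)
  let ?M = "leb a b"
  fix f assume f: "f \<in> L2 ?M"
  show "sine_transform a b f \<in> L2 spectral_measure"
    using Bessel[OF assms f] by (simp add: L2_spectral)
  fix g assume g: "g \<in> L2 ?M"
  have "integrable spectral_measure (\<lambda>x. sine_transform a b f x * sine_transform a b g x)"
    using summable_mult_squares[OF Bessel[OF assms f] Bessel[OF assms g]] by (simp add: integrable_spectral)
  from integral_spectral[OF this]
  show "L2_inner spectral_measure (sine_transform a b f) (sine_transform a b g) = L2_inner ?M f g"
    using sums_unique[OF Parseval[OF assms f g]] by (simp add: L2_inner_def)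
next
  fix g assume "g \<in> L2 spectral_measure"
  then have "summable (\<lambda>n. (g (real n))\<^sup>2)" by (simp add: L2_spectral)
  from sine_series_exists[OF assms this] obtain f where
    f: "f \<in> L2 (leb a b)" "\<forall>n. sine_coeff a b f n = g (real n)"
    by (elim bexE conjE)
  then show "\<exists>f\<in>L2 (leb a b). AE x in spectral_measure. sine_transform a b f x = g x"
    by (intro bexI[of _ f]) (simp_all add: AE_spectral)
qed

text \<open>If \<open>z\<close> has the coefficients \<open>\<lambda>\<^sub>n w\<^sub>n\<close>, then the partial sums of \<open>w\<close> converge in
  the graph norm: their first derivatives form an orthogonal series with square norms
  \<open>\<lambda>\<^sub>n w\<^sub>n\<^sup>2 = w\<^sub>n z\<^sub>n\<close>.\<close>

lemma dirichlet_laplacian_iff: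
  assumes "a < b" and w: "w \<in> L2 (leb a b)" and z: "z \<in> L2 (leb a b)"
  shows "(w, z) \<in> dirichlet_laplacian {a<..<b} \<longleftrightarrow>
    (\<forall>n. sine_coeff a b z n = (freq a b n)\<^sup>2 * sine_coeff a b w n)"
proof
  let ?M = "leb a b"
  {
    assume "(w, z) \<in> dirichlet_laplacian {a<..<b}"
    from dirichlet_laplacian_symmetric[OF assms(1) this smooth_mode mode_boundary[OF assms(1)]]
    show "\<forall>n. sine_coeff a b z n = (freq a b n)\<^sup>2 * sine_coeff a b w n"
      unfolding deriv2_mode L2_inner_scale_right sine_coeff_def by simp
  }
  assume coeff: "\<forall>n. sine_coeff a b z n = (freq a b n)\<^sup>2 * sine_coeff a b w n"
  let ?w = "sine_coeff a b w"
  have orth: "L2_inner ?M (deriv (mode a b 0 m)) (deriv (mode a b 0 n)) = (if m = n then (freq a b n)\<^sup>2 else 0)" for m n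
    using deriv_mode_orthogonal[OF assms(1), of m n]
    by (cases "m = n") (simp_all add: mode_orthonormal[OF assms(1)])
  have "summable (\<lambda>n. ?w n * sine_coeff a b z n)"
    using Parseval[OF assms] by (rule sums_summable)
  then have "summable (\<lambda>n. (?w n)\<^sup>2 * (freq a b n)\<^sup>2)"
    by (simp add: coeff power2_eq_square ac_simps)
  from orthogonal_series_converges[OF finite_measure_interval smooth_L2[OF smooth_deriv[OF smooth_mode]] orth this]
  obtain g where g: "g \<in> L2 ?M"
    "(\<lambda>N. L2_norm ?M (\<lambda>x. (\<Sum>n<N. ?w n * deriv (mode a b 0 n) x) - g x)) \<longlonglongrightarrow> 0" ..
  define c where "c N n = (if n < N then ?w n else 0)" for N n
  define S where "S N = series a b 0 (c N)" for N
  have rapid: "rapid a b (c N)" for N by (rule rapid_finite[of N]) (simp add: c_def)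
  have S: "S N = (\<lambda>x. \<Sum>n<N. ?w n * mode a b 0 n x)" for N
    unfolding S_def by (intro ext, subst series_finite[of N]) (auto simp: c_def)
  have S1: "deriv (S N) = (\<lambda>x. \<Sum>n<N. ?w n * deriv (mode a b 0 n) x)" for N
    unfolding S_def deriv_series[OF assms(1) rapid]
    by (intro ext, subst series_finite[of N]) (auto simp: c_def deriv_mode intro!: sum.cong)
  have S2: "- deriv (deriv (S N)) x = (\<Sum>n<N. sine_coeff a b z n * mode a b 0 n x)" for N x
    unfolding S_def deriv_series[OF assms(1) rapid] deriv_series[OF assms(1) rapid_freq_mult[OF assms(1) rapid, of 1, simplified]]
    by (subst series_finite[of N])
       (auto simp: c_def mode_add_2 coeff power2_eq_square sum_negf[symmetric] intro!: sum.cong)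
  show "(w, z) \<in> dirichlet_laplacian {a<..<b}"
  proof (rule dirichlet_laplacianI[OF assms(1) w g(1) z])
    show "smooth_on UNIV (S N)" for N unfolding S_def by (rule smooth_series[OF assms(1) rapid])
    show "S N a = 0" "S N b = 0" for N unfolding S_def by (rule series_boundary[OF assms(1)])+
    show "(\<lambda>N. L2_norm ?M (\<lambda>x. S N x - w x)) \<longlonglongrightarrow> 0"
      unfolding S by (rule sine_expansion[OF assms(1) w])
    show "(\<lambda>N. L2_norm ?M (\<lambda>x. deriv (S N) x - g x)) \<longlonglongrightarrow> 0"
      unfolding S1 by (rule g(2))
    show "(\<lambda>N. L2_norm ?M (\<lambda>x. - deriv (deriv (S N)) x - z x)) \<longlonglongrightarrow> 0"
      unfolding S2 by (rule sine_expansion[OF assms(1) z])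
  qed
qed

lemma diagonalizes_dirichlet_laplacian:
  assumes "a < b"
  shows "diagonalizes (leb a b) (dirichlet_laplacian {a<..<b})
    spectral_measure (eigenvalue a b) (sine_transform a b)"
  unfolding diagonalizes_def
proof (intro conjI ballI)
  show "dirichlet_laplacian {a<..<b} \<subseteq> L2 (leb a b) \<times> L2 (leb a b)"
    by (auto simp: dirichlet_laplacian_def H1_0_def H1_def)
  show "L2_unitary (leb a b) spectral_measure (sine_transform a b)"
    by (rule sine_transform_unitary[OF assms])
  show "0 \<le> eigenvalue a b x" for x by (simp add: eigenvalue_def)
  show "(w, z) \<in> dirichlet_laplacian {a<..<b} \<longleftrightarrow>
      (AE x in spectral_measure. sine_transform a b z x = eigenvalue a b x * sine_transform a b w x)"
    if "w \<in> L2 (leb a b)" "z \<in> L2 (leb a b)" for w z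
    using dirichlet_laplacian_iff[OF assms that] by (simp add: AE_spectral)
qed simp

text \<open>The domain of \<open>A\<^sup>\<alpha>\<close> contains the domain of \<open>A\<close>, because \<open>\<lambda>\<^sup>2\<^sup>\<alpha> \<le> 1 + \<lambda>\<^sup>2\<close> for \<open>0 < \<alpha> \<le> 1\<close>;
  the required \<open>y = A\<^sup>\<alpha> w\<close> is then given by its coefficients.\<close>

lemma op_powr_exists:
  assumes "a < b" "0 < \<alpha>" "\<alpha> \<le> 1" and wz: "(w, z) \<in> dirichlet_laplacian {a<..<b}"
  shows "\<exists>y\<in>L2 (leb a b).
    (w, y) \<in> op_powr (leb a b) (dirichlet_laplacian {a<..<b}) \<alpha> \<and>
    (\<forall>n. sine_coeff a b y n = ((freq a b n)\<^sup>2) powr \<alpha> * sine_coeff a b w n)"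
proof -
  let ?M = "leb a b"
  have w: "w \<in> L2 ?M" and z: "z \<in> L2 ?M"
    using wz by (auto simp: dirichlet_laplacian_def H1_0_def H1_def)
  have coeff: "sine_coeff a b z n = (freq a b n)\<^sup>2 * sine_coeff a b w n" for n
    using dirichlet_laplacian_iff[OF assms(1) w z] wz by blast
  have "summable (\<lambda>n. (((freq a b n)\<^sup>2) powr \<alpha> * sine_coeff a b w n)\<^sup>2)"
  proof (rule summable_comparison_test)
    have "(((freq a b n)\<^sup>2) powr \<alpha> * sine_coeff a b w n)\<^sup>2 \<le> (sine_coeff a b w n)\<^sup>2 + (sine_coeff a b z n)\<^sup>2" for n
    proof -
      define l where "l = (freq a b n)\<^sup>2"
      have l: "l > 0" using freq_pos[OF assms(1), of n] by (simp add: l_def)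
      have "(l powr \<alpha>)\<^sup>2 \<le> 1 + l\<^sup>2"
      proof (cases "l \<le> 1")
        case True
        then have "l powr \<alpha> \<le> 1" using l assms(2) by (simp add: powr_le1)
        then have "(l powr \<alpha>)\<^sup>2 \<le> 1" by (simp add: power_le_one)
        then show ?thesis using zero_le_power2[of l] by linarith
      next
        case False
        then have "l powr \<alpha> \<le> l powr 1" using assms(3) by (intro powr_mono) auto
        then have "(l powr \<alpha>)\<^sup>2 \<le> l\<^sup>2" using l by (intro power_mono) auto
        then show ?thesis by linarith
      qed
      then have "(l powr \<alpha>)\<^sup>2 * (sine_coeff a b w n)\<^sup>2 \<le> (1 + l\<^sup>2) * (sine_coeff a b w n)\<^sup>2"
        by (intro mult_right_mono) auto
      then show ?thesis by (simp add: coeff l_def power_mult_distrib distrib_right)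
    qed
    then show "\<exists>N. \<forall>n\<ge>N. norm ((((freq a b n)\<^sup>2) powr \<alpha> * sine_coeff a b w n)\<^sup>2)
        \<le> (sine_coeff a b w n)\<^sup>2 + (sine_coeff a b z n)\<^sup>2" by simp
    show "summable (\<lambda>n. (sine_coeff a b w n)\<^sup>2 + (sine_coeff a b z n)\<^sup>2)"
      by (intro summable_add Bessel assms(1) w z)
  qed
  from sine_series_exists[OF assms(1) this] obtain y where
    y: "y \<in> L2 ?M" "\<forall>n. sine_coeff a b y n = ((freq a b n)\<^sup>2) powr \<alpha> * sine_coeff a b w n"
    by (elim bexE conjE)
  have "AE x in spectral_measure. sine_transform a b y x = eigenvalue a b x powr \<alpha> * sine_transform a b w x"
    by (simp add: AE_spectral y(2))
  then have "(w, y) \<in> op_powr ?M (dirichlet_laplacian {a<..<b}) \<alpha>"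
    unfolding op_powr_def using diagonalizes_dirichlet_laplacian[OF assms(1)] w y(1)
    by (intro CollectI case_prodI conjI exI)
  then show ?thesis by (intro bexI[of _ y] conjI y)
qed

section \<open>Solutions of the damped equation\<close>

lemma series_diff:
  assumes "a < b" "rapid a b c" "rapid a b d"
  shows "series a b q c x - series a b q d x = series a b q (\<lambda>n. c n - d n) x"
  unfolding series_def
  by (subst suminf_diff[OF series_summable[OF assms(1,2)] series_summable[OF assms(1,3)]])
     (simp add: left_diff_distrib)

lemma series_divide:
  assumes "a < b" "rapid a b c"
  shows "series a b q c x / k = series a b q (\<lambda>n. c n / k) x"
  unfolding series_def
  by (subst suminf_divide[OF series_summable[OF assms], symmetric]) simp

lemma rapid_bounded:
  assumes M: "rapid a b M" and "a < b" and "\<And>n. \<bar>c n\<bar> \<le> K * M n"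
  shows "rapid a b c"
  unfolding rapid_def
proof
  fix k
  show "summable (\<lambda>n. \<bar>c n\<bar> * freq a b n ^ k)"
  proof (rule summable_comparison_test)
    have "\<bar>c n\<bar> * freq a b n ^ k \<le> \<bar>K\<bar> * (\<bar>M n\<bar> * freq a b n ^ k)" for n
    proof -
      have "\<bar>c n\<bar> \<le> \<bar>K\<bar> * \<bar>M n\<bar>" using assms(3)[of n] by (simp flip: abs_mult)
      then have "\<bar>c n\<bar> * freq a b n ^ k \<le> \<bar>K\<bar> * \<bar>M n\<bar> * freq a b n ^ k"
        using freq_pos[OF assms(2), of n] by (intro mult_right_mono) auto
      then show ?thesis by (simp add: mult.assoc)
    qed
    then show "\<exists>N. \<forall>n\<ge>N. norm (\<bar>c n\<bar> * freq a b n ^ k) \<le> \<bar>K\<bar> * (\<bar>M n\<bar> * freq a b n ^ k)"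
      using zero_less_power[OF freq_pos[OF assms(2)]] by (simp add: abs_mult abs_of_pos)
    show "summable (\<lambda>n. \<bar>K\<bar> * (\<bar>M n\<bar> * freq a b n ^ k))"
      by (rule summable_mult[OF rapid_summable[OF M]])
  qed
qed

lemma rapid_diff:
  assumes "rapid a b c" "rapid a b d" "a < b"
  shows "rapid a b (\<lambda>n. c n - d n)"
  unfolding rapid_def
proof
  fix k
  show "summable (\<lambda>n. \<bar>c n - d n\<bar> * freq a b n ^ k)"
  proof (rule summable_comparison_test)
    have "\<bar>c n - d n\<bar> * freq a b n ^ k \<le> \<bar>c n\<bar> * freq a b n ^ k + \<bar>d n\<bar> * freq a b n ^ k" for n
    proof -
      have "\<bar>c n - d n\<bar> * freq a b n ^ k \<le> (\<bar>c n\<bar> + \<bar>d n\<bar>) * freq a b n ^ k"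
        using freq_pos[OF assms(3), of n] by (intro mult_right_mono) auto
      then show ?thesis by (simp add: distrib_right)
    qed
    then show "\<exists>N. \<forall>n\<ge>N. norm (\<bar>c n - d n\<bar> * freq a b n ^ k) \<le> \<bar>c n\<bar> * freq a b n ^ k + \<bar>d n\<bar> * freq a b n ^ k"
      using zero_less_power[OF freq_pos[OF assms(3)]] by (simp add: abs_mult abs_of_pos)
    show "summable (\<lambda>n. \<bar>c n\<bar> * freq a b n ^ k + \<bar>d n\<bar> * freq a b n ^ k)"
      by (rule summable_add[OF rapid_summable[OF assms(1)] rapid_summable[OF assms(2)]])
  qed
qed

lemma series_L2: "a < b \<Longrightarrow> rapid a b c \<Longrightarrow> series a b q c \<in> L2 (leb a b)"
  by (rule smooth_L2[OF smooth_series])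

lemma L2_norm_series_le:
  assumes "a < b" and M: "rapid a b M" and c: "\<And>n. \<bar>c n\<bar> \<le> K * \<bar>M n\<bar>" and "K \<ge> 0"
  shows "L2_norm (leb a b) (series a b q c)
    \<le> K * (sqrt (2 / (b - a)) * (\<Sum>n. \<bar>M n\<bar>) * sqrt (b - a))"
proof -
  have absM: "rapid a b (\<lambda>n. \<bar>M n\<bar>)" using M by (simp add: rapid_def)
  have c': "rapid a b c" by (rule rapid_bounded[OF absM assms(1) c])
  have "(\<Sum>n. \<bar>c n\<bar>) \<le> (\<Sum>n. K * \<bar>M n\<bar>)"
    by (rule suminf_le[OF c rapid_summable_abs[OF c'] summable_mult[OF rapid_summable_abs[OF M]]])
  also have "\<dots> = K * (\<Sum>n. \<bar>M n\<bar>)" by (rule suminf_mult[OF rapid_summable_abs[OF M]])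
  finally have le: "(\<Sum>n. \<bar>c n\<bar>) \<le> K * (\<Sum>n. \<bar>M n\<bar>)" .
  have "L2_norm (leb a b) (series a b q c) \<le> (sqrt (2 / (b - a)) * (\<Sum>n. \<bar>c n\<bar>)) * sqrt (b - a)"
    using suminf_nonneg[OF rapid_summable_abs[OF c']] assms(1)
    by (intro L2_norm_le_sup series_L2 series_bound c' mult_nonneg_nonneg) auto
  also have "\<dots> \<le> (sqrt (2 / (b - a)) * (K * (\<Sum>n. \<bar>M n\<bar>))) * sqrt (b - a)"
    using le assms(1) by (intro mult_right_mono mult_left_mono) auto
  finally show ?thesis by (simp add: ac_simps)
qed

text \<open>The pointwise sum of a rapidly decreasing sine series is its sum in \<open>L\<^sup>2\<close>, by dominated
  convergence.\<close>

lemma sine_coeff_series: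
  assumes "a < b" and c: "rapid a b c"
  shows "sine_coeff a b (series a b 0 c) n = c n"
proof (rule sine_coeff_limit[OF assms(1) series_L2[OF assms]])
  define B where "B = sqrt (2 / (b - a)) * (\<Sum>n. \<bar>c n\<bar>)"
  show "(\<lambda>N. L2_norm (leb a b) (\<lambda>x. (\<Sum>n<N. c n * mode a b 0 n x) - series a b 0 c x)) \<longlonglongrightarrow> 0"
  proof (rule L2_norm_tendsto_0_bounded[where B = "B + B"])
    show "(\<lambda>x. (\<Sum>n<N. c n * mode a b 0 n x) - series a b 0 c x) \<in> borel_measurable (leb a b)" for N
      by (intro L2_measurable L2_diff L2_sum L2_scale mode_L2 series_L2[OF assms])
    fix x
    have "(\<lambda>N. (\<Sum>n<N. c n * mode a b 0 n x)) \<longlonglongrightarrow> series a b 0 c x"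
      unfolding series_def by (rule summable_LIMSEQ[OF series_summable[OF assms]])
    then show "(\<lambda>N. (\<Sum>n<N. c n * mode a b 0 n x) - series a b 0 c x) \<longlonglongrightarrow> 0"
      by (simp add: LIM_zero_iff)
    fix N
    have "\<bar>\<Sum>n<N. c n * mode a b 0 n x\<bar> \<le> (\<Sum>n<N. sqrt (2 / (b - a)) * \<bar>c n\<bar>)"
      using series_term_bound[OF assms(1), of c _ 0 x] by (intro sum_abs[THEN order_trans] sum_mono) simp
    also have "\<dots> \<le> B"
      unfolding B_def sum_distrib_left[symmetric]
      using assms(1) by (intro mult_left_mono sum_le_suminf rapid_summable_abs[OF c]) auto
    finally have "\<bar>\<Sum>n<N. c n * mode a b 0 n x\<bar> \<le> B" .
    moreover have "\<bar>series a b 0 c x\<bar> \<le> B" unfolding B_def by (rule series_bound[OF assms])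
    ultimately show "\<bar>(\<Sum>n<N. c n * mode a b 0 n x) - series a b 0 c x\<bar> \<le> B + B" by linarith
  qed
qed

text \<open>A superposition of modes \<open>Re (\<kappa>\<^sub>n exp (\<rho>\<^sub>n t))\<close> with rapidly decreasing
  amplitudes \<open>\<kappa>\<^sub>n\<close>, where \<open>\<rho>\<^sub>n\<close> is a characteristic root of the \<open>n\<close>-th mode. Its \<open>k\<close>-th time
  derivative has the coefficients \<open>amplitude k t\<close>. All estimates in time follow, mode by mode, from
  \<open>\<bar>\<rho>\<^sub>n\<bar> \<le> \<mu>\<^sub>n\<close>: for \<open>t \<ge> 0\<close> the \<open>k\<close>-th derivative is at most \<open>\<mu>\<^sub>n\<^sup>k \<bar>\<kappa>\<^sub>n\<bar>\<close>, which is summable.\<close>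

locale damped_modes =
  fixes a b c \<alpha> :: real and \<kappa> \<rho> :: "nat \<Rightarrow> complex"
  assumes ab: "a < b" and \<alpha>: "0 < \<alpha>" "\<alpha> \<le> 1"
    and \<kappa>: "rapid a b (\<lambda>n. cmod (\<kappa> n))"
    and \<rho>: "\<And>n. Re (\<rho> n) \<le> 0" "\<And>n. cmod (\<rho> n) \<le> freq a b n"
    and root: "\<And>n. \<kappa> n \<noteq> 0 \<Longrightarrow>
      (\<rho> n)\<^sup>2 + of_real (c * ((freq a b n)\<^sup>2 powr \<alpha>)) * \<rho> n + of_real ((freq a b n)\<^sup>2) = 0"
begin

definition amplitude :: "nat \<Rightarrow> real \<Rightarrow> nat \<Rightarrow> real" where
  "amplitude k t n = Re (\<kappa> n * \<rho> n ^ k * exp (\<rho> n * of_real t))"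

definition solution :: "nat \<Rightarrow> real \<Rightarrow> real \<Rightarrow> real" where
  "solution k t = series a b 0 (amplitude k t)"

definition majorant :: "nat \<Rightarrow> nat \<Rightarrow> real" where
  "majorant k n = freq a b n ^ k * cmod (\<kappa> n)"

lemma majorant_nonneg: "majorant k n \<ge> 0"
  using freq_pos[OF ab, of n] by (simp add: majorant_def)

lemma rapid_majorant: "rapid a b (majorant k)"
  using rapid_freq_mult[OF ab \<kappa>, of k] by (simp add: majorant_def[abs_def])

lemma amplitude_bound: "t \<ge> 0 \<Longrightarrow> \<bar>amplitude k t n\<bar> \<le> majorant k n"
proof -
  assume t: "t \<ge> 0"
  have "\<bar>amplitude k t n\<bar> \<le> cmod (\<kappa> n) * cmod (\<rho> n) ^ k * exp (Re (\<rho> n) * t)"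
    unfolding amplitude_def by (rule abs_Re_le_cmod[THEN order_trans]) (simp add: norm_mult norm_power)
  also have "\<dots> \<le> cmod (\<kappa> n) * freq a b n ^ k * 1"
    using \<rho>[of n] t by (intro mult_mono power_mono) (auto simp: mult_nonpos_nonneg freq_pos[OF ab] less_imp_le)
  finally show ?thesis by (simp add: majorant_def mult.commute)
qed

lemma amplitude_DERIV: "((\<lambda>t. amplitude k t n) has_real_derivative amplitude (Suc k) t n) (at t)"
proof -
  have "((\<lambda>z. \<kappa> n * \<rho> n ^ k * exp (\<rho> n * z)) has_field_derivative \<kappa> n * \<rho> n ^ Suc k * exp (\<rho> n * of_real t))
      (at (of_real t))"
    by (auto intro!: derivative_eq_intros)
  then have "((\<lambda>t. \<kappa> n * \<rho> n ^ k * exp (\<rho> n * of_real t)) has_vector_derivative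
      \<kappa> n * \<rho> n ^ Suc k * exp (\<rho> n * of_real t)) (at t)"
    by (rule has_vector_derivative_real_field)
  from bounded_linear.has_vector_derivative[OF bounded_linear_Re this] show ?thesis
    unfolding amplitude_def has_real_derivative_iff_has_vector_derivative .
qed

lemma amplitude_lipschitz:
  assumes "t \<ge> 0" "\<tau> \<ge> 0"
  shows "\<bar>amplitude k \<tau> n - amplitude k t n\<bar> \<le> \<bar>\<tau> - t\<bar> * majorant (Suc k) n"
proof -
  have "norm (amplitude k \<tau> n - amplitude k t n) \<le> majorant (Suc k) n * norm (\<tau> - t)"
    by (rule field_differentiable_bound[of "{0..}" _ "\<lambda>t. amplitude (Suc k) t n"])
       (use assms amplitude_bound in \<open>auto intro: has_field_derivative_at_within amplitude_DERIV\<close>)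
  then show ?thesis by (simp add: mult.commute)
qed

lemma amplitude_difference_quotient:
  assumes "t \<ge> 0" "\<tau> \<ge> 0" "\<tau> \<noteq> t"
  shows "\<bar>(amplitude k \<tau> n - amplitude k t n) / (\<tau> - t) - amplitude (Suc k) t n\<bar>
    \<le> \<bar>\<tau> - t\<bar> * majorant (Suc (Suc k)) n"
proof -
  \<comment> \<open>Apply the mean value inequality after subtracting the tangent at \<open>t\<close>, up to a constant.\<close>
  define g where "g \<sigma> = amplitude k \<sigma> n - \<sigma> * amplitude (Suc k) t n" for \<sigma>
  have "norm (g \<tau> - g t) \<le> (\<bar>\<tau> - t\<bar> * majorant (Suc (Suc k)) n) * norm (\<tau> - t)"
  proof (rule field_differentiable_bound[of "closed_segment t \<tau>" _ "\<lambda>\<sigma>. amplitude (Suc k) \<sigma> n - amplitude (Suc k) t n"])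
    fix \<sigma> assume \<sigma>: "\<sigma> \<in> closed_segment t \<tau>"
    then have \<sigma>': "\<sigma> \<ge> 0" "\<bar>\<sigma> - t\<bar> \<le> \<bar>\<tau> - t\<bar>"
      using assms by (auto simp: closed_segment_eq_real_ivl split: if_splits)
    show "(g has_real_derivative amplitude (Suc k) \<sigma> n - amplitude (Suc k) t n) (at \<sigma> within closed_segment t \<tau>)"
      unfolding g_def
      by (rule has_field_derivative_at_within) (auto intro!: derivative_eq_intros amplitude_DERIV)
    show "norm (amplitude (Suc k) \<sigma> n - amplitude (Suc k) t n) \<le> \<bar>\<tau> - t\<bar> * majorant (Suc (Suc k)) n"
      using amplitude_lipschitz[OF assms(1) \<sigma>'(1), of "Suc k" n]
        mult_right_mono[OF \<sigma>'(2) majorant_nonneg[of "Suc (Suc k)" n]] by simp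
  qed auto
  moreover have "g \<tau> - g t = ((amplitude k \<tau> n - amplitude k t n) / (\<tau> - t) - amplitude (Suc k) t n) * (\<tau> - t)"
    using assms(3) by (simp add: g_def field_simps)
  ultimately have "\<bar>(amplitude k \<tau> n - amplitude k t n) / (\<tau> - t) - amplitude (Suc k) t n\<bar> * \<bar>\<tau> - t\<bar>
      \<le> (\<bar>\<tau> - t\<bar> * majorant (Suc (Suc k)) n) * \<bar>\<tau> - t\<bar>"
    by (simp only: abs_mult[symmetric] real_norm_def)
  then show ?thesis using assms(3) by (simp only: mult_le_cancel_right)
qed

lemma rapid_amplitude: "t \<ge> 0 \<Longrightarrow> rapid a b (amplitude k t)"
  by (rule rapid_bounded[OF rapid_majorant[of k] ab, where K = 1]) (simp add: amplitude_bound)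

lemma solution_L2: "t \<ge> 0 \<Longrightarrow> solution k t \<in> L2 (leb a b)"
  unfolding solution_def by (rule series_L2[OF ab rapid_amplitude])

lemma solution_H1_0: "t \<ge> 0 \<Longrightarrow> solution k t \<in> H1_0 {a<..<b}"
  unfolding solution_def
  by (rule vanishing_smooth_H1_0[OF ab smooth_series[OF ab rapid_amplitude] series_boundary(1)[OF ab] series_boundary(2)[OF ab]])

lemma eventually_nonneg_neq: "\<forall>\<^sub>F \<tau> in at t within {0::real..}. \<tau> \<ge> 0 \<and> \<tau> \<noteq> t"
  unfolding eventually_at_filter by (rule always_eventually) auto

lemma tendsto_0_within_halfline:
  fixes f :: "real \<Rightarrow> real"
  assumes "\<And>\<tau>. \<tau> \<ge> 0 \<Longrightarrow> \<tau> \<noteq> t \<Longrightarrow> 0 \<le> f \<tau> \<and> f \<tau> \<le> \<bar>\<tau> - t\<bar> * K"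
  shows "(f \<longlongrightarrow> 0) (at t within {0..})"
proof (rule Lim_null_comparison)
  show "\<forall>\<^sub>F \<tau> in at t within {0..}. norm (f \<tau>) \<le> \<bar>\<tau> - t\<bar> * K"
    using eventually_nonneg_neq[of t] by eventually_elim (use assms in auto)
  have "((\<lambda>\<tau>. \<bar>\<tau> - t\<bar> * K) \<longlongrightarrow> \<bar>t - t\<bar> * K) (at t within {0..})"
    by (intro tendsto_intros)
  then show "((\<lambda>\<tau>. \<bar>\<tau> - t\<bar> * K) \<longlongrightarrow> 0) (at t within {0..})" by simp
qed

lemma solution_continuous_L2:
  assumes "t \<ge> 0"
  shows "((\<lambda>\<tau>. L2_norm (leb a b) (\<lambda>x. solution k \<tau> x - solution k t x)) \<longlongrightarrow> 0)
    (at t within {0..})"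
proof (rule tendsto_0_within_halfline, rule conjI[OF L2_norm_nonneg])
  fix \<tau> :: real assume \<tau>: "\<tau> \<ge> 0"
  have "(\<lambda>x. solution k \<tau> x - solution k t x) = series a b 0 (\<lambda>n. amplitude k \<tau> n - amplitude k t n)"
    unfolding solution_def by (intro ext series_diff ab rapid_amplitude \<tau> assms)
  then show "L2_norm (leb a b) (\<lambda>x. solution k \<tau> x - solution k t x)
      \<le> \<bar>\<tau> - t\<bar> * (sqrt (2 / (b - a)) * (\<Sum>n. \<bar>majorant (Suc k) n\<bar>) * sqrt (b - a))"
    using L2_norm_series_le[OF ab rapid_majorant[of "Suc k"], of "\<lambda>n. amplitude k \<tau> n - amplitude k t n" "\<bar>\<tau> - t\<bar>" 0]
      amplitude_lipschitz[OF assms \<tau>] majorant_nonneg by simp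
qed

lemma solution_continuous_H1:
  assumes "t \<ge> 0"
  shows "((\<lambda>\<tau>. H1_norm {a<..<b} (\<lambda>x. solution k \<tau> x - solution k t x)) \<longlongrightarrow> 0) (at t within {0..})"
proof (rule tendsto_0_within_halfline)
  let ?M = "leb a b"
  define B where "B q = sqrt (2 / (b - a)) * (\<Sum>n. \<bar>majorant (Suc k + q) n\<bar>) * sqrt (b - a)" for q
  fix \<tau> :: real assume \<tau>: "\<tau> \<ge> 0"
  define d where "d n = amplitude k \<tau> n - amplitude k t n" for n
  have d: "rapid a b d" unfolding d_def by (intro rapid_diff rapid_amplitude \<tau> assms ab)
  have d': "rapid a b (\<lambda>n. freq a b n * d n)" using rapid_freq_mult[OF ab d, of 1] by simp
  have eq: "(\<lambda>x. solution k \<tau> x - solution k t x) = series a b 0 d"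
    unfolding solution_def d_def by (intro ext series_diff ab rapid_amplitude \<tau> assms)
  have d_le: "\<bar>d n\<bar> \<le> \<bar>\<tau> - t\<bar> * \<bar>majorant (Suc k + 0) n\<bar>" for n
    using amplitude_lipschitz[OF assms \<tau>, of k n] majorant_nonneg[of "Suc k" n] by (simp add: d_def)
  have d'_le: "\<bar>freq a b n * d n\<bar> \<le> \<bar>\<tau> - t\<bar> * \<bar>majorant (Suc k + 1) n\<bar>" for n
    using mult_left_mono[OF amplitude_lipschitz[OF assms \<tau>, of k n], of "freq a b n"] freq_pos[OF ab, of n]
    by (simp add: d_def majorant_def abs_mult ac_simps)
  have 0: "L2_norm ?M (series a b 0 d) \<le> \<bar>\<tau> - t\<bar> * B 0"
    unfolding B_def by (rule L2_norm_series_le[OF ab rapid_majorant d_le]) simp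
  have 1: "L2_norm ?M (series a b 1 (\<lambda>n. freq a b n * d n)) \<le> \<bar>\<tau> - t\<bar> * B 1"
    unfolding B_def by (rule L2_norm_series_le[OF ab rapid_majorant d'_le]) simp
  have "has_weak_deriv {a<..<b} 1 (series a b 0 d) (series a b 1 (\<lambda>n. freq a b n * d n))"
    using has_weak_deriv_deriv[OF ab smooth_series[OF ab d, of 0]] deriv_series[OF ab d, of 0]
    by (simp del: One_nat_def add: Suc_eq_plus1)
  then have "H1_norm {a<..<b} (series a b 0 d)
      = sqrt ((L2_norm ?M (series a b 0 d))\<^sup>2 + (L2_norm ?M (series a b 1 (\<lambda>n. freq a b n * d n)))\<^sup>2)"
    by (rule H1_norm_eq[OF ab series_L2[OF ab d']])
  also have "\<dots> \<le> L2_norm ?M (series a b 0 d) + L2_norm ?M (series a b 1 (\<lambda>n. freq a b n * d n))"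
    by (rule sqrt_sum_squares_le_sum) (simp_all add: L2_norm_nonneg)
  also have "\<dots> \<le> \<bar>\<tau> - t\<bar> * (B 0 + B 1)" using 0 1 by (simp add: distrib_left)
  finally have "H1_norm {a<..<b} (series a b 0 d) \<le> \<bar>\<tau> - t\<bar> * (B 0 + B 1)" .
  moreover have "0 \<le> H1_norm {a<..<b} (series a b 0 d)" by (simp add: H1_norm_def)
  ultimately show "0 \<le> H1_norm {a<..<b} (\<lambda>x. solution k \<tau> x - solution k t x) \<and>
      H1_norm {a<..<b} (\<lambda>x. solution k \<tau> x - solution k t x) \<le> \<bar>\<tau> - t\<bar> * (B 0 + B 1)"
    unfolding eq by (rule conjI[rotated])
qed

lemma solution_derivative_L2:
  assumes "t \<ge> 0"
  shows "((\<lambda>\<tau>. L2_norm (leb a b)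
      (\<lambda>x. (solution k \<tau> x - solution k t x) / (\<tau> - t) - solution (Suc k) t x)) \<longlongrightarrow> 0) (at t within {0..})"
proof (rule tendsto_0_within_halfline, rule conjI[OF L2_norm_nonneg])
  fix \<tau> :: real assume \<tau>: "\<tau> \<ge> 0" "\<tau> \<noteq> t"
  define d where "d n = (amplitude k \<tau> n - amplitude k t n) / (\<tau> - t) - amplitude (Suc k) t n" for n
  have r: "rapid a b (\<lambda>n. amplitude k \<tau> n - amplitude k t n)"
    by (intro rapid_diff rapid_amplitude \<tau> assms ab)
  have r': "rapid a b (\<lambda>n. (amplitude k \<tau> n - amplitude k t n) / (\<tau> - t))"
    by (rule rapid_bounded[OF rapid_majorant[of "Suc k"] ab, where K = 1])
       (use amplitude_lipschitz[OF assms \<tau>(1)] \<tau>(2) in \<open>simp add: divide_le_eq mult.commute\<close>)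
  have "(solution k \<tau> x - solution k t x) / (\<tau> - t) - solution (Suc k) t x = series a b 0 d x" for x
    unfolding solution_def d_def series_diff[OF ab rapid_amplitude[OF \<tau>(1)] rapid_amplitude[OF assms]]
      series_divide[OF ab r] by (rule series_diff[OF ab r' rapid_amplitude[OF assms]])
  moreover have "\<bar>d n\<bar> \<le> \<bar>\<tau> - t\<bar> * \<bar>majorant (Suc (Suc k)) n\<bar>" for n
    using amplitude_difference_quotient[OF assms \<tau>, of k n] majorant_nonneg[of "Suc (Suc k)" n] by (simp add: d_def)
  ultimately show "L2_norm (leb a b) (\<lambda>x. (solution k \<tau> x - solution k t x) / (\<tau> - t) - solution (Suc k) t x)
      \<le> \<bar>\<tau> - t\<bar> * (sqrt (2 / (b - a)) * (\<Sum>n. \<bar>majorant (Suc (Suc k)) n\<bar>) * sqrt (b - a))"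
    using L2_norm_series_le[OF ab rapid_majorant[of "Suc (Suc k)"], of d "\<bar>\<tau> - t\<bar>" 0] by simp
qed

lemma amplitude_equation:
  "amplitude 2 t n + (freq a b n)\<^sup>2 * amplitude 0 t n + c * ((freq a b n)\<^sup>2 powr \<alpha>) * amplitude 1 t n = 0"
proof (cases "\<kappa> n = 0")
  case False
  let ?E = "\<kappa> n * exp (\<rho> n * of_real t)"
  have Re_scale: "Re (of_real r * z) = r * Re z" for r z by simp
  have "amplitude 2 t n + (freq a b n)\<^sup>2 * amplitude 0 t n + c * ((freq a b n)\<^sup>2 powr \<alpha>) * amplitude 1 t n
      = Re (?E * (\<rho> n)\<^sup>2 + of_real ((freq a b n)\<^sup>2) * ?E + of_real (c * ((freq a b n)\<^sup>2 powr \<alpha>)) * (?E * \<rho> n))"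
    unfolding plus_complex.sel Re_scale by (simp add: amplitude_def ac_simps)
  also have "?E * (\<rho> n)\<^sup>2 + of_real ((freq a b n)\<^sup>2) * ?E + of_real (c * ((freq a b n)\<^sup>2 powr \<alpha>)) * (?E * \<rho> n)
      = ?E * ((\<rho> n)\<^sup>2 + of_real (c * ((freq a b n)\<^sup>2 powr \<alpha>)) * \<rho> n + of_real ((freq a b n)\<^sup>2))"
    by (simp only: distrib_left ac_simps)
  also have "Re \<dots> = 0" unfolding root[OF False] by simp
  finally show ?thesis .
qed (simp add: amplitude_def)

text \<open>Tested with \<open>w\<close>, the equation becomes a Parseval sum over the modes, each term of which is
  \<open>w\<^sub>n\<close> times the equation of a damped oscillator.\<close>

lemma energy_solution_solution:
  "energy_solution {a<..<b} c \<alpha> (solution 0 0) (solution 1 0) (solution 0)"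
  unfolding energy_solution_def
proof (intro exI[of _ "solution 1"] conjI allI impI)
  let ?M = "leb a b"
  show "solution 0 t \<in> H1_0 {a<..<b}" if "t \<ge> 0" for t by (rule solution_H1_0[OF that])
  show "((\<lambda>\<tau>. H1_norm {a<..<b} (\<lambda>x. solution 0 \<tau> x - solution 0 t x)) \<longlongrightarrow> 0) (at t within {0..})"
    if "t \<ge> 0" for t by (rule solution_continuous_H1[OF that])
  show "solution 1 t \<in> L2 ?M" if "t \<ge> 0" for t by (rule solution_L2[OF that])
  show "((\<lambda>\<tau>. L2_norm ?M (\<lambda>x. (solution 0 \<tau> x - solution 0 t x) / (\<tau> - t) - solution 1 t x)) \<longlongrightarrow> 0)
      (at t within {0..})" if "t \<ge> 0" for t
    using solution_derivative_L2[OF that, of 0] by simp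
  show "((\<lambda>\<tau>. L2_norm ?M (\<lambda>x. solution 1 \<tau> x - solution 1 t x)) \<longlongrightarrow> 0) (at t within {0..})"
    if "t \<ge> 0" for t by (rule solution_continuous_L2[OF that])
  show "\<forall>(w, z)\<in>dirichlet_laplacian {a<..<b}.
      \<exists>y g. (w, y) \<in> op_powr ?M (dirichlet_laplacian {a<..<b}) \<alpha> \<and> continuous_on {0..} g \<and>
        (\<forall>t\<ge>0. ((\<lambda>\<tau>. L2_inner ?M (solution 1 \<tau>) w) has_real_derivative g t) (at t within {0..}) \<and>
          g t + L2_inner ?M (solution 0 t) z + c * L2_inner ?M (solution 1 t) y = 0)"
  proof (intro ballI, clarify)
    fix w z assume wz: "(w, z) \<in> dirichlet_laplacian {a<..<b}"
    have w: "w \<in> L2 ?M" and z: "z \<in> L2 ?M"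
      using wz by (auto simp: dirichlet_laplacian_def H1_0_def H1_def)
    have zn: "sine_coeff a b z n = (freq a b n)\<^sup>2 * sine_coeff a b w n" for n
      using dirichlet_laplacian_iff[OF ab w z] wz by simp
    from op_powr_exists[OF ab \<alpha> wz]
    obtain y where y: "y \<in> L2 ?M" "(w, y) \<in> op_powr ?M (dirichlet_laplacian {a<..<b}) \<alpha>"
      and yn: "\<forall>n. sine_coeff a b y n = ((freq a b n)\<^sup>2) powr \<alpha> * sine_coeff a b w n"
      by (elim bexE conjE)
    define g where "g t = L2_inner ?M (solution 2 t) w" for t
    have ev: "\<forall>\<^sub>F \<tau> in at t within {0..}. solution k \<tau> \<in> L2 ?M" for t k
      using eventually_nonneg_neq[of t] by eventually_elim (simp add: solution_L2)
    have "continuous_on {0..} g"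
      unfolding continuous_on_def g_def
      by (intro ballI L2_inner_tendsto_eventually[OF ev solution_L2 w solution_continuous_L2]) auto
    moreover have "((\<lambda>\<tau>. L2_inner ?M (solution 1 \<tau>) w) has_real_derivative g t) (at t within {0..})" if t: "t \<ge> 0" for t
      unfolding has_field_derivative_iff
    proof (rule Lim_transform_eventually)
      have quot: "\<forall>\<^sub>F \<tau> in at t within {0..}. (\<lambda>x. (solution 1 \<tau> x - solution 1 t x) / (\<tau> - t)) \<in> L2 ?M"
        using ev[of 1 t]
      proof eventually_elim
        case (elim \<tau>)
        from L2_scale[OF L2_diff[OF elim solution_L2[OF t]], of "1 / (\<tau> - t)"] show ?case by simp
      qed
      have "((\<lambda>\<tau>. L2_norm ?M (\<lambda>x. (solution 1 \<tau> x - solution 1 t x) / (\<tau> - t) - solution 2 t x)) \<longlongrightarrow> 0) (at t within {0..})"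
        using solution_derivative_L2[OF t, of 1] by (simp add: numeral_2_eq_2)
      from L2_inner_tendsto_eventually[OF quot solution_L2[OF t] w this]
      show "((\<lambda>\<tau>. L2_inner ?M (\<lambda>x. (solution 1 \<tau> x - solution 1 t x) / (\<tau> - t)) w) \<longlongrightarrow> g t) (at t within {0..})"
        unfolding g_def .
      show "\<forall>\<^sub>F \<tau> in at t within {0..}. L2_inner ?M (\<lambda>x. (solution 1 \<tau> x - solution 1 t x) / (\<tau> - t)) w
          = (L2_inner ?M (solution 1 \<tau>) w - L2_inner ?M (solution 1 t) w) / (\<tau> - t)"
        using ev[of 1 t]
      proof eventually_elim
        case (elim \<tau>)
        have "L2_inner ?M (\<lambda>x. 1 / (\<tau> - t) * (solution 1 \<tau> x - solution 1 t x)) w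
            = 1 / (\<tau> - t) * (L2_inner ?M (solution 1 \<tau>) w - L2_inner ?M (solution 1 t) w)"
          by (simp only: L2_inner_scale_left L2_inner_diff_left[OF elim solution_L2[OF t] w])
        then show ?case by simp
      qed
    qed
    moreover have "g t + L2_inner ?M (solution 0 t) z + c * L2_inner ?M (solution 1 t) y = 0" if t: "t \<ge> 0" for t
    proof -
      have coeff: "sine_coeff a b (solution k t) n = amplitude k t n" for k n
        unfolding solution_def by (rule sine_coeff_series[OF ab rapid_amplitude[OF t]])
      have inner: "(\<lambda>n. amplitude k t n * sine_coeff a b f n) sums L2_inner ?M (solution k t) f"
        if "f \<in> L2 ?M" for k f
        using Parseval[OF ab solution_L2[OF t, of k] that] by (simp only: coeff)
      have "(\<lambda>n. amplitude 2 t n * sine_coeff a b w n + amplitude 0 t n * sine_coeff a b z n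
            + c * (amplitude 1 t n * sine_coeff a b y n))
          sums (L2_inner ?M (solution 2 t) w + L2_inner ?M (solution 0 t) z + c * L2_inner ?M (solution 1 t) y)"
        by (intro sums_add sums_mult inner w z y(1))
      moreover have "amplitude 2 t n * sine_coeff a b w n + amplitude 0 t n * sine_coeff a b z n
          + c * (amplitude 1 t n * sine_coeff a b y n) = 0" for n
      proof -
        have "amplitude 2 t n * sine_coeff a b w n + amplitude 0 t n * sine_coeff a b z n
            + c * (amplitude 1 t n * sine_coeff a b y n)
          = (amplitude 2 t n + (freq a b n)\<^sup>2 * amplitude 0 t n + c * ((freq a b n)\<^sup>2 powr \<alpha>) * amplitude 1 t n)
            * sine_coeff a b w n"
          unfolding zn yn[rule_format] by (simp add: algebra_simps)
        then show ?thesis by (simp only: amplitude_equation mult_zero_left)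
      qed
      ultimately have "(\<lambda>n. 0) sums (L2_inner ?M (solution 2 t) w + L2_inner ?M (solution 0 t) z + c * L2_inner ?M (solution 1 t) y)"
        by simp
      from sums_unique2[OF this sums_zero] show ?thesis by (simp add: g_def)
    qed
    ultimately show "\<exists>y g. (w, y) \<in> op_powr ?M (dirichlet_laplacian {a<..<b}) \<alpha> \<and> continuous_on {0..} g \<and>
        (\<forall>t\<ge>0. ((\<lambda>\<tau>. L2_inner ?M (solution 1 \<tau>) w) has_real_derivative g t) (at t within {0..}) \<and>
          g t + L2_inner ?M (solution 0 t) z + c * L2_inner ?M (solution 1 t) y = 0)"
      using y(2) by (intro exI[of _ y] exI[of _ g] conjI allI impI)
  qed
qed simp_all

end

section \<open>Gevrey regularity and decay of the coefficients\<close>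

lemma continuous_eq_if_AE_eq:
  fixes f g :: "real \<Rightarrow> real"
  assumes "continuous_on {a<..<b} f" "continuous_on {a<..<b} g"
    and eq: "AE x in leb a b. f x = g x" and x: "x \<in> {a<..<b}"
  shows "f x = g x"
proof -
  define S where "S = {x \<in> {a<..<b}. f x - g x \<in> - {0}}"
  have "open S"
    unfolding S_def by (rule continuous_open_preimage[unfolded vimage_def Int_def mem_Collect_eq])
      (use assms in \<open>auto intro: continuous_intros\<close>)
  moreover have "negligible S"
  proof -
    have "AE x in lebesgue. x \<in> {a<..<b} \<longrightarrow> f x = g x"
      using eq by (subst (asm) AE_restrict_space_iff) auto
    then have "AE x in lebesgue. x \<notin> S"
      by eventually_elim (auto simp: S_def)
    then have "S \<in> null_sets lebesgue"
      using \<open>open S\<close> by (subst AE_iff_null_sets) auto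
    then show ?thesis by (simp add: negligible_iff_null_sets)
  qed
  ultimately have "S = {}" using open_not_negligible by blast
  then have "x \<notin> S" by simp
  then show ?thesis using x by (simp add: S_def)
qed

lemma higher_deriv_cong_open:
  fixes f g :: "real \<Rightarrow> real"
  assumes "open S" "\<And>x. x \<in> S \<Longrightarrow> f x = g x"
  shows "x \<in> S \<Longrightarrow> (deriv ^^ p) f x = (deriv ^^ p) g x"
proof (induction p arbitrary: x)
  case (Suc p)
  have "\<forall>\<^sub>F y in nhds x. y \<in> S" using assms(1) Suc.prems by (rule eventually_nhds_in_open)
  then have "\<forall>\<^sub>F y in nhds x. (deriv ^^ p) f y = (deriv ^^ p) g y"
    by eventually_elim (rule Suc.IH)
  then show ?case by (simp add: deriv_cong_ev)
qed (simp add: assms(2))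

lemma mode_periodic:
  assumes "a < b" "4 dvd Suc n"
  shows "mode a b q n (x + (b - a) / 2) = mode a b q n x"
proof -
  obtain j where j: "Suc n = 4 * j" using assms(2) by (auto simp: dvd_def)
  have "freq a b n * ((b - a) / 2) = 2 * real j * pi"
    using assms(1) by (simp add: freq_def j del: of_nat_Suc)
  then have "freq a b n * (x + (b - a) / 2 - a) + real q * (pi / 2)
      = (freq a b n * (x - a) + real q * (pi / 2)) + 2 * real j * pi"
    by (simp add: algebra_simps)
  then show ?thesis by (simp only: mode_def sin_add[of _ "2 * real j * pi"] sin_2npi cos_2npi mult_1_right mult_zero_right add_0_right)
qed

lemma series_periodic:
  assumes "a < b" "\<And>n. c n \<noteq> 0 \<Longrightarrow> 4 dvd Suc n"
  shows "series a b q c (x + (b - a) / 2) = series a b q c x"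
proof -
  have "c n * mode a b q n (x + (b - a) / 2) = c n * mode a b q n x" for n
    using mode_periodic[OF assms(1), of n] assms(2)[of n] by (cases "c n = 0") simp_all
  then show ?thesis unfolding series_def by (rule suminf_cong)
qed

text \<open>If all frequencies are multiples of the fourth one, the series has the period \<open>(b - a) / 2\<close>,
  and a compact subset of the open interval contains a full period. So interior bounds for the
  derivatives hold on the whole interval, and the derivatives of even order, which are sine series
  again, yield bounds for the coefficients.\<close>

lemma gevrey_coeff_le:
  assumes "a < b" and c: "rapid a b c" and four: "\<And>n. c n \<noteq> 0 \<Longrightarrow> 4 dvd Suc n"
    and f: "f \<in> gevrey r {a<..<b}" and eq: "AE x in leb a b. series a b 0 c x = f x"
  shows "\<exists>R>0. \<forall>n. \<forall>q\<ge>1. \<bar>c n\<bar> * freq a b n ^ (2 * q)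
    \<le> sqrt (b - a) * (R ^ (2 * q) * real (2 * q) powr (r * real (2 * q)))"
proof -
  let ?M = "leb a b" and ?F = "series a b 0 c"
  define P where "P = (b - a) / 2"
  \<comment> \<open>The middle half of the interval has the length of the period \<open>P\<close>.\<close>
  define K where "K = {a + (b - a) / 4 .. b - (b - a) / 4}"
  have smooth: "smooth_on {a<..<b} f" using f by (simp add: gevrey_def)
  have "continuous_on {a<..<b} f"
  proof (rule continuous_at_imp_continuous_on, rule ballI)
    fix x assume "x \<in> {a<..<b}"
    then have "(deriv ^^ 0) f field_differentiable at x" using smooth unfolding smooth_on_def by blast
    then show "isCont f x" by (simp add: field_differentiable_imp_continuous_at)
  qed
  then have Ff: "?F x = f x" if "x \<in> {a<..<b}" for x
    by (intro continuous_eq_if_AE_eq[OF smooth_continuous_on[OF smooth_series[OF assms(1) c]] _ eq that])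
  have KO: "compact K" "K \<subseteq> {a<..<b}"
  proof -
    show "compact K" by (simp add: K_def)
    show "K \<subseteq> {a<..<b}"
    proof
      fix x assume "x \<in> K"
      then have "a + (b - a) / 4 \<le> x" "x \<le> b - (b - a) / 4" by (simp_all add: K_def)
      then have "a < x \<and> x < b" using assms(1) by (simp add: field_simps)
      then show "x \<in> {a<..<b}" by simp
    qed
  qed
  then obtain R where R: "R > 0" "\<forall>p\<ge>1. \<forall>x\<in>K. \<bar>(deriv ^^ p) f x\<bar> \<le> R ^ p * real p powr (r * real p)"
    using f unfolding gevrey_def by blast
  define G where "G q = series a b 0 (\<lambda>n. freq a b n ^ (2 * q) * c n)" for q
  have deriv_even: "(deriv ^^ (2 * q)) ?F x = (-1) ^ q * G q x" for q x
  proof -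
    have "(deriv ^^ (2 * q)) ?F x = (\<Sum>n. (-1) ^ q * ((freq a b n ^ (2 * q) * c n) * mode a b 0 n x))"
      unfolding higher_deriv_series[OF assms(1) c] series_def add_0 mode_add_even by (simp only: ac_simps)
    also have "\<dots> = (-1) ^ q * G q x"
      unfolding G_def series_def by (rule suminf_mult[OF series_summable[OF assms(1) rapid_freq_mult[OF assms(1) c]]])
    finally show ?thesis .
  qed
  have G_period: "G q (x + P) = G q x" for q x
    unfolding G_def P_def by (rule series_periodic[OF assms(1)]) (use four in auto)
  have G_K: "\<bar>G q x\<bar> \<le> R ^ (2 * q) * real (2 * q) powr (r * real (2 * q))" if "x \<in> K" "q \<ge> 1" for q x
  proof -
    have "\<bar>G q x\<bar> = \<bar>(deriv ^^ (2 * q)) ?F x\<bar>" unfolding deriv_even by (simp add: abs_mult power_abs)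
    also have "(deriv ^^ (2 * q)) ?F x = (deriv ^^ (2 * q)) f x"
      using higher_deriv_cong_open[of "{a<..<b}" ?F f x "2 * q"] Ff KO(2) that(1) by auto
    also have "\<bar>\<dots>\<bar> \<le> R ^ (2 * q) * real (2 * q) powr (r * real (2 * q))"
      using R(2)[rule_format, of "2 * q" x] that by simp
    finally show ?thesis .
  qed
  have G_all: "\<bar>G q x\<bar> \<le> R ^ (2 * q) * real (2 * q) powr (r * real (2 * q))" if x: "x \<in> {a<..<b}" and q: "q \<ge> 1" for q x
  proof -
    have "a < x" "x < b" using x by simp_all
    then consider "a + (b - a) / 4 \<le> x" "x \<le> b - (b - a) / 4" | "a + (b - a) / 4 \<le> x + P" "x + P \<le> b - (b - a) / 4"
      | "a + (b - a) / 4 \<le> x - P" "x - P \<le> b - (b - a) / 4"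
      unfolding P_def by argo
    then consider "x \<in> K" | "x + P \<in> K" | "x - P \<in> K"
      unfolding K_def by (metis atLeastAtMost_iff)
    then show ?thesis
    proof cases
      case 1
      then show ?thesis using G_K q by blast
    next
      case 2
      then show ?thesis using G_K[OF 2 q] G_period[of q x] by simp
    next
      case 3
      then show ?thesis using G_K[OF 3 q] G_period[of q "x - P"] by simp
    qed
  qed
  have "\<bar>c n\<bar> * freq a b n ^ (2 * q) \<le> sqrt (b - a) * (R ^ (2 * q) * real (2 * q) powr (r * real (2 * q)))"
    if q: "q \<ge> 1" for n q
  proof -
    have GL: "G q \<in> L2 ?M" unfolding G_def by (rule series_L2[OF assms(1) rapid_freq_mult[OF assms(1) c]])
    have "L2_inner ?M (G q) (mode a b 0 n) = freq a b n ^ (2 * q) * c n"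
      using sine_coeff_series[OF assms(1) rapid_freq_mult[OF assms(1) c]] by (simp add: G_def sine_coeff_def)
    then have "\<bar>c n\<bar> * freq a b n ^ (2 * q) = \<bar>L2_inner ?M (G q) (mode a b 0 n)\<bar>"
      using freq_pos[OF assms(1), of n] by (simp add: abs_mult mult.commute)
    also have "\<dots> \<le> L2_norm ?M (G q) * L2_norm ?M (mode a b 0 n)"
      by (rule L2_Cauchy_Schwarz[OF GL mode_L2])
    also have "\<dots> = L2_norm ?M (G q)"
      by (simp add: L2_norm_def mode_orthonormal[OF assms(1)])
    also have "\<dots> \<le> (R ^ (2 * q) * real (2 * q) powr (r * real (2 * q))) * sqrt (b - a)"
      using R(1) by (intro L2_norm_le_sup assms(1) GL G_all q) auto
    finally show ?thesis by (simp add: mult.commute)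
  qed
  with R(1) show ?thesis by blast
qed

text \<open>Optimizing the order of differentiation: with \<open>2 q\<close> just below \<open>X = (\<mu> / (2 R))\<^sup>1\<^sup>/\<^sup>r\<close>, the
  bound becomes \<open>2\<^sup>-\<^sup>2\<^sup>q\<close>.\<close>

lemma gevrey_coeff_decay:
  assumes "a < b" and c: "rapid a b c" and four: "\<And>n. c n \<noteq> 0 \<Longrightarrow> 4 dvd Suc n" and "r > 0"
    and f: "f \<in> gevrey r {a<..<b}" and eq: "AE x in leb a b. series a b 0 c x = f x"
  shows "\<exists>C \<kappa>. \<kappa> > 0 \<and> (\<forall>n. \<bar>c n\<bar> \<le> C * exp (- \<kappa> * freq a b n powr (1 / r)))"
proof -
  obtain R where R: "R > 0" and bound: "\<forall>n. \<forall>q\<ge>1. \<bar>c n\<bar> * freq a b n ^ (2 * q)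
      \<le> sqrt (b - a) * (R ^ (2 * q) * real (2 * q) powr (r * real (2 * q)))"
    using gevrey_coeff_le[OF assms(1-3) f eq] by blast
  define B where "B = (\<Sum>n. \<bar>c n\<bar>) + sqrt (b - a)"
  have cB: "\<bar>c n\<bar> \<le> B" for n
    using sum_le_suminf[OF rapid_summable_abs[OF c], of "{n}"] assms(1) by (simp add: B_def add_increasing2)
  have B0: "B \<ge> 0" using cB[of 0] by linarith
  define \<kappa> where "\<kappa> = ln 2 * (1 / (2 * R)) powr (1 / r)"
  have "\<bar>c n\<bar> \<le> (4 * B) * exp (- \<kappa> * freq a b n powr (1 / r))" for n
  proof -
    let ?\<mu> = "freq a b n"
    have \<mu>: "?\<mu> > 0" by (rule freq_pos[OF assms(1)])
    define X where "X = (?\<mu> / (2 * R)) powr (1 / r)"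
    define q where "q = nat \<lfloor>X / 2\<rfloor>"
    have X: "X > 0" using \<mu> R by (simp add: X_def)
    have q: "real (2 * q) \<le> X" "X < real (2 * q) + 2" using X unfolding q_def by linarith+
    have "\<bar>c n\<bar> \<le> B * (1 / 2) ^ (2 * q)"
    proof (cases "q = 0")
      case False
      then have q1: "q \<ge> 1" by simp
      have "real (2 * q) powr r \<le> X powr r" using q(1) \<open>r > 0\<close> by (intro powr_mono2) auto
      also have "\<dots> = ?\<mu> / (2 * R)" using \<mu> R \<open>r > 0\<close> by (simp add: X_def powr_powr)
      finally have "R * real (2 * q) powr r \<le> ?\<mu> / 2" using R by (simp add: field_simps)
      then have "(R * real (2 * q) powr r) ^ (2 * q) \<le> (?\<mu> / 2) ^ (2 * q)"
        using R by (intro power_mono) auto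
      moreover have "R ^ (2 * q) * real (2 * q) powr (r * real (2 * q)) = (R * real (2 * q) powr r) ^ (2 * q)"
        using q1 by (simp add: power_mult_distrib powr_powr flip: powr_realpow')
      ultimately have "\<bar>c n\<bar> * ?\<mu> ^ (2 * q) \<le> sqrt (b - a) * (?\<mu> / 2) ^ (2 * q)"
        using bound[rule_format, OF q1, of n] assms(1)
        by (smt (verit, best) mult_left_mono real_sqrt_ge_zero)
      also have "\<dots> \<le> B * (?\<mu> / 2) ^ (2 * q)"
        using suminf_nonneg[OF rapid_summable_abs[OF c]] \<mu> by (intro mult_right_mono) (auto simp: B_def)
      also have "\<dots> = (B * (1 / 2) ^ (2 * q)) * ?\<mu> ^ (2 * q)" by (simp add: power_divide)
      finally show ?thesis using \<mu> by (simp only: mult_le_cancel_right) (simp add: not_less)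
    qed (use cB in simp)
    also have "B * (1 / 2) ^ (2 * q) \<le> B * (4 * exp (- \<kappa> * ?\<mu> powr (1 / r)))"
    proof (rule mult_left_mono[OF _ B0])
    have "(1 / 2 :: real) ^ (2 * q) = 2 powr (- real (2 * q))"
      by (subst powr_minus, subst powr_realpow) (simp_all add: power_one_over inverse_eq_divide)
    also have "\<dots> \<le> 2 powr (2 - X)" using q(2) by (intro powr_mono) auto
    also have "\<dots> = 4 * exp (- \<kappa> * ?\<mu> powr (1 / r))"
    proof -
      have "X = (1 / (2 * R)) powr (1 / r) * ?\<mu> powr (1 / r)"
        using \<mu> R by (simp add: X_def powr_divide)
      then have "\<kappa> * ?\<mu> powr (1 / r) = X * ln 2" by (simp add: \<kappa>_def)
      then show ?thesis by (simp add: powr_diff powr_def[of 2 X] exp_minus divide_inverse)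
    qed
    finally show "(1 / 2) ^ (2 * q) \<le> 4 * exp (- \<kappa> * ?\<mu> powr (1 / r))" .
    qed
    finally show ?thesis by (simp only: ac_simps)
  qed
  moreover have "\<kappa> > 0" using R by (simp add: \<kappa>_def)
  ultimately show ?thesis by blast
qed

text \<open>After taking logarithms, the difference of both sides is \<open>x\<^sup>\<sigma> (\<kappa> x\<^sup>p\<^sup>-\<^sup>\<sigma> - K)\<close> up to a
  constant.\<close>

lemma exp_powr_eventually_less:
  fixes \<sigma> p \<kappa> \<delta> C K :: real
  assumes "0 < \<sigma>" "\<sigma> < p" "\<kappa> > 0" "\<delta> > 0"
  shows "\<forall>\<^sub>F x in at_top. C * exp (- \<kappa> * x powr p) < \<delta> * exp (- K * x powr \<sigma>)"
proof -
  have "filterlim (\<lambda>x::real. x powr \<sigma> * (\<kappa> * x powr (p - \<sigma>) - K)) at_top at_top"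
  proof (rule filterlim_at_top_mult_at_top)
    show "filterlim (\<lambda>x::real. x powr \<sigma>) at_top at_top" using assms by real_asymp
    show "filterlim (\<lambda>x::real. \<kappa> * x powr (p - \<sigma>) - K) at_top at_top" using assms by real_asymp
  qed
  then have "\<forall>\<^sub>F x in at_top. ln ((\<bar>C\<bar> + 1) / \<delta>) < x powr \<sigma> * (\<kappa> * x powr (p - \<sigma>) - K)"
    unfolding filterlim_at_top_dense by blast
  then show ?thesis
    using eventually_gt_at_top[of 0]
  proof eventually_elim
    case (elim x)
    have "x powr \<sigma> * (\<kappa> * x powr (p - \<sigma>) - K) = \<kappa> * x powr p - K * x powr \<sigma>"
      using elim(2) by (simp add: right_diff_distrib mult.left_commute flip: powr_add)
    then have "exp (ln ((\<bar>C\<bar> + 1) / \<delta>)) < exp (\<kappa> * x powr p - K * x powr \<sigma>)"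
      using elim(1) by simp
    then have "(\<bar>C\<bar> + 1) / \<delta> < exp (\<kappa> * x powr p) / exp (K * x powr \<sigma>)"
      using assms(4) by (simp add: exp_diff)
    then have "\<bar>C\<bar> + 1 < \<delta> * (exp (\<kappa> * x powr p) / exp (K * x powr \<sigma>))"
      using assms(4) by (simp add: divide_less_eq mult.commute)
    then have "C < \<delta> * (exp (\<kappa> * x powr p) / exp (K * x powr \<sigma>))" by linarith
    then show ?case using assms(4) by (simp add: exp_minus field_simps)
  qed
qed

lemma freq_at_top: "a < b \<Longrightarrow> filterlim (freq a b) at_top sequentially"
proof -
  assume "a < b"
  then have "pi / (b - a) > 0" by simp
  then have "filterlim (\<lambda>n. real (Suc n) * (pi / (b - a))) at_top sequentially" by real_asymp
  then show ?thesis by (simp add: freq_def[abs_def])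
qed

definition decays_slowly :: "real \<Rightarrow> real \<Rightarrow> real \<Rightarrow> (nat \<Rightarrow> real) \<Rightarrow> bool" where
  "decays_slowly a b \<sigma> d \<longleftrightarrow> (\<exists>\<delta>>0. \<exists>K. \<exists>\<^sub>F n in sequentially.
    \<delta> * exp (- K * freq a b n powr \<sigma>) \<le> \<bar>d n\<bar>)"

lemma not_gevrey_if_decays_slowly:
  assumes "a < b" and c: "rapid a b c" and four: "\<And>n. c n \<noteq> 0 \<Longrightarrow> 4 dvd Suc n"
    and "0 < r" "0 < \<sigma>" "\<sigma> < 1 / r" and slow: "decays_slowly a b \<sigma> c"
  shows "\<not> (\<exists>f. (AE x in leb a b. series a b 0 c x = f x) \<and> f \<in> gevrey r {a<..<b})"
proof
  assume "\<exists>f. (AE x in leb a b. series a b 0 c x = f x) \<and> f \<in> gevrey r {a<..<b}"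
  then obtain f where f: "f \<in> gevrey r {a<..<b}" "AE x in leb a b. series a b 0 c x = f x"
    by blast
  obtain \<delta> K where \<delta>: "\<delta> > 0"
    and large: "\<exists>\<^sub>F n in sequentially. \<delta> * exp (- K * freq a b n powr \<sigma>) \<le> \<bar>c n\<bar>"
    using slow unfolding decays_slowly_def by blast
  obtain C \<kappa> where \<kappa>: "\<kappa> > 0" "\<forall>n. \<bar>c n\<bar> \<le> C * exp (- \<kappa> * freq a b n powr (1 / r))"
    using gevrey_coeff_decay[OF assms(1-4) f] by blast
  have "\<forall>\<^sub>F n in sequentially. C * exp (- \<kappa> * freq a b n powr (1 / r)) < \<delta> * exp (- K * freq a b n powr \<sigma>)"
    by (rule eventually_compose_filterlim[OF exp_powr_eventually_less[OF assms(5,6) \<kappa>(1) \<delta>] freq_at_top[OF assms(1)]])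
  then have "\<forall>\<^sub>F n in sequentially. \<not> \<delta> * exp (- K * freq a b n powr \<sigma>) \<le> \<bar>c n\<bar>"
  proof eventually_elim
    case (elim n)
    then show ?case using \<kappa>(2)[rule_format, of n] by linarith
  qed
  then show False using large by (simp add: frequently_def)
qed

section \<open>Real analytic functions are Gevrey of order one\<close>

text \<open>The power series extends the function to a complex disc, where Cauchy's inequality bounds all
  derivatives.\<close>

lemma real_analytic_local_bound:
  fixes f :: "real \<Rightarrow> real"
  assumes S: "open S" "real_analytic_on S f" "x \<in> S"
  shows "\<exists>d>0. \<exists>B\<ge>0. \<exists>R>0. ball x d \<subseteq> S \<and>
    (\<forall>y\<in>ball x d. \<forall>p. (deriv ^^ p) f field_differentiable at y \<and> \<bar>(deriv ^^ p) f y\<bar> \<le> B * R ^ p * fact p)"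
proof -
  obtain \<rho> k where \<rho>: "\<rho> > 0" and sums: "\<forall>y\<in>S. \<bar>y - x\<bar> < \<rho> \<longrightarrow> (\<lambda>n. k n * (y - x) ^ n) sums f y"
    using S(2,3) unfolding real_analytic_on_def by blast
  obtain e where e: "e > 0" "ball x e \<subseteq> S" using S(1,3) open_contains_ball by blast
  define d where "d = min e \<rho> / 4"
  have d: "d > 0" "4 * d \<le> e" "4 * d \<le> \<rho>" using e(1) \<rho> by (auto simp: d_def)
  define F where "F z = (\<Sum>n. of_real (k n) * (z - of_real x) ^ n)" for z :: complex
  let ?c = "complex_of_real x"
  have in_S: "y \<in> S" "\<bar>y - x\<bar> < \<rho>" if "\<bar>y - x\<bar> < 4 * d" for y
    using that e(2) d by (auto simp: subset_iff dist_real_def abs_minus_commute)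
  have "(\<lambda>n. k n * (3 * d) ^ n) sums f (x + 3 * d)"
    using sums[rule_format, OF in_S[of "x + 3 * d"]] d(1) by simp
  then have "summable (\<lambda>n. complex_of_real (k n) * (of_real (3 * d)) ^ n)"
    using sums_of_real[of "\<lambda>n. k n * (3 * d) ^ n"] by (auto dest: sums_summable)
  then have summ: "summable (\<lambda>n. of_real (k n) * (z - ?c) ^ n)" if "z \<in> ball ?c (3 * d)" for z
    by (rule powser_inside) (use that d(1) in \<open>simp add: dist_norm norm_minus_commute\<close>)
  have holo: "F holomorphic_on ball ?c (3 * d)"
    by (rule power_series_holomorphic[where a = "\<lambda>n. complex_of_real (k n)"])
       (use summ in \<open>auto simp: F_def intro: summable_sums\<close>)
  have F_real: "F (of_real y) = of_real (f y)" if "\<bar>y - x\<bar> < 3 * d" for y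
  proof -
    have "(\<lambda>n. k n * (y - x) ^ n) sums f y" using sums in_S[of y] that d(1) by auto
    from sums_of_real[OF this, where 'a = complex] have "(\<lambda>n. of_real (k n) * (of_real y - ?c) ^ n) sums of_real (f y)"
      by simp
    then show ?thesis unfolding F_def by (rule sums_unique[symmetric])
  qed
  have step: "g field_differentiable at y \<and> deriv G (of_real y) = of_real (deriv g y)"
    if g: "\<And>y. \<bar>y - x\<bar> < 3 * d \<Longrightarrow> G (of_real y) = of_real (g y)" and hG: "G holomorphic_on ball ?c (3 * d)"
      and y: "\<bar>y - x\<bar> < 3 * d" for g :: "real \<Rightarrow> real" and G y
  proof -
    have "of_real y \<in> ball ?c (3 * d)"
      using y by (simp add: dist_of_real dist_real_def abs_minus_commute)
    then have "(G has_field_derivative deriv G (of_real y)) (at (of_real y))"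
      using hG by (intro holomorphic_derivI[of G "ball ?c (3 * d)"]) auto
    then have v: "((\<lambda>t. G (of_real t)) has_vector_derivative deriv G (of_real y)) (at y)"
      by (rule has_vector_derivative_real_field)
    define T where "T = {x - 3 * d <..< x + 3 * d}"
    have T: "open T" "y \<in> T" using y by (auto simp: T_def)
    have Gg: "G (of_real t) = of_real (g t)" if "t \<in> T" for t
      using that by (intro g) (auto simp: T_def)
    have v': "((\<lambda>t. complex_of_real (g t)) has_vector_derivative deriv G (of_real y)) (at y)"
      by (rule has_vector_derivative_transform_within_open[OF v T Gg])
    have re: "(g has_real_derivative Re (deriv G (of_real y))) (at y)"
      using bounded_linear.has_vector_derivative[OF bounded_linear_Re v']
      by (simp add: has_real_derivative_iff_has_vector_derivative)
    have "((\<lambda>t. 0) has_real_derivative Im (deriv G (of_real y))) (at y)"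
      using bounded_linear.has_vector_derivative[OF bounded_linear_Im v']
      by (simp add: has_real_derivative_iff_has_vector_derivative)
    then have "Im (deriv G (of_real y)) = 0" by (rule DERIV_unique) simp
    then have "deriv G (of_real y) = of_real (deriv g y)"
      using DERIV_imp_deriv[OF re] by (simp add: complex_eq_iff)
    with re show ?thesis by (auto simp: field_differentiable_def)
  qed
  have holo_p: "(deriv ^^ p) F holomorphic_on ball ?c (3 * d)" for p
    by (rule holomorphic_higher_deriv[OF holo]) simp
  have deriv_real: "(deriv ^^ p) F (of_real y) = of_real ((deriv ^^ p) f y)" if "\<bar>y - x\<bar> < 3 * d" for y p
    using that
  proof (induction p arbitrary: y)
    case 0
    then show ?case using F_real by simp
  next
    case (Suc p)
    show ?case using step[OF Suc.IH holo_p Suc.prems] by simp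
  qed
  have compact: "compact (F ` cball ?c (2 * d))"
    using d(1) by (intro compact_continuous_image holomorphic_on_imp_continuous_on
        holomorphic_on_subset[OF holo]) auto
  from compact_imp_bounded[OF compact]
  obtain B where B: "\<forall>z\<in>F ` cball ?c (2 * d). norm z \<le> B"
    unfolding bounded_iff by blast
  have "norm (F ?c) \<le> B" using B d(1) by auto
  then have B0: "B \<ge> 0" using norm_ge_zero[of "F ?c"] by linarith
  have bound: "(deriv ^^ p) f field_differentiable at y \<and> \<bar>(deriv ^^ p) f y\<bar> \<le> B * (1 / d) ^ p * fact p"
    if "y \<in> ball x d" for y p
  proof
    have y: "\<bar>y - x\<bar> < d" using that by (simp add: dist_real_def abs_minus_commute)
    then have y3: "\<bar>y - x\<bar> < 3 * d" by linarith
    show "(deriv ^^ p) f field_differentiable at y"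
      using step[OF deriv_real holo_p y3] by blast
    have sub: "w \<in> cball ?c (2 * d)" if "w \<in> cball (of_real y) d" for w
    proof -
      have "dist ?c w \<le> dist ?c (of_real y) + dist (of_real y) w" by (rule dist_triangle)
      also have "\<dots> \<le> d + d"
        using that y by (intro add_mono) (auto simp: dist_of_real dist_real_def abs_minus_commute)
      finally show ?thesis by simp
    qed
    have sub': "cball (of_real y) d \<subseteq> ball ?c (3 * d)"
      using sub d(1) by fastforce
    have "norm ((deriv ^^ p) F (of_real y)) \<le> fact p * B / d ^ p"
    proof (rule Cauchy_inequality)
      show "F holomorphic_on ball (of_real y) d"
        by (rule holomorphic_on_subset[OF holo]) (use sub' ball_subset_cball in blast)
      show "continuous_on (cball (of_real y) d) F"
        by (rule holomorphic_on_imp_continuous_on[OF holomorphic_on_subset[OF holo sub']])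
      show "norm (F w) \<le> B" if "norm (of_real y - w) = d" for w
        using B sub[of w] that by (simp add: dist_norm)
    qed (rule d(1))
    then show "\<bar>(deriv ^^ p) f y\<bar> \<le> B * (1 / d) ^ p * fact p"
      by (simp add: deriv_real[OF y3] power_inverse divide_inverse ac_simps)
  qed
  have "ball x d \<subseteq> S" using e d by (auto simp: subset_iff)
  then show ?thesis
    using d(1) B0 bound by (intro exI[of _ d] exI[of _ B] exI[of _ "1 / d"] conjI ballI allI) auto
qed

text \<open>A compact set is covered by finitely many of these discs; the constant \<open>B\<close> is absorbed by
  \<open>(B + 1)\<^sup>p\<close> for \<open>p \<ge> 1\<close>, and \<open>p! \<le> p\<^sup>p\<close>.\<close>

lemma real_analytic_imp_gevrey_1:
  assumes "open S" "real_analytic_on S f"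
  shows "f \<in> gevrey 1 S"
proof -
  define bounded_by where "bounded_by x d M \<longleftrightarrow>
    (\<forall>y\<in>ball x d. \<forall>p\<ge>1. \<bar>(deriv ^^ p) f y\<bar> \<le> M ^ p * real p ^ p)" for x d M
  have local: "(\<forall>p. (deriv ^^ p) f field_differentiable at x) \<and> (\<exists>d>0. \<exists>M>0. bounded_by x d M)"
    if x: "x \<in> S" for x
  proof -
    from real_analytic_local_bound[OF assms x] obtain d B R where d: "d > 0" and B: "B \<ge> 0" and R: "R > 0"
      and bd: "\<forall>y\<in>ball x d. \<forall>p. (deriv ^^ p) f field_differentiable at y \<and> \<bar>(deriv ^^ p) f y\<bar> \<le> B * R ^ p * fact p"
      by (elim exE conjE)
    have "bounded_by x d ((B + 1) * R)"
      unfolding bounded_by_def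
    proof (intro ballI allI impI)
      fix y p assume y: "y \<in> ball x d" and p: "(1::nat) \<le> p"
      have "\<bar>(deriv ^^ p) f y\<bar> \<le> B * R ^ p * fact p" using bd y by blast
      also have "\<dots> \<le> ((B + 1) ^ p * R ^ p) * real p ^ p"
      proof (intro mult_mono)
        have "B \<le> (B + 1) ^ 1" by simp
        also have "\<dots> \<le> (B + 1) ^ p" using p B by (intro power_increasing) auto
        finally show "B \<le> (B + 1) ^ p" .
        show "fact p \<le> real p ^ p" using fact_le_power[of p, where 'a = real] by simp
      qed (use B R in auto)
      finally show "\<bar>(deriv ^^ p) f y\<bar> \<le> ((B + 1) * R) ^ p * real p ^ p"
        by (simp only: power_mult_distrib)
    qed
    moreover have "(B + 1) * R > 0" using B R by simp
    moreover have "(deriv ^^ p) f field_differentiable at x" for p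
      using bspec[OF bd, of x] d by simp
    ultimately show ?thesis using d by (intro conjI allI exI[of _ d] exI[of _ "(B + 1) * R"])
  qed
  then have "smooth_on S f" by (simp add: smooth_on_def)
  moreover have "\<exists>M>0. \<forall>p\<ge>1. \<forall>y\<in>K. \<bar>(deriv ^^ p) f y\<bar> \<le> M ^ p * real p powr (1 * real p)"
    if K: "compact K" "K \<subseteq> S" for K
  proof -
    have "\<forall>x\<in>K. \<exists>d. d > 0 \<and> (\<exists>M>0. bounded_by x d M)" using local K(2) by (simp add: subset_iff)
    from bchoice[OF this] obtain d where d: "\<forall>x\<in>K. d x > 0 \<and> (\<exists>M>0. bounded_by x (d x) M)" ..
    have "K \<subseteq> (\<Union>x\<in>K. ball x (d x))"
    proof
      fix t assume "t \<in> K"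
      moreover from this have "t \<in> ball t (d t)" using d by simp
      ultimately show "t \<in> (\<Union>x\<in>K. ball x (d x))" by (rule UN_I)
    qed
    from compactE_image[OF K(1) _ this] obtain C where C: "C \<subseteq> K" "finite C" "K \<subseteq> (\<Union>x\<in>C. ball x (d x))"
      by auto
    have "\<forall>x\<in>C. \<exists>M. M > 0 \<and> bounded_by x (d x) M" using d C(1) by (simp add: subset_iff)
    from bchoice[OF this] obtain m where m: "\<forall>x\<in>C. m x > 0 \<and> bounded_by x (d x) (m x)" ..
    define M where "M = (\<Sum>x\<in>C. m x) + 1"
    have M: "m x \<le> M" if "x \<in> C" for x
      using member_le_sum[of x C m] m that C(2) by (simp add: M_def less_imp_le)
    have "M > 0" using sum_nonneg[of C m] m by (simp add: M_def less_imp_le add_nonneg_pos)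
    moreover have "\<bar>(deriv ^^ p) f y\<bar> \<le> M ^ p * real p powr (1 * real p)" if p: "p \<ge> 1" and y: "y \<in> K" for p y
    proof -
      obtain x where x: "x \<in> C" "y \<in> ball x (d x)" using C(3) y by auto
      have "\<bar>(deriv ^^ p) f y\<bar> \<le> m x ^ p * real p ^ p"
        using m x p unfolding bounded_by_def by simp
      also have "\<dots> \<le> M ^ p * real p ^ p"
        using M[OF x(1)] m x(1) by (intro mult_right_mono power_mono) (auto intro: less_imp_le)
      finally show ?thesis using p by (simp add: powr_realpow)
    qed
    ultimately show ?thesis by (intro exI[of _ M] conjI allI impI ballI)
  qed
  ultimately show ?thesis by (simp add: gevrey_def)
qed

section \<open>Slowly decaying modes\<close>

text \<open>These amplitudes decrease faster than every power of the frequency, so that the solution is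
  smooth from the beginning, but no faster than the modes are damped.\<close>

lemma rapid_exp_powr:
  assumes "a < b" "0 < \<sigma>"
  shows "rapid a b (\<lambda>n. exp (- (freq a b n powr \<sigma>)))"
  unfolding rapid_def
proof
  fix k
  have "((\<lambda>x::real. exp (- (x powr \<sigma>)) * x powr (real k + 2)) \<longlongrightarrow> 0) at_top"
    using assms(2) by real_asymp
  then have "\<forall>\<^sub>F x::real in at_top. exp (- (x powr \<sigma>)) * x powr (real k + 2) < 1"
    by (rule order_tendstoD) simp
  then have ev: "\<forall>\<^sub>F n in sequentially. exp (- (freq a b n powr \<sigma>)) * freq a b n powr (real k + 2) < 1"
    by (rule eventually_compose_filterlim[OF _ freq_at_top[OF assms(1)]])
  show "summable (\<lambda>n. \<bar>exp (- (freq a b n powr \<sigma>))\<bar> * freq a b n ^ k)"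
  proof (rule summable_comparison_test_ev)
    have "summable (\<lambda>n. inverse (real n ^ 2))" by (rule inverse_power_summable) simp
    then have "summable (\<lambda>n. ((b - a) / pi)\<^sup>2 * inverse (real (Suc n) ^ 2))"
      by (intro summable_mult) (subst summable_Suc_iff)
    then show "summable (\<lambda>n. 1 / (freq a b n)\<^sup>2)"
      by (simp add: freq_def power_divide power_mult_distrib divide_inverse ac_simps)
    show "\<forall>\<^sub>F n in sequentially. norm (\<bar>exp (- (freq a b n powr \<sigma>))\<bar> * freq a b n ^ k) \<le> 1 / (freq a b n)\<^sup>2"
      using ev
    proof eventually_elim
      case (elim n)
      have pos: "freq a b n > 0" by (rule freq_pos[OF assms(1)])
      then have "freq a b n powr (real k + 2) = freq a b n ^ k * (freq a b n)\<^sup>2"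
        by (simp add: powr_add powr_realpow flip: powr_numeral)
      then show ?case using elim pos by (simp add: field_simps)
    qed
  qed
qed

lemma freq_square_powr: "a < b \<Longrightarrow> (freq a b n)\<^sup>2 powr \<alpha> = freq a b n powr (2 * \<alpha>)"
  using freq_pos[of a b n] by (simp add: powr_powr flip: powr_numeral)

lemma frequentlyI_unbounded: "(\<And>N. \<exists>n\<ge>N. P n) \<Longrightarrow> \<exists>\<^sub>F n in sequentially. P n"
  unfolding frequently_def eventually_sequentially by blast

text \<open>The slow root \<open>-2 \<lambda> / (B + sqrt (B\<^sup>2 - 4 \<lambda>))\<close>, with \<open>B = c \<lambda>\<^sup>\<alpha>\<close>, is of size
  \<open>\<lambda>\<^sup>1\<^sup>-\<^sup>\<alpha>\<close>.\<close>

lemma overdamped_modes: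
  assumes "a < b" "0 < c" "1 / 2 \<le> \<alpha>" "\<alpha> < 1" and crit: "\<alpha> = 1 / 2 \<longrightarrow> 2 \<le> c"
    and \<sigma>: "\<sigma> = 2 * (1 - \<alpha>)"
  shows "\<exists>\<kappa> \<rho>. damped_modes a b c \<alpha> \<kappa> \<rho> \<and> (\<forall>n. \<kappa> n \<noteq> 0 \<longrightarrow> 4 dvd Suc n) \<and>
    (\<forall>t>0. decays_slowly a b \<sigma> (damped_modes.amplitude \<kappa> \<rho> 0 t))"
proof -
  define \<mu> where "\<mu> = freq a b"
  define B where "B n = c * \<mu> n powr (2 * \<alpha>)" for n
  define T where "T n = B n + sqrt ((B n)\<^sup>2 - 4 * (\<mu> n)\<^sup>2)" for n
  define good where "good n \<longleftrightarrow> 4 dvd Suc n \<and> 2 * \<mu> n \<le> B n" for n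
  define \<rho> where "\<rho> n = (if good n then complex_of_real (- (2 * (\<mu> n)\<^sup>2 / T n)) else 0)" for n
  define \<kappa> where "\<kappa> n = (if good n then complex_of_real (exp (- (\<mu> n powr \<sigma>))) else 0)" for n
  have \<sigma>0: "\<sigma> > 0" using assms(4) \<sigma> by simp
  have \<mu>: "\<mu> n > 0" for n unfolding \<mu>_def by (rule freq_pos[OF assms(1)])
  have B: "B n > 0" for n using assms(2) \<mu>[of n] by (simp add: B_def)
  have disc: "(B n)\<^sup>2 - 4 * (\<mu> n)\<^sup>2 \<ge> 0" if "good n" for n
    using power_mono[of "2 * \<mu> n" "B n" 2] that \<mu>[of n] by (simp add: good_def power_mult_distrib)
  have T: "T n \<ge> B n" "T n \<ge> 2 * \<mu> n" if "good n" for n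
    using real_sqrt_ge_zero[OF disc[OF that]] that unfolding T_def good_def by linarith+
  have modes: "damped_modes a b c \<alpha> \<kappa> \<rho>"
  proof
    show "rapid a b (\<lambda>n. cmod (\<kappa> n))"
      by (rule rapid_bounded[OF rapid_exp_powr[OF assms(1) \<sigma>0] assms(1), where K = 1])
         (simp add: \<kappa>_def \<mu>_def)
    fix n
    show "Re (\<rho> n) \<le> 0"
      using T(1)[of n] B[of n] by (cases "good n") (simp_all add: \<rho>_def)
    show "cmod (\<rho> n) \<le> freq a b n"
    proof (cases "good n")
      case True
      have "2 * (\<mu> n)\<^sup>2 / T n \<le> 2 * (\<mu> n)\<^sup>2 / (2 * \<mu> n)"
        using T(2)[OF True] \<mu>[of n] by (intro divide_left_mono) auto
      also have "\<dots> = \<mu> n" using \<mu>[of n] by (simp add: power2_eq_square)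
      finally show ?thesis
        using True T(1)[OF True] B[of n] by (simp add: \<rho>_def norm_divide norm_mult norm_power \<mu>_def)
    qed (use \<mu>[of n] in \<open>simp add: \<rho>_def \<mu>_def\<close>)
    assume "\<kappa> n \<noteq> 0"
    then have g: "good n" by (rule contrapos_np) (simp add: \<kappa>_def)
    have T0: "T n \<noteq> 0" using T(1)[OF g] B[of n] by simp
    have "(sqrt ((B n)\<^sup>2 - 4 * (\<mu> n)\<^sup>2))\<^sup>2 = (B n)\<^sup>2 - 4 * (\<mu> n)\<^sup>2" using disc[OF g] by simp
    then have quad: "(T n)\<^sup>2 - 2 * B n * T n + 4 * (\<mu> n)\<^sup>2 = 0"
      by (simp add: T_def power2_eq_square algebra_simps)
    \<comment> \<open>The substitution \<open>\<rho> = - 2 \<mu>\<^sup>2 / T\<close> turns the characteristic equation into this equation for \<open>T\<close>.\<close>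
    have "(- (2 * (\<mu> n)\<^sup>2 / T n))\<^sup>2 + B n * (- (2 * (\<mu> n)\<^sup>2 / T n)) + (\<mu> n)\<^sup>2
        = (\<mu> n)\<^sup>2 / (T n)\<^sup>2 * ((T n)\<^sup>2 - 2 * B n * T n + 4 * (\<mu> n)\<^sup>2)"
      using T0 by (simp add: field_simps power2_eq_square)
    then have real_root: "(- (2 * (\<mu> n)\<^sup>2 / T n))\<^sup>2 + B n * (- (2 * (\<mu> n)\<^sup>2 / T n)) + (\<mu> n)\<^sup>2 = 0"
      by (simp only: quad mult_zero_right)
    have "(\<rho> n)\<^sup>2 + of_real (B n) * \<rho> n + of_real ((\<mu> n)\<^sup>2)
        = of_real ((- (2 * (\<mu> n)\<^sup>2 / T n))\<^sup>2 + B n * (- (2 * (\<mu> n)\<^sup>2 / T n)) + (\<mu> n)\<^sup>2)"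
      using g by (simp only: \<rho>_def if_True of_real_add of_real_mult of_real_power)
    also have "\<dots> = 0" unfolding real_root by simp
    finally show "(\<rho> n)\<^sup>2 + of_real (c * (freq a b n)\<^sup>2 powr \<alpha>) * \<rho> n + of_real ((freq a b n)\<^sup>2) = 0"
      unfolding freq_square_powr[OF assms(1)] by (simp add: B_def \<mu>_def)
  qed (use assms in auto)
  have "\<forall>\<^sub>F x::real in at_top. 2 * x \<le> c * x powr (2 * \<alpha>)"
  proof (cases "\<alpha> = 1 / 2")
    case True
    then have "2 * \<alpha> = 1" "2 \<le> c" using crit by simp_all
    show ?thesis
      using eventually_gt_at_top[of 0]
    proof eventually_elim
      case (elim x)
      then show ?case using \<open>2 * \<alpha> = 1\<close> \<open>2 \<le> c\<close> by simp
    qed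
  next
    case False
    then have "filterlim (\<lambda>x::real. x powr (2 * \<alpha> - 1)) at_top at_top" using assms(3) by real_asymp
    then have "\<forall>\<^sub>F x::real in at_top. 2 / c \<le> x powr (2 * \<alpha> - 1)"
      unfolding filterlim_at_top by blast
    then show ?thesis
      using eventually_gt_at_top[of 0]
    proof eventually_elim
      case (elim x)
      have "x powr (2 * \<alpha>) = x * x powr (2 * \<alpha> - 1)"
        using elim(2) by (simp add: powr_diff)
      then show ?case using elim assms(2) by (simp add: field_simps)
    qed
  qed
  from eventually_compose_filterlim[OF this freq_at_top[OF assms(1)]]
  obtain N0 where N0: "\<And>n. n \<ge> N0 \<Longrightarrow> 2 * \<mu> n \<le> B n"
    unfolding B_def \<mu>_def eventually_sequentially by blast
  have "\<exists>\<^sub>F n in sequentially. good n"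
  proof (rule frequentlyI_unbounded)
    fix N
    have "4 dvd Suc (4 * (N + N0) + 3)" by presburger
    then have "good (4 * (N + N0) + 3)" using N0[of "4 * (N + N0) + 3"] by (simp add: good_def)
    then show "\<exists>n\<ge>N. good n" by (intro exI[of _ "4 * (N + N0) + 3"]) simp
  qed
  then have "\<exists>\<^sub>F n in sequentially. 1 * exp (- (1 + 2 * t / c) * freq a b n powr \<sigma>)
      \<le> \<bar>damped_modes.amplitude \<kappa> \<rho> 0 t n\<bar>" if "t > 0" for t
  proof (rule frequently_elim1)
    fix n assume g: "good n"
    have "2 * (\<mu> n)\<^sup>2 / T n \<le> 2 * (\<mu> n)\<^sup>2 / B n"
      using T(1)[OF g] B[of n] by (intro divide_left_mono) (auto intro: mult_pos_pos)
    also have "\<dots> = 2 / c * \<mu> n powr \<sigma>"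
    proof -
      have "\<mu> n powr \<sigma> = (\<mu> n)\<^sup>2 / \<mu> n powr (2 * \<alpha>)"
        using \<mu>[of n] by (simp add: \<sigma> powr_diff right_diff_distrib)
      then show ?thesis by (simp add: B_def)
    qed
    finally have "2 * (\<mu> n)\<^sup>2 / T n * t \<le> 2 / c * \<mu> n powr \<sigma> * t"
      using that by (intro mult_right_mono) auto
    moreover have exponent: "- (1 + 2 * t / c) * \<mu> n powr \<sigma> = - (\<mu> n powr \<sigma>) - 2 / c * \<mu> n powr \<sigma> * t"
      by (simp add: algebra_simps)
    ultimately have "exp (- (1 + 2 * t / c) * \<mu> n powr \<sigma>) \<le> exp (- (\<mu> n powr \<sigma>) + - (2 * (\<mu> n)\<^sup>2 / T n) * t)"
      unfolding exponent exp_le_cancel_iff by (simp only: mult_minus_left)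
    also have "\<dots> = \<bar>damped_modes.amplitude \<kappa> \<rho> 0 t n\<bar>"
    proof -
      have "damped_modes.amplitude \<kappa> \<rho> 0 t n
          = Re (complex_of_real (exp (- (\<mu> n powr \<sigma>))) * exp (complex_of_real (- (2 * (\<mu> n)\<^sup>2 / T n) * t)))"
        using g by (simp add: damped_modes.amplitude_def[OF modes] \<kappa>_def \<rho>_def)
      also have "\<dots> = exp (- (\<mu> n powr \<sigma>)) * exp (- (2 * (\<mu> n)\<^sup>2 / T n) * t)"
        unfolding exp_of_real of_real_mult[symmetric] by (rule Re_complex_of_real)
      finally show ?thesis by (simp only: exp_add abs_mult abs_exp_cancel)
    qed
    finally show "1 * exp (- (1 + 2 * t / c) * freq a b n powr \<sigma>) \<le> \<bar>damped_modes.amplitude \<kappa> \<rho> 0 t n\<bar>"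
      by (simp only: \<mu>_def mult_1)
  qed
  then have "\<forall>t>0. decays_slowly a b \<sigma> (damped_modes.amplitude \<kappa> \<rho> 0 t)"
    unfolding decays_slowly_def by (intro allI impI exI[of _ 1] conjI zero_less_one exI)
  moreover have "\<forall>n. \<kappa> n \<noteq> 0 \<longrightarrow> 4 dvd Suc n" by (simp add: \<kappa>_def good_def)
  ultimately show ?thesis using modes by (intro exI conjI)
qed

lemma increment_tendsto:
  fixes f f' :: "real \<Rightarrow> real"
  assumes deriv: "\<forall>\<^sub>F x in at_top. (f has_real_derivative f' x) (at x)"
    and lim: "(f' \<longlongrightarrow> l) at_top" and "h > 0"
  shows "((\<lambda>x. f (x + h) - f x) \<longlongrightarrow> h * l) at_top"
proof (rule tendstoI)
  fix e :: real assume "e > 0"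
  then have "\<forall>\<^sub>F x in at_top. dist (f' x) l < e / h"
    using lim \<open>h > 0\<close> by (intro tendstoD) auto
  from eventually_conj[OF deriv this] obtain X where
    X: "\<And>x. x \<ge> X \<Longrightarrow> (f has_real_derivative f' x) (at x) \<and> dist (f' x) l < e / h"
    unfolding eventually_at_top_linorder by blast
  show "\<forall>\<^sub>F x in at_top. dist (f (x + h) - f x) (h * l) < e"
    using eventually_ge_at_top[of X]
  proof eventually_elim
    case (elim x)
    obtain z where z: "x < z" "f (x + h) - f x = (x + h - x) * f' z"
      using MVT2[of x "x + h" f f'] X elim \<open>h > 0\<close> by auto
    then have "dist (f (x + h) - f x) (h * l) = h * dist (f' z) l"
      using \<open>h > 0\<close> by (simp add: dist_real_def abs_mult flip: right_diff_distrib)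
    also have "\<dots> < e" using X[of z] z(1) elim \<open>h > 0\<close> by (simp add: pos_less_divide_eq mult.commute)
    finally show ?case .
  qed
qed

text \<open>The derivative of \<open>\<omega>\<close> converges, so the increments of \<open>\<omega>\<close> over steps of length \<open>h\<close>
  converge and their differences tend to \<open>0\<close>. In the borderline case \<open>p = 2\<close> the function \<open>\<omega>\<close> is
  linear.\<close>

lemma frequency_second_difference:
  fixes k p h :: real
  assumes "h > 0" "p < 2 \<or> p = 2 \<and> k < 1"
  defines "\<omega> \<equiv> \<lambda>x. sqrt (x\<^sup>2 - k * x powr p)"
  shows "((\<lambda>x. \<omega> x - 2 * \<omega> (x + h) + \<omega> (x + h + h)) \<longlongrightarrow> 0) at_top"
    and "\<forall>\<^sub>F x in at_top. x\<^sup>2 - k * x powr p > 0"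
proof -
  have "\<exists>L. ((\<lambda>x::real. x powr (p - 2)) \<longlongrightarrow> L) at_top \<and> k * L < 1"
  proof (cases "p < 2")
    case True
    then have "((\<lambda>x::real. x powr (p - 2)) \<longlongrightarrow> 0) at_top" by real_asymp
    then show ?thesis by (intro exI[of _ 0]) simp
  next
    case False
    then have p: "p = 2" "k < 1" using assms(2) by auto
    have "((\<lambda>x::real. x powr (p - 2)) \<longlongrightarrow> 1) at_top"
    proof (rule Lim_transform_eventually[OF tendsto_const])
      show "\<forall>\<^sub>F x::real in at_top. 1 = x powr (p - 2)"
        using eventually_gt_at_top[of 0] by eventually_elim (simp add: p)
    qed
    then show ?thesis using p(2) by (intro exI[of _ 1]) simp
  qed
  then obtain L where L: "((\<lambda>x::real. x powr (p - 2)) \<longlongrightarrow> L) at_top" "k * L < 1" by blast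
  have split: "x\<^sup>2 - k * x powr p = x\<^sup>2 * (1 - k * x powr (p - 2))" if "x > 0" for x
    using that by (simp add: powr_diff right_diff_distrib)
  have "((\<lambda>x. 1 - k * x powr (p - 2)) \<longlongrightarrow> 1 - k * L) at_top" by (intro tendsto_intros L(1))
  then have "\<forall>\<^sub>F x in at_top. 0 < 1 - k * x powr (p - 2)"
    using L(2) by (intro order_tendstoD) auto
  then have ev: "\<forall>\<^sub>F x in at_top. x > 0 \<and> 0 < 1 - k * x powr (p - 2)"
    using eventually_gt_at_top[of 0] by eventually_elim simp
  then show pos: "\<forall>\<^sub>F x in at_top. x\<^sup>2 - k * x powr p > 0"
    by eventually_elim (simp add: split)
  define \<omega>' where "\<omega>' x = (2 * x - k * (p * x powr (p - 1))) / (2 * sqrt (x\<^sup>2 - k * x powr p))" for x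
  have "\<forall>\<^sub>F x in at_top. (\<omega> has_real_derivative \<omega>' x) (at x)"
    using ev pos
  proof eventually_elim
    case (elim x)
    then show ?case
      unfolding \<omega>_def \<omega>'_def
      by (auto intro!: derivative_eq_intros simp: field_simps)
  qed
  moreover have "(\<omega>' \<longlongrightarrow> (2 - k * (p * L)) / (2 * sqrt (1 - k * L))) at_top"
  proof (rule Lim_transform_eventually)
    show "((\<lambda>x. (2 - k * (p * x powr (p - 2))) / (2 * sqrt (1 - k * x powr (p - 2))))
        \<longlongrightarrow> (2 - k * (p * L)) / (2 * sqrt (1 - k * L))) at_top"
      using L(2) by (intro tendsto_intros L(1)) auto
    show "\<forall>\<^sub>F x in at_top. (2 - k * (p * x powr (p - 2))) / (2 * sqrt (1 - k * x powr (p - 2))) = \<omega>' x"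
      using ev
    proof eventually_elim
      case (elim x)
      have num: "2 * x - k * (p * x powr (p - 1)) = x * (2 - k * (p * x powr (p - 2)))"
      proof -
        have "x powr (p - 1) = x * x powr (p - 2)"
          using elim by (simp add: powr_diff power2_eq_square)
        then show ?thesis by (simp add: algebra_simps)
      qed
      have den: "sqrt (x\<^sup>2 - k * x powr p) = x * sqrt (1 - k * x powr (p - 2))"
        using elim by (simp add: split real_sqrt_mult)
      show ?case unfolding \<omega>'_def num den using elim by simp
    qed
  qed
  ultimately have inc: "((\<lambda>x. \<omega> (x + h) - \<omega> x) \<longlongrightarrow> h * ((2 - k * (p * L)) / (2 * sqrt (1 - k * L)))) at_top"
    by (rule increment_tendsto[OF _ _ assms(1)])
  have "filterlim (\<lambda>x. x + h) at_top (at_top :: real filter)" by real_asymp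
  from tendsto_diff[OF filterlim_compose[OF inc this] inc]
  show "((\<lambda>x. \<omega> x - 2 * \<omega> (x + h) + \<omega> (x + h + h)) \<longlongrightarrow> 0) at_top"
    by (simp add: algebra_simps)
qed

text \<open>Three angles in nearly arithmetic progression cannot all be bad: if \<open>cos x\<close>, \<open>cos y\<close> and \<open>sin z\<close>
  were small, then \<open>x + z\<close> would be close to an odd multiple of \<open>\<pi> / 2\<close> and \<open>2 y\<close> close to an odd
  multiple of \<open>\<pi>\<close>.\<close>

lemma cos_cos_sin_not_all_small:
  fixes x y z :: real
  assumes "1 / 2 < cos (x - 2 * y + z)"
  shows "1 / 8 \<le> \<bar>cos x\<bar> \<or> 1 / 8 \<le> \<bar>cos y\<bar> \<or> 1 / 8 \<le> \<bar>sin z\<bar>"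
proof (rule ccontr)
  assume "\<not> (1 / 8 \<le> \<bar>cos x\<bar> \<or> 1 / 8 \<le> \<bar>cos y\<bar> \<or> 1 / 8 \<le> \<bar>sin z\<bar>)"
  then have small: "\<bar>cos x\<bar> < 1 / 8" "\<bar>cos y\<bar> < 1 / 8" "\<bar>sin z\<bar> < 1 / 8" by auto
  have le: "\<bar>s * t\<bar> \<le> \<bar>s\<bar>" if "\<bar>t\<bar> \<le> 1" for s t :: real
    using mult_left_mono[OF that abs_ge_zero[of s]] by (simp add: abs_mult)
  have "\<bar>cos (x + z)\<bar> \<le> \<bar>cos x * cos z\<bar> + \<bar>sin z * sin x\<bar>"
    unfolding cos_add mult.commute[of "sin x"] by (rule abs_triangle_ineq4)
  also have "\<dots> \<le> \<bar>cos x\<bar> + \<bar>sin z\<bar>" by (intro add_mono le) auto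
  finally have 1: "\<bar>cos (x + z)\<bar> < 1 / 4" using small by linarith
  have "\<bar>sin (2 * y)\<bar> = 2 * \<bar>cos y * sin y\<bar>" by (simp add: sin_double abs_mult)
  then have 2: "\<bar>sin (2 * y)\<bar> < 1 / 4" using le[of "sin y" "cos y"] small by simp
  have "x - 2 * y + z = (x + z) - 2 * y" by simp
  then have "cos (x - 2 * y + z) = cos (x + z) * cos (2 * y) + sin (2 * y) * sin (x + z)"
    by (simp only: cos_diff mult.commute[of "sin (2 * y)"])
  moreover have "\<bar>cos (x + z) * cos (2 * y)\<bar> \<le> \<bar>cos (x + z)\<bar>" "\<bar>sin (2 * y) * sin (x + z)\<bar> \<le> \<bar>sin (2 * y)\<bar>"
    by (intro le; simp)+
  ultimately show False using assms 1 2 by linarith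
qed

text \<open>The amplitude of a single oscillating mode vanishes at some times. So every third mode gets a
  sine instead of a cosine: the second differences of the angles tend to \<open>0\<close>, hence in every
  block of three modes that lies far enough out, one of them is not small.\<close>

lemma oscillating_modes:
  assumes "a < b" "0 < c" "0 < \<alpha>" "\<alpha> \<le> 1 / 2" and crit: "\<alpha> = 1 / 2 \<longrightarrow> c < 2"
    and \<sigma>: "\<sigma> = 2 * \<alpha>"
  shows "\<exists>\<kappa> \<rho>. damped_modes a b c \<alpha> \<kappa> \<rho> \<and> (\<forall>n. \<kappa> n \<noteq> 0 \<longrightarrow> 4 dvd Suc n) \<and>
    (\<forall>t>0. decays_slowly a b \<sigma> (damped_modes.amplitude \<kappa> \<rho> 0 t))"
proof -
  define k where "k = c\<^sup>2 / 4"
  define \<omega> where "\<omega> x = sqrt (x\<^sup>2 - k * x powr (2 * \<sigma>))" for x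
  define \<mu> where "\<mu> = freq a b"
  define B where "B n = c * \<mu> n powr \<sigma>" for n
  define good where "good n \<longleftrightarrow> 4 dvd Suc n \<and> (\<mu> n)\<^sup>2 - k * \<mu> n powr (2 * \<sigma>) > 0" for n
  define \<rho> where "\<rho> n = (if good n then Complex (- (B n / 2)) (\<omega> (\<mu> n)) else 0)" for n
  define \<zeta> where "\<zeta> n = (if 12 dvd Suc n then \<i> else 1)" for n
  define \<kappa> where "\<kappa> n = (if good n then \<zeta> n * complex_of_real (exp (- (\<mu> n powr \<sigma>))) else 0)" for n
  have \<sigma>0: "\<sigma> > 0" using assms(3) \<sigma> by simp
  have \<mu>: "\<mu> n > 0" for n unfolding \<mu>_def by (rule freq_pos[OF assms(1)])
  have B: "B n > 0" for n using assms(2) \<mu>[of n] by (simp add: B_def)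
  have B2: "(B n / 2)\<^sup>2 = k * \<mu> n powr (2 * \<sigma>)" for n
    using \<mu>[of n] by (simp add: B_def k_def power_mult_distrib power_divide powr_power mult.commute)
  have \<omega>2: "(\<omega> (\<mu> n))\<^sup>2 = (\<mu> n)\<^sup>2 - (B n / 2)\<^sup>2" if "good n" for n
    using that by (simp add: \<omega>_def good_def B2)
  have modes: "damped_modes a b c \<alpha> \<kappa> \<rho>"
  proof
    show "rapid a b (\<lambda>n. cmod (\<kappa> n))"
      by (rule rapid_bounded[OF rapid_exp_powr[OF assms(1) \<sigma>0] assms(1), where K = 1])
         (simp add: \<kappa>_def \<mu>_def \<zeta>_def norm_mult)
    fix n
    show "Re (\<rho> n) \<le> 0" using B[of n] by (simp add: \<rho>_def)
    show "cmod (\<rho> n) \<le> freq a b n"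
    proof (cases "good n")
      case True
      have "cmod (\<rho> n) = sqrt ((\<mu> n)\<^sup>2)"
        using True \<omega>2[OF True] by (simp add: \<rho>_def cmod_def)
      then show ?thesis using \<mu>[of n] by (simp add: \<mu>_def)
    qed (use \<mu>[of n] in \<open>simp add: \<rho>_def \<mu>_def\<close>)
    assume "\<kappa> n \<noteq> 0"
    then have g: "good n" by (rule contrapos_np) (simp add: \<kappa>_def)
    have "(\<rho> n)\<^sup>2 + of_real (B n) * \<rho> n + of_real ((\<mu> n)\<^sup>2) = 0"
      using \<omega>2[OF g] g
      by (simp add: \<rho>_def complex_eq_iff power2_eq_square algebra_simps)
    then show "(\<rho> n)\<^sup>2 + of_real (c * (freq a b n)\<^sup>2 powr \<alpha>) * \<rho> n + of_real ((freq a b n)\<^sup>2) = 0"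
      unfolding freq_square_powr[OF assms(1)] by (simp add: B_def \<mu>_def \<sigma>)
  qed (use assms in auto)
  have amp: "\<bar>damped_modes.amplitude \<kappa> \<rho> 0 t n\<bar> = exp (- (1 + c * t / 2) * \<mu> n powr \<sigma>) *
      (if 12 dvd Suc n then \<bar>sin (\<omega> (\<mu> n) * t)\<bar> else \<bar>cos (\<omega> (\<mu> n) * t)\<bar>)" if g: "good n" for n t
  proof -
    have "exp (- (1 + c * t / 2) * \<mu> n powr \<sigma>) = exp (- (\<mu> n powr \<sigma>)) * exp (- (B n / 2) * t)"
      by (simp add: B_def algebra_simps flip: exp_add)
    moreover have "exp (\<rho> n * of_real t) = of_real (exp (- (B n / 2) * t)) * Complex (cos (\<omega> (\<mu> n) * t)) (sin (\<omega> (\<mu> n) * t))"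
      using g by (simp add: \<rho>_def exp_eq_polar complex_eq_iff Re_exp Im_exp)
    ultimately show ?thesis
      using g by (simp add: damped_modes.amplitude_def[OF modes] \<kappa>_def \<zeta>_def abs_mult)
  qed
  define h where "h = 4 * pi / (b - a)"
  have h: "h > 0" using assms(1) by (simp add: h_def)
  have kp: "2 * \<sigma> < 2 \<or> 2 * \<sigma> = 2 \<and> k < 1"
  proof (cases "\<alpha> = 1 / 2")
    case True
    then have "c\<^sup>2 < 2\<^sup>2" using crit assms(2) by (intro power_strict_mono) auto
    then show ?thesis using True by (simp add: \<sigma> k_def)
  qed (use assms(4) in \<open>simp add: \<sigma>\<close>)
  have diff2: "((\<lambda>x. \<omega> x - 2 * \<omega> (x + h) + \<omega> (x + h + h)) \<longlongrightarrow> 0) at_top"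
    and pos: "\<forall>\<^sub>F x in at_top. x\<^sup>2 - k * x powr (2 * \<sigma>) > 0"
    unfolding \<omega>_def by (rule frequency_second_difference[OF h kp])+
  from eventually_compose_filterlim[OF pos freq_at_top[OF assms(1)]]
  obtain N0 where N0: "\<And>n. n \<ge> N0 \<Longrightarrow> (\<mu> n)\<^sup>2 - k * \<mu> n powr (2 * \<sigma>) > 0"
    unfolding \<mu>_def eventually_sequentially by blast
  have "\<exists>\<^sub>F n in sequentially. 1 / 8 * exp (- (1 + c * t / 2) * freq a b n powr \<sigma>)
      \<le> \<bar>damped_modes.amplitude \<kappa> \<rho> 0 t n\<bar>" if "t > 0" for t
  proof (rule frequentlyI_unbounded)
    fix N
    have "((\<lambda>x. cos ((\<omega> x - 2 * \<omega> (x + h) + \<omega> (x + h + h)) * t)) \<longlongrightarrow> cos (0 * t)) at_top"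
      by (intro tendsto_intros diff2)
    then have "\<forall>\<^sub>F x in at_top. 1 / 2 < cos ((\<omega> x - 2 * \<omega> (x + h) + \<omega> (x + h + h)) * t)"
      by (rule order_tendstoD) simp
    from eventually_compose_filterlim[OF this freq_at_top[OF assms(1)]]
    obtain N1 where N1: "\<And>n. n \<ge> N1 \<Longrightarrow>
        1 / 2 < cos ((\<omega> (\<mu> n) - 2 * \<omega> (\<mu> n + h) + \<omega> (\<mu> n + h + h)) * t)"
      unfolding \<mu>_def eventually_sequentially by blast
    \<comment> \<open>A block of three consecutive modes: \<open>Suc m\<close>, \<open>Suc (m + 4)\<close> and \<open>Suc (m + 8)\<close> are congruent to
      \<open>4\<close>, \<open>8\<close> and \<open>0\<close> modulo \<open>12\<close>, so the first two carry a cosine and the last one a sine.\<close>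
    define m where "m = 12 * (N + N0 + N1) + 3"
    have shift: "\<mu> n + h = \<mu> (n + 4)" for n
      unfolding \<mu>_def freq_def h_def add_divide_distrib[symmetric] by (simp add: algebra_simps)
    have shift2: "\<mu> (m + 4) + h = \<mu> (m + 8)" using shift[of "m + 4"] by (simp add: add.commute)
    have "N1 \<le> m" by (simp add: m_def)
    then have "1 / 2 < cos (\<omega> (\<mu> m) * t - 2 * (\<omega> (\<mu> (m + 4)) * t) + \<omega> (\<mu> (m + 8)) * t)"
      using N1[of m] unfolding shift[of m] shift2 by (simp only: left_diff_distrib distrib_right mult.assoc)
    note small = cos_cos_sin_not_all_small[OF this]
    have dvd: "\<not> 12 dvd Suc m" "\<not> 12 dvd Suc (m + 4)" "12 dvd Suc (m + 8)"
      unfolding m_def by presburger+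
    have "\<exists>n\<in>{m, m + 4, m + 8}.
        1 / 8 \<le> (if 12 dvd Suc n then \<bar>sin (\<omega> (\<mu> n) * t)\<bar> else \<bar>cos (\<omega> (\<mu> n) * t)\<bar>)"
      using small by (simp only: bex_simps dvd if_True if_False simp_thms)
    then obtain n where n: "n \<in> {m, m + 4, m + 8}"
      "1 / 8 \<le> (if 12 dvd Suc n then \<bar>sin (\<omega> (\<mu> n) * t)\<bar> else \<bar>cos (\<omega> (\<mu> n) * t)\<bar>)" ..
    have "4 dvd Suc m" "4 dvd Suc (m + 4)" "4 dvd Suc (m + 8)" unfolding m_def by presburger+
    then have "4 dvd Suc n" using n(1) by blast
    moreover have "N \<le> n" "N0 \<le> n" using n(1) by (auto simp: m_def)
    ultimately have g: "good n" using N0 by (simp add: good_def)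
    have "1 / 8 * exp (- (1 + c * t / 2) * \<mu> n powr \<sigma>) \<le> \<bar>damped_modes.amplitude \<kappa> \<rho> 0 t n\<bar>"
      unfolding amp[OF g] mult.commute[of "1 / 8"] by (rule mult_left_mono[OF n(2)]) simp
    then show "\<exists>n\<ge>N. 1 / 8 * exp (- (1 + c * t / 2) * freq a b n powr \<sigma>)
        \<le> \<bar>damped_modes.amplitude \<kappa> \<rho> 0 t n\<bar>"
      using \<open>N \<le> n\<close> unfolding \<mu>_def by (intro exI[of _ n] conjI)
  qed
  then have "\<forall>t>0. decays_slowly a b \<sigma> (damped_modes.amplitude \<kappa> \<rho> 0 t)"
    unfolding decays_slowly_def
    by (intro allI impI exI[of _ "1 / 8"] exI[of _ "1 + c * _ / 2"] conjI) simp_all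
  moreover have "\<forall>n. \<kappa> n \<noteq> 0 \<longrightarrow> 4 dvd Suc n" by (simp add: \<kappa>_def good_def)
  ultimately show ?thesis using modes by (intro exI conjI)
qed

section \<open>Solutions that are not Gevrey regular\<close>

lemma (in damped_modes) solution_not_gevrey:
  assumes "0 < r" "0 < \<sigma>" "r < 1 / \<sigma>" and four: "\<And>n. \<kappa> n \<noteq> 0 \<Longrightarrow> 4 dvd Suc n"
    and large: "\<forall>t>0. decays_slowly a b \<sigma> (amplitude 0 t)"
    and t: "t > 0"
  shows "\<not> (\<exists>f. (AE x in leb a b. solution 0 t x = f x) \<and> f \<in> gevrey r {a<..<b})"
proof -
  have four': "4 dvd Suc n" if "amplitude 0 t n \<noteq> 0" for n
  proof (rule four, rule notI)
    assume "\<kappa> n = 0"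
    with that show False by (simp add: amplitude_def)
  qed
  have less: "\<sigma> < 1 / r" using assms(1-3) by (simp add: field_simps)
  show ?thesis
    unfolding solution_def
    by (rule not_gevrey_if_decays_slowly[OF ab rapid_amplitude[OF less_imp_le[OF t]] four' assms(1,2) less])
       (assumption, rule large[rule_format, OF t])
qed

text \<open>For \<open>\<alpha> \<ge> 1/2\<close> the maximum is its second entry, for \<open>\<alpha> \<le> 1/2\<close> the first one. At
  \<open>\<alpha> = 1/2\<close> both agree, and \<open>c\<close> decides whether the modes are overdamped.\<close>

lemma slow_modes_exist:
  assumes "a < b" "0 < c" "0 < \<alpha>" "\<alpha> < 1"
    and s: "s = max (1 / (2 * \<alpha>)) (1 / (2 * (1 - \<alpha>)))"
  shows "\<exists>\<kappa> \<rho> \<sigma>. 0 < \<sigma> \<and> s = 1 / \<sigma> \<and> damped_modes a b c \<alpha> \<kappa> \<rho> \<and> (\<forall>n. \<kappa> n \<noteq> 0 \<longrightarrow> 4 dvd Suc n) \<and>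
    (\<forall>t>0. decays_slowly a b \<sigma> (damped_modes.amplitude \<kappa> \<rho> 0 t))"
proof (cases "1 / 2 < \<alpha> \<or> \<alpha> = 1 / 2 \<and> 2 \<le> c")
  case True
  then have half: "1 / 2 \<le> \<alpha>" and crit: "\<alpha> = 1 / 2 \<longrightarrow> 2 \<le> c" by auto
  from overdamped_modes[OF assms(1,2) half assms(4) crit refl] obtain \<kappa> \<rho> where
    "damped_modes a b c \<alpha> \<kappa> \<rho> \<and> (\<forall>n. \<kappa> n \<noteq> 0 \<longrightarrow> 4 dvd Suc n) \<and>
    (\<forall>t>0. decays_slowly a b (2 * (1 - \<alpha>)) (damped_modes.amplitude \<kappa> \<rho> 0 t))"
    by (elim exE)
  moreover have "s = 1 / (2 * (1 - \<alpha>))"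
    unfolding s using half assms(3,4) by (intro max_absorb2 divide_left_mono) auto
  ultimately show ?thesis
    using assms(4) by (intro exI[of _ \<kappa>] exI[of _ \<rho>] exI[of _ "2 * (1 - \<alpha>)"]) simp
next
  case False
  then have half: "\<alpha> \<le> 1 / 2" and crit: "\<alpha> = 1 / 2 \<longrightarrow> c < 2" by auto
  from oscillating_modes[OF assms(1-3) half crit refl] obtain \<kappa> \<rho> where
    "damped_modes a b c \<alpha> \<kappa> \<rho> \<and> (\<forall>n. \<kappa> n \<noteq> 0 \<longrightarrow> 4 dvd Suc n) \<and>
    (\<forall>t>0. decays_slowly a b (2 * \<alpha>) (damped_modes.amplitude \<kappa> \<rho> 0 t))"
    by (elim exE)
  moreover have "s = 1 / (2 * \<alpha>)"
    unfolding s using half assms(3,4) by (intro max_absorb1 divide_left_mono) auto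
  ultimately show ?thesis
    using assms(3) by (intro exI[of _ \<kappa>] exI[of _ \<rho>] exI[of _ "2 * \<alpha>"]) simp
qed

theorem corollary4p4:
  fixes a b c \<alpha> s :: real and \<Omega> :: "real set"
  assumes "a < b" and "\<Omega> = {a<..<b}"
    and "0 < c" and "0 < \<alpha>" and "\<alpha> < 1"
    and "s = max (1 / (2 * \<alpha>)) (1 / (2 * (1 - \<alpha>)))"
  shows "(\<forall>r. 0 < r \<and> r < s \<longrightarrow>
            (\<exists>u\<^sub>0 u\<^sub>1 u. u\<^sub>0 \<in> H1_0 \<Omega> \<and> u\<^sub>1 \<in> L2 (lebesgue_on \<Omega>) \<and>
               energy_solution \<Omega> c \<alpha> u\<^sub>0 u\<^sub>1 u \<and>
               (\<forall>t>0. \<not> (\<exists>f. (AE x in lebesgue_on \<Omega>. u t x = f x) \<and> f \<in> gevrey r \<Omega>)))) \<and>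
         (\<alpha> \<noteq> 1 / 2 \<longrightarrow>
            (\<exists>u\<^sub>0 u\<^sub>1 u. u\<^sub>0 \<in> H1_0 \<Omega> \<and> u\<^sub>1 \<in> L2 (lebesgue_on \<Omega>) \<and>
               energy_solution \<Omega> c \<alpha> u\<^sub>0 u\<^sub>1 u \<and>
               (\<forall>t>0. \<not> (\<exists>f. (AE x in lebesgue_on \<Omega>. u t x = f x) \<and> real_analytic_on \<Omega> f))))"
proof -
  from slow_modes_exist[OF assms(1,3-6)]
  obtain \<kappa> \<rho> \<sigma> where \<sigma>: "0 < \<sigma>" "s = 1 / \<sigma>" and modes: "damped_modes a b c \<alpha> \<kappa> \<rho>"
    and four: "\<forall>n. \<kappa> n \<noteq> 0 \<longrightarrow> 4 dvd Suc n"
    and large: "\<forall>t>0. decays_slowly a b \<sigma> (damped_modes.amplitude \<kappa> \<rho> 0 t)"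
    by (elim exE conjE)
  interpret damped_modes a b c \<alpha> \<kappa> \<rho> by (rule modes)
  note sol = solution_H1_0[of 0 0, OF order_refl] solution_L2[of 0 1, OF order_refl] energy_solution_solution
  have not_gevrey: "\<forall>t>0. \<not> (\<exists>f. (AE x in lebesgue_on \<Omega>. solution 0 t x = f x) \<and> f \<in> gevrey r \<Omega>)"
    if "0 < r" "r < s" for r
    unfolding assms(2)
    by (intro allI impI solution_not_gevrey[OF that(1) \<sigma>(1) _ _ large]) (use that(2) \<sigma>(2) four in auto)
  show ?thesis
  proof (intro conjI allI impI)
    fix r assume "0 < r \<and> r < s"
    then show "\<exists>u\<^sub>0 u\<^sub>1 u. u\<^sub>0 \<in> H1_0 \<Omega> \<and> u\<^sub>1 \<in> L2 (lebesgue_on \<Omega>) \<and> energy_solution \<Omega> c \<alpha> u\<^sub>0 u\<^sub>1 u \<and>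
        (\<forall>t>0. \<not> (\<exists>f. (AE x in lebesgue_on \<Omega>. u t x = f x) \<and> f \<in> gevrey r \<Omega>))"
      using sol not_gevrey[of r] unfolding assms(2) by (intro exI conjI) auto
  next
    assume "\<alpha> \<noteq> 1 / 2"
    then have "1 < 1 / (2 * \<alpha>) \<or> 1 < 1 / (2 * (1 - \<alpha>))" using assms(4,5) by auto
    then have "1 < s" unfolding assms(6) by (simp add: less_max_iff_disj)
    have "\<not> (\<exists>f. (AE x in lebesgue_on \<Omega>. solution 0 t x = f x) \<and> real_analytic_on \<Omega> f)" if "t > 0" for t
    proof
      assume "\<exists>f. (AE x in lebesgue_on \<Omega>. solution 0 t x = f x) \<and> real_analytic_on \<Omega> f"
      then obtain f where f: "AE x in lebesgue_on \<Omega>. solution 0 t x = f x" "real_analytic_on \<Omega> f" by blast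
      have "open \<Omega>" by (simp add: assms(2))
      then have "f \<in> gevrey 1 \<Omega>" using f(2) by (rule real_analytic_imp_gevrey_1)
      with f(1) not_gevrey[OF zero_less_one \<open>1 < s\<close>] that show False by blast
    qed
    then show "\<exists>u\<^sub>0 u\<^sub>1 u. u\<^sub>0 \<in> H1_0 \<Omega> \<and> u\<^sub>1 \<in> L2 (lebesgue_on \<Omega>) \<and> energy_solution \<Omega> c \<alpha> u\<^sub>0 u\<^sub>1 u \<and>
        (\<forall>t>0. \<not> (\<exists>f. (AE x in lebesgue_on \<Omega>. u t x = f x) \<and> real_analytic_on \<Omega> f))"
      using sol unfolding assms(2) by (intro exI conjI) auto
  qed
qed

end
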